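(* Let $X_0:\Sigma\to M$ be an immersed submanifold (spacelike if $M=\mathbb{R}^{n,k}$) with Gauss map $\rho_0$ and induced metric $g_0=X_0^*\langle\cdot,\cdot\rangle$. Consider the mean curvature flow (MCF) $$\partial_t X = H,\qquad X(0)=X_0,$$ and the harmonic-Ricci flow (HRF) with coupling constant $\alpha=-\epsilon$, $$\partial_t\rho=\tau_g(\rho),\qquad \partial_t g=-2\,\mathrm{Ric}_g+2\alpha\, d\rho\otimes d\rho,\qquad g(0)=g_0,\quad \rho(0)=\rho_0 .$$ Suppose that $X(t)$ is the unique solution of the MCF and $(\rho(t),g(t))$ is the unique solution of the HRF, on a time interval $I=[0,T)$. Then these flows are equivalent in the following sense. (1) For every $t\in I$, the Gauss map and the induced metric of $X(t)$ are exactly $\rho(t)$ and $g(t)$. (2) $X(t)$ can be constructed from $(\rho(t),g(t))$ and $X_0$ as follows: if $\Phi_t(x):T_x\Sigma\to\rho(x,t)$ is the family of isometries determined by $(\rho,g)$ and $dX_0$ through parallel transport in $t$ (defined in the context), then the solution $\tilde X$ of the ODE $$\partial_t\tilde X=\operatorname{tr}_{\Phi}d\rho,\qquad \tilde X(0)=X_0,$$ satisfies $\tilde X(t)=X(t)$ for all $t\in I$.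
   Context: $\Sigma$ is an $n$-dimensional smooth manifold, compact or complete non-compact. $M$ is one of two flat spaces with inner product $\langle\cdot,\cdot\rangle$: Euclidean space $\mathbb{R}^{n+k}$, with sign $\epsilon=1$; or pseudo-Euclidean space $\mathbb{R}^{n,k}$ (positive definite in $n$ directions, negative definite in $k$ directions), with sign $\epsilon=-1$. An immersion into $\mathbb{R}^{n,k}$ is spacelike if its induced metric is positive definite. In the case $M=\mathbb{R}^{n,k}$ the MCF is a flow of spacelike immersions. The second fundamental form is $A(u,v)=(D_u\,dX(v))^\perp$, where $D$ is the flat derivative of $M$ and $\perp$ the projection to the normal bundle, and $H=\operatorname{tr}_gA$ is the mean curvature vector. $G$ is the Grassmannian of oriented $n$-dimensional (spacelike, if $M=\mathbb{R}^{n,k}$) linear subspaces of $M$. With the identification $T_PG=\mathrm{Hom}(P,P^\perp)$, it carries the canonical positive definite metric $g_G(\varphi,\psi)=\epsilon\sum_{i=1}^n\langle\varphi(e_i),\psi(e_i)\rangle$, $\{e_i\}$ an orthonormal basis of $P$. The Gauss map of $X$ is $\rho:\Sigma\to G$, $\rho(x)=dX(T_x\Sigma)$ (with the orientation induced from $\Sigma$). $d\rho\otimes d\rho$ denotes the symmetric 2-tensor $\rho^*g_G$ on $\Sigma$, and $\tau_g(\rho)=\operatorname{tr}_g\nabla d\rho$ is the tension field of $\rho:(\Sigma,g)\to(G,g_G)$. Construction of $\Phi$: for each $x\in\Sigma$, a curve $v(t)\in T_x\Sigma$ is called intrinsically parallel if $\partial_tv^j+\tfrac12g^{jl}(\partial_tg_{il})v^i=0$;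 a curve $w(t)\in\rho(x,t)\subset M$ is called extrinsically parallel if the orthogonal projection of $\partial_tw(t)$ onto $\rho(x,t)$ vanishes. $\Phi_t(x):T_x\Sigma\to\rho(x,t)$ is the linear map with $\Phi_0(x)=dX_0(x)$ that sends intrinsically parallel curves to extrinsically parallel curves; it is an isometry from $(T_x\Sigma,g(t))$ onto $\rho(x,t)$. Finally, $\operatorname{tr}_\Phi d\rho=\sum_{i=1}^n d\rho(E_i)\big(\Phi_t(E_i)\big)\in\rho(x,t)^\perp\subset M$ for a $g(t)$-orthonormal basis $\{E_i\}$ of $T_x\Sigma$, where $d\rho(E_i)\in\mathrm{Hom}(\rho(x,t),\rho(x,t)^\perp)$. *)

theory Defs
  imports "HOL-Analysis.Analysis"
begin

section \<open>Calculus in coordinates\<close>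

text \<open>All derivatives are taken within the domain. The domains used below are open sets, or relatively
  open subsets of (open set) \<open>\<times> [0,T)\<close>; on these the derivative within the domain is unique, so that
  one-sided time derivatives at \<open>t = 0\<close> are included.\<close>

primrec Ck_on :: "nat \<Rightarrow> 'v::real_normed_vector set \<Rightarrow> ('v \<Rightarrow> 'w::real_normed_vector) \<Rightarrow> bool" where
  "Ck_on 0 S f \<longleftrightarrow> continuous_on S f"
| "Ck_on (Suc k) S f \<longleftrightarrow> (\<forall>p\<in>S. f differentiable (at p within S)) \<and>
     (\<forall>v. Ck_on k S (\<lambda>p. frechet_derivative f (at p within S) v))"

definition smooth_on :: "'v::real_normed_vector set \<Rightarrow> ('v \<Rightarrow> 'w::real_normed_vector) \<Rightarrow> bool" where
  "smooth_on S f \<longleftrightarrow> (\<forall>k. Ck_on k S f)"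

abbreviation Dd :: "('v::real_normed_vector \<Rightarrow> 'w::real_normed_vector) \<Rightarrow> 'v \<Rightarrow> 'v \<Rightarrow> 'w" where
  "Dd f p \<equiv> frechet_derivative f (at p)"

text \<open>A Riemannian metric in coordinates is \<open>h p u v\<close>: base point, then two vectors.
  \<open>christoffel h p u v\<close> is the vector \<open>u\<^sup>i v\<^sup>j \<Gamma>\<^sup>k\<^sub>i\<^sub>j e\<^sub>k\<close>, i.e. the Levi-Civita derivative of
  the constant coordinate field \<open>v\<close> in direction \<open>u\<close>, given by the Koszul formula.\<close>

definition christoffel ::
  "('e::euclidean_space \<Rightarrow> 'e \<Rightarrow> 'e \<Rightarrow> real) \<Rightarrow> 'e \<Rightarrow> 'e \<Rightarrow> 'e \<Rightarrow> 'e" where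
  "christoffel h p u v = (THE z. \<forall>w. h p z w =
     (Dd (\<lambda>q. h q v w) p u + Dd (\<lambda>q. h q u w) p v - Dd (\<lambda>q. h q u v) p w) / 2)"

text \<open>\<open>riemann h p u v w\<close> is \<open>R(u,v)w = \<nabla>\<^sub>u\<nabla>\<^sub>v w - \<nabla>\<^sub>v\<nabla>\<^sub>u w\<close> for constant coordinate fields;
  \<open>ricci h p v w\<close> is the trace of \<open>u \<mapsto> R(u,v)w\<close> (positive on round spheres).\<close>

definition riemann ::
  "('e::euclidean_space \<Rightarrow> 'e \<Rightarrow> 'e \<Rightarrow> real) \<Rightarrow> 'e \<Rightarrow> 'e \<Rightarrow> 'e \<Rightarrow> 'e \<Rightarrow> 'e" where
  "riemann h p u v w =
     Dd (\<lambda>q. christoffel h q v w) p u - Dd (\<lambda>q. christoffel h q u w) p v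
     + christoffel h p u (christoffel h p v w) - christoffel h p v (christoffel h p u w)"

definition ricci ::
  "(real^'n \<Rightarrow> real^'n \<Rightarrow> real^'n \<Rightarrow> real) \<Rightarrow> real^'n \<Rightarrow> real^'n \<Rightarrow> real^'n \<Rightarrow> real" where
  "ricci h p v w = (\<Sum>i\<in>UNIV. riemann h p (axis i 1) v w $ i)"

definition inv_metric :: "(real^'n \<Rightarrow> real^'n \<Rightarrow> real) \<Rightarrow> real^'n^'n" where
  "inv_metric G = matrix_inv (\<chi> i j. G (axis i 1) (axis j 1))"

definition tr_metric ::
  "(real^'n \<Rightarrow> real^'n \<Rightarrow> real) \<Rightarrow> (real^'n \<Rightarrow> real^'n \<Rightarrow> 'w::real_vector) \<Rightarrow> 'w" where
  "tr_metric G B = (\<Sum>i\<in>UNIV. \<Sum>j\<in>UNIV. (inv_metric G $ i $ j) *\<^sub>R B (axis i 1) (axis j 1))"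

text \<open>The tension field \<open>tr\<^sub>g \<nabla>df\<close> of a map \<open>f\<close> (in coordinates of both manifolds) from the metric
  \<open>g\<close> to the metric \<open>h\<close>.\<close>

definition tension ::
  "('e::euclidean_space \<Rightarrow> 'e \<Rightarrow> 'e \<Rightarrow> real) \<Rightarrow> (real^'n \<Rightarrow> real^'n \<Rightarrow> real^'n \<Rightarrow> real) \<Rightarrow>
   (real^'n \<Rightarrow> 'e) \<Rightarrow> real^'n \<Rightarrow> 'e" where
  "tension h g f p = tr_metric (g p) (\<lambda>u v.
     Dd (\<lambda>q. Dd f q v) p u - Dd f p (christoffel g p u v)
     + christoffel h (f p) (Dd f p u) (Dd f p v))"


section \<open>Oriented smooth manifolds\<close>

type_synonym ('a, 'n) chart = "'a set \<times> ('a \<Rightarrow> real^'n)"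

abbreviation cimage :: "('a, 'n::finite) chart \<Rightarrow> (real^'n) set" where
  "cimage c \<equiv> snd c ` fst c"

abbreviation cinv :: "('a, 'n::finite) chart \<Rightarrow> real^'n \<Rightarrow> 'a" where
  "cinv c \<equiv> inv_into (fst c) (snd c)"

definition second_countable_space :: "'a topology \<Rightarrow> bool" where
  "second_countable_space S \<longleftrightarrow> (\<exists>\<B>. countable \<B> \<and> (\<forall>V\<in>\<B>. openin S V) \<and>
     (\<forall>U x. openin S U \<and> x \<in> U \<longrightarrow> (\<exists>V\<in>\<B>. x \<in> V \<and> V \<subseteq> U)))"

definition oriented_manifold :: "'a topology \<Rightarrow> ('a, 'n::finite) chart set \<Rightarrow> bool" where
  "oriented_manifold S \<A> \<longleftrightarrow>
     Hausdorff_space S \<and> second_countable_space S \<and> (\<Union>c\<in>\<A>. fst c) = topspace S \<and>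
     (\<forall>c\<in>\<A>. openin S (fst c) \<and> open (cimage c) \<and>
        homeomorphic_map (subtopology S (fst c)) (top_of_set (cimage c)) (snd c)) \<and>
     (\<forall>c\<in>\<A>. \<forall>c'\<in>\<A>. smooth_on (snd c ` (fst c \<inter> fst c')) (snd c' \<circ> cinv c) \<and>
        (\<forall>x\<in>fst c \<inter> fst c'. det (matrix (Dd (snd c' \<circ> cinv c) (snd c x))) > 0))"

text \<open>A tangent vector at \<open>x\<close> is the family of its components in all charts around \<open>x\<close>,
  related by the Jacobians of the transition maps, and set to \<open>0\<close> for the other charts.\<close>

type_synonym ('a, 'n) tvec = "('a, 'n) chart \<Rightarrow> real^'n"

definition tangent_space :: "('a, 'n::finite) chart set \<Rightarrow> 'a \<Rightarrow> ('a, 'n) tvec set" where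
  "tangent_space \<A> x = {v.
     (\<forall>c\<in>\<A>. \<forall>c'\<in>\<A>. x \<in> fst c \<inter> fst c' \<longrightarrow> v c' = Dd (snd c' \<circ> cinv c) (snd c x) (v c)) \<and>
     (\<forall>c. c \<notin> \<A> \<or> x \<notin> fst c \<longrightarrow> v c = 0)}"

definition tlin :: "real \<Rightarrow> ('a, 'n::finite) tvec \<Rightarrow> real \<Rightarrow> ('a, 'n) tvec \<Rightarrow> ('a, 'n) tvec" where
  "tlin a v b w = (\<lambda>c. a *\<^sub>R v c + b *\<^sub>R w c)"

definition coord_vec ::
  "('a, 'n::finite) chart set \<Rightarrow> ('a, 'n) chart \<Rightarrow> 'a \<Rightarrow> real^'n \<Rightarrow> ('a, 'n) tvec" where
  "coord_vec \<A> c x u =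
     (\<lambda>c'. if c' \<in> \<A> \<and> x \<in> fst c' then Dd (snd c' \<circ> cinv c) (snd c x) u else 0)"

definition chart_at :: "('a, 'n::finite) chart set \<Rightarrow> 'a \<Rightarrow> ('a, 'n) chart" where
  "chart_at \<A> x = (SOME c. c \<in> \<A> \<and> x \<in> fst c)"

text \<open>The differential of a vector-valued map; by the chain rule it does not depend on the chart.\<close>

definition mdiff ::
  "('a, 'n::finite) chart set \<Rightarrow> ('a \<Rightarrow> 'w::real_normed_vector) \<Rightarrow> 'a \<Rightarrow> ('a, 'n) tvec \<Rightarrow> 'w" where
  "mdiff \<A> f x v = (let c = chart_at \<A> x in Dd (f \<circ> cinv c) (snd c x) (v c))"

text \<open>Metrics \<open>g x v w\<close> on the manifold, and their components in a chart.\<close>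

type_synonym ('a, 'n) mmetric = "'a \<Rightarrow> ('a, 'n) tvec \<Rightarrow> ('a, 'n) tvec \<Rightarrow> real"

definition loc_metric ::
  "('a, 'n::finite) chart set \<Rightarrow> ('a, 'n) chart \<Rightarrow> ('a, 'n) mmetric \<Rightarrow>
   real^'n \<Rightarrow> real^'n \<Rightarrow> real^'n \<Rightarrow> real" where
  "loc_metric \<A> c g p u v = g (cinv c p) (coord_vec \<A> c (cinv c p) u) (coord_vec \<A> c (cinv c p) v)"

definition metric_at :: "('a, 'n::finite) chart set \<Rightarrow> ('a, 'n) mmetric \<Rightarrow> 'a \<Rightarrow> bool" where
  "metric_at \<A> g x \<longleftrightarrow> (\<forall>v\<in>tangent_space \<A> x. \<forall>w\<in>tangent_space \<A> x.
     g x v w = g x w v \<and> (v \<noteq> (\<lambda>c. 0) \<longrightarrow> g x v v > 0) \<and>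
     (\<forall>v'\<in>tangent_space \<A> x. \<forall>a b. g x (tlin a v b v') w = a * g x v w + b * g x v' w))"

text \<open>\<open>C1_curve S \<A> \<gamma> V\<close>: \<open>\<gamma>\<close> is a \<open>C\<^sup>1\<close> curve on \<open>[0,1]\<close> with velocity field \<open>V\<close>.\<close>

definition C1_curve ::
  "'a topology \<Rightarrow> ('a, 'n::finite) chart set \<Rightarrow> (real \<Rightarrow> 'a) \<Rightarrow> (real \<Rightarrow> ('a, 'n) tvec) \<Rightarrow> bool" where
  "C1_curve S \<A> \<gamma> V \<longleftrightarrow> continuous_map (top_of_set {0..1}) S \<gamma> \<and>
     (\<forall>s\<in>{0..1}. V s \<in> tangent_space \<A> (\<gamma> s)) \<and>
     (\<forall>c\<in>\<A>. continuous_on {s\<in>{0..1}. \<gamma> s \<in> fst c} (\<lambda>s. V s c) \<and>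
        (\<forall>s\<in>{0..1}. \<gamma> s \<in> fst c \<longrightarrow>
           ((\<lambda>r. snd c (\<gamma> r)) has_vector_derivative V s c) (at s within {0..1})))"

text \<open>Points in different components have distance \<open>\<infinity>\<close>.\<close>

definition riem_dist ::
  "'a topology \<Rightarrow> ('a, 'n::finite) chart set \<Rightarrow> ('a, 'n) mmetric \<Rightarrow> 'a \<Rightarrow> 'a \<Rightarrow> ereal" where
  "riem_dist S \<A> g x y = Inf {ereal (integral {0..1} (\<lambda>s. sqrt (g (\<gamma> s) (V s) (V s)))) | \<gamma> V.
     C1_curve S \<A> \<gamma> V \<and> \<gamma> 0 = x \<and> \<gamma> 1 = y}"

definition complete_metric ::
  "'a topology \<Rightarrow> ('a, 'n::finite) chart set \<Rightarrow> ('a, 'n) mmetric \<Rightarrow> bool" where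
  "complete_metric S \<A> g \<longleftrightarrow> (\<forall>\<sigma>::nat \<Rightarrow> 'a. range \<sigma> \<subseteq> topspace S \<and>
     (\<forall>e>0. \<exists>N. \<forall>m\<ge>N. \<forall>n\<ge>N. riem_dist S \<A> g (\<sigma> m) (\<sigma> n) < ereal e)
     \<longrightarrow> (\<exists>x. limitin S \<sigma> x sequentially))"


section \<open>The flat spaces and the Grassmannian\<close>

text \<open>\<open>\<epsilon> = 1\<close> is Euclidean space of dimension \<open>n + k\<close>, \<open>\<epsilon> = -1\<close> is the pseudo-Euclidean space
  with \<open>n\<close> positive and \<open>k\<close> negative directions.\<close>

definition flat_form :: "real \<Rightarrow> real^('n::finite + 'k::finite) \<Rightarrow> real^('n + 'k) \<Rightarrow> real" where
  "flat_form \<epsilon> v w = (\<Sum>i\<in>UNIV. v $ Inl i * w $ Inl i) + \<epsilon> * (\<Sum>j\<in>UNIV. v $ Inr j * w $ Inr j)"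

definition tan_proj ::
  "real \<Rightarrow> (real^('n::finite + 'k::finite)) set \<Rightarrow> real^('n + 'k) \<Rightarrow> real^('n + 'k)" where
  "tan_proj \<epsilon> P w = (THE p. p \<in> P \<and> (\<forall>q\<in>P. flat_form \<epsilon> (w - p) q = 0))"

definition nor_proj ::
  "real \<Rightarrow> (real^('n::finite + 'k::finite)) set \<Rightarrow> real^('n + 'k) \<Rightarrow> real^('n + 'k)" where
  "nor_proj \<epsilon> P w = w - tan_proj \<epsilon> P w"

text \<open>A basis of an \<open>n\<close>-dimensional subspace is given as an injective linear map from \<open>real^'n\<close>;
  in the pseudo-Euclidean case the subspace has to be spacelike.\<close>

definition frame :: "real \<Rightarrow> (real^'n \<Rightarrow> real^('n::finite + 'k::finite)) \<Rightarrow> bool" where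
  "frame \<epsilon> f \<longleftrightarrow> linear f \<and> inj f \<and> (\<epsilon> = -1 \<longrightarrow> (\<forall>u. u \<noteq> 0 \<longrightarrow> flat_form \<epsilon> (f u) (f u) > 0))"

text \<open>An oriented subspace is represented by the set of all its positively oriented bases.\<close>

type_synonym ('n, 'k) osub = "(real^'n \<Rightarrow> real^('n + 'k)) set"

definition oriented_span :: "(real^'n \<Rightarrow> real^('n::finite + 'k::finite)) \<Rightarrow> ('n, 'k) osub" where
  "oriented_span f = {\<lambda>u. f (B *v u) | B :: real^'n^'n. det B > 0}"

definition subspace_of :: "('n::finite, 'k::finite) osub \<Rightarrow> (real^('n + 'k)) set" where
  "subspace_of P = (\<Union>f\<in>P. range f)"

definition grassmannian :: "real \<Rightarrow> ('n::finite, 'k::finite) osub set" where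
  "grassmannian \<epsilon> = {oriented_span f | f. frame \<epsilon> f}"

text \<open>Charts of the Grassmannian: for an adapted orthonormal basis \<open>(F, N)\<close> of the flat space, the
  matrix \<open>L\<close> is the coordinate of the graph of \<open>L\<close>, oriented as the range of \<open>F\<close>.\<close>

type_synonym ('n, 'k) gchart = "(real^'n \<Rightarrow> real^('n + 'k)) \<times> (real^'k \<Rightarrow> real^('n + 'k))"

definition gcharts :: "real \<Rightarrow> ('n::finite, 'k::finite) gchart set" where
  "gcharts \<epsilon> = {(F, N). linear F \<and> linear N \<and>
     (\<forall>u v. flat_form \<epsilon> (F u) (F v) = u \<bullet> v) \<and> (\<forall>u z. flat_form \<epsilon> (F u) (N z) = 0) \<and>
     (\<forall>z z'. flat_form \<epsilon> (N z) (N z') = \<epsilon> * (z \<bullet> z'))}"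

definition gframe :: "('n::finite, 'k::finite) gchart \<Rightarrow> real^'n^'k \<Rightarrow> real^'n \<Rightarrow> real^('n + 'k)" where
  "gframe b L = (\<lambda>u. fst b u + snd b (L *v u))"

definition gdom :: "real \<Rightarrow> ('n::finite, 'k::finite) gchart \<Rightarrow> ('n, 'k) osub set" where
  "gdom \<epsilon> b = {oriented_span (gframe b L) | L. frame \<epsilon> (gframe b L)}"

definition gcoord :: "('n::finite, 'k::finite) gchart \<Rightarrow> ('n, 'k) osub \<Rightarrow> real^'n^'k" where
  "gcoord b P = (THE L. oriented_span (gframe b L) = P)"

text \<open>The identification \<open>T\<^sub>P G = Hom(P, P\<^sup>\<bottom>)\<close>: a curve \<open>P(s)\<close> through \<open>P\<close> corresponds to
  \<open>w(0) \<mapsto> (w'(0))\<^sup>\<bottom>\<close> for curves \<open>w(s) \<in> P(s)\<close>. For the coordinate velocity \<open>A\<close> at \<open>L\<close>, use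
  \<open>w(s) = gframe b (L + s A) u\<close>.\<close>

definition ghom ::
  "real \<Rightarrow> ('n::finite, 'k::finite) gchart \<Rightarrow> real^'n^'k \<Rightarrow> real^'n^'k \<Rightarrow> real^('n + 'k) \<Rightarrow> real^('n + 'k)" where
  "ghom \<epsilon> b L A w =
     nor_proj \<epsilon> (range (gframe b L)) (snd b (A *v (THE u. gframe b L u = w)))"

definition grass_metric ::
  "real \<Rightarrow> (real^('n::finite + 'k::finite)) set \<Rightarrow> (real^('n + 'k) \<Rightarrow> real^('n + 'k)) \<Rightarrow>
   (real^('n + 'k) \<Rightarrow> real^('n + 'k)) \<Rightarrow> real" where
  "grass_metric \<epsilon> P \<phi> \<psi> =
     (let e = (SOME e :: 'n \<Rightarrow> real^('n + 'k).
                 \<forall>i j. e i \<in> P \<and> flat_form \<epsilon> (e i) (e j) = (if i = j then 1 else 0))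
      in \<epsilon> * (\<Sum>i\<in>UNIV. flat_form \<epsilon> (\<phi> (e i)) (\<psi> (e i))))"

definition gmetric ::
  "real \<Rightarrow> ('n::finite, 'k::finite) gchart \<Rightarrow> real^'n^'k \<Rightarrow> real^'n^'k \<Rightarrow> real^'n^'k \<Rightarrow> real" where
  "gmetric \<epsilon> b L A B = grass_metric \<epsilon> (range (gframe b L)) (ghom \<epsilon> b L A) (ghom \<epsilon> b L B)"


section \<open>Immersions and mean curvature flow\<close>

definition immersion ::
  "real \<Rightarrow> ('a, 'n::finite) chart set \<Rightarrow> ('a \<Rightarrow> real^('n + 'k::finite)) \<Rightarrow> bool" where
  "immersion \<epsilon> \<A> X \<longleftrightarrow> (\<forall>c\<in>\<A>. smooth_on (cimage c) (X \<circ> cinv c) \<and>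
     (\<forall>p\<in>cimage c. frame \<epsilon> (Dd (X \<circ> cinv c) p)))"

definition induced_metric ::
  "real \<Rightarrow> ('a, 'n::finite) chart set \<Rightarrow> ('a \<Rightarrow> real^('n + 'k::finite)) \<Rightarrow> ('a, 'n) mmetric" where
  "induced_metric \<epsilon> \<A> X x v w = flat_form \<epsilon> (mdiff \<A> X x v) (mdiff \<A> X x w)"

text \<open>The orientation of the Gauss map does not depend on the chart because all charts of the atlas
  are positively related.\<close>

definition gauss_map ::
  "('a, 'n::finite) chart set \<Rightarrow> ('a \<Rightarrow> real^('n + 'k::finite)) \<Rightarrow> 'a \<Rightarrow> ('n, 'k) osub" where
  "gauss_map \<A> X x = oriented_span (\<lambda>u. mdiff \<A> X x (coord_vec \<A> (chart_at \<A> x) x u))"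

definition second_fund ::
  "real \<Rightarrow> (real^'n \<Rightarrow> real^('n::finite + 'k::finite)) \<Rightarrow> real^'n \<Rightarrow> real^'n \<Rightarrow> real^'n \<Rightarrow> real^('n + 'k)" where
  "second_fund \<epsilon> Y p u v = nor_proj \<epsilon> (range (Dd Y p)) (Dd (\<lambda>q. Dd Y q v) p u)"

definition mean_curvature ::
  "real \<Rightarrow> ('a, 'n::finite) chart set \<Rightarrow> ('a, 'n) chart \<Rightarrow> ('a \<Rightarrow> real^('n + 'k::finite)) \<Rightarrow> 'a \<Rightarrow> real^('n + 'k)" where
  "mean_curvature \<epsilon> \<A> c X x =
     tr_metric (loc_metric \<A> c (induced_metric \<epsilon> \<A> X) (snd c x))
       (second_fund \<epsilon> (X \<circ> cinv c) (snd c x))"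

definition MCF_solution ::
  "real \<Rightarrow> ('a, 'n::finite) chart set \<Rightarrow> real set \<Rightarrow> ('a \<Rightarrow> real^('n + 'k::finite)) \<Rightarrow>
   (real \<Rightarrow> 'a \<Rightarrow> real^('n + 'k)) \<Rightarrow> bool" where
  "MCF_solution \<epsilon> \<A> I X0 X \<longleftrightarrow>
     (\<forall>c\<in>\<A>. smooth_on (cimage c \<times> I) (\<lambda>(p, t). X t (cinv c p))) \<and>
     (\<forall>t\<in>I. immersion \<epsilon> \<A> (X t)) \<and>
     (\<forall>c\<in>\<A>. \<forall>x\<in>fst c. \<forall>t\<in>I.
        ((\<lambda>s. X s x) has_vector_derivative mean_curvature \<epsilon> \<A> c (X t) x) (at t within I)) \<and>
     (\<forall>c\<in>\<A>. \<forall>x\<in>fst c. X 0 x = X0 x)"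


section \<open>Harmonic-Ricci flow\<close>

definition smooth_metric_family ::
  "('a, 'n::finite) chart set \<Rightarrow> real set \<Rightarrow> (real \<Rightarrow> ('a, 'n) mmetric) \<Rightarrow> bool" where
  "smooth_metric_family \<A> I g \<longleftrightarrow>
     (\<forall>c\<in>\<A>. (\<forall>t\<in>I. \<forall>x\<in>fst c. metric_at \<A> (g t) x) \<and>
        (\<forall>u v. smooth_on (cimage c \<times> I) (\<lambda>(p, t). loc_metric \<A> c (g t) p u v)))"

definition smooth_grass_family ::
  "real \<Rightarrow> ('a, 'n::finite) chart set \<Rightarrow> real set \<Rightarrow> (real \<Rightarrow> 'a \<Rightarrow> ('n, 'k::finite) osub) \<Rightarrow> bool" where
  "smooth_grass_family \<epsilon> \<A> I \<rho> \<longleftrightarrow>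
     (\<forall>c\<in>\<A>. \<forall>x\<in>fst c. \<forall>t\<in>I. \<rho> t x \<in> grassmannian \<epsilon> \<and>
        (\<forall>b\<in>gcharts \<epsilon>. \<rho> t x \<in> gdom \<epsilon> b \<longrightarrow>
          (\<exists>W. open W \<and> (snd c x, t) \<in> W \<and>
             (\<forall>(p, s)\<in>W \<inter> cimage c \<times> I. \<rho> s (cinv c p) \<in> gdom \<epsilon> b) \<and>
             smooth_on (W \<inter> cimage c \<times> I) (\<lambda>(p, s). gcoord b (\<rho> s (cinv c p))))))"

text \<open>The differential of a map into the Grassmannian as an element of \<open>Hom(\<rho>(x), \<rho>(x)\<^sup>\<bottom>)\<close>; it does
  not depend on the chart of the Grassmannian.\<close>

definition grass_diff ::
  "real \<Rightarrow> ('a, 'n::finite) chart set \<Rightarrow> ('a \<Rightarrow> ('n, 'k::finite) osub) \<Rightarrow> 'a \<Rightarrow> ('a, 'n) tvec \<Rightarrow>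
   real^('n + 'k) \<Rightarrow> real^('n + 'k)" where
  "grass_diff \<epsilon> \<A> \<rho> x v =
     (let b = (SOME b. b \<in> gcharts \<epsilon> \<and> \<rho> x \<in> gdom \<epsilon> b)
      in ghom \<epsilon> b (gcoord b (\<rho> x)) (mdiff \<A> (\<lambda>y. gcoord b (\<rho> y)) x v))"

definition pullback_grass ::
  "real \<Rightarrow> ('a, 'n::finite) chart set \<Rightarrow> ('a \<Rightarrow> ('n, 'k::finite) osub) \<Rightarrow> ('a, 'n) mmetric" where
  "pullback_grass \<epsilon> \<A> \<rho> x v w =
     grass_metric \<epsilon> (subspace_of (\<rho> x)) (grass_diff \<epsilon> \<A> \<rho> x v) (grass_diff \<epsilon> \<A> \<rho> x w)"

definition HRF_solution ::
  "real \<Rightarrow> real \<Rightarrow> ('a, 'n::finite) chart set \<Rightarrow> real set \<Rightarrow>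
   ('a \<Rightarrow> ('n, 'k::finite) osub) \<Rightarrow> ('a, 'n) mmetric \<Rightarrow>
   (real \<Rightarrow> 'a \<Rightarrow> ('n, 'k) osub) \<Rightarrow> (real \<Rightarrow> ('a, 'n) mmetric) \<Rightarrow> bool" where
  "HRF_solution \<epsilon> \<alpha> \<A> I \<rho>0 g0 \<rho> g \<longleftrightarrow>
     smooth_metric_family \<A> I g \<and> smooth_grass_family \<epsilon> \<A> I \<rho> \<and>
     (\<forall>c\<in>\<A>. \<forall>x\<in>fst c. \<forall>t\<in>I. \<forall>b\<in>gcharts \<epsilon>. \<rho> t x \<in> gdom \<epsilon> b \<longrightarrow>
        ((\<lambda>s. gcoord b (\<rho> s x)) has_vector_derivative
           tension (gmetric \<epsilon> b) (loc_metric \<A> c (g t)) (\<lambda>p. gcoord b (\<rho> t (cinv c p))) (snd c x))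
        (at t within I)) \<and>
     (\<forall>c\<in>\<A>. \<forall>x\<in>fst c. \<forall>t\<in>I. \<forall>u v.
        ((\<lambda>s. loc_metric \<A> c (g s) (snd c x) u v) has_real_derivative
           - 2 * ricci (loc_metric \<A> c (g t)) (snd c x) u v
           + 2 * \<alpha> * loc_metric \<A> c (pullback_grass \<epsilon> \<A> (\<rho> t)) (snd c x) u v)
        (at t within I)) \<and>
     (\<forall>c\<in>\<A>. \<forall>x\<in>fst c. \<rho> 0 x = \<rho>0 x \<and>
        (\<forall>v\<in>tangent_space \<A> x. \<forall>w\<in>tangent_space \<A> x. g 0 x v w = g0 x v w))"


section \<open>Reconstruction of the immersion\<close>

definition intrinsically_parallel ::
  "('a, 'n::finite) chart set \<Rightarrow> real set \<Rightarrow> (real \<Rightarrow> ('a, 'n) mmetric) \<Rightarrow> 'a \<Rightarrow>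
   (real \<Rightarrow> ('a, 'n) tvec) \<Rightarrow> bool" where
  "intrinsically_parallel \<A> I g x v \<longleftrightarrow> (\<forall>t\<in>I. v t \<in> tangent_space \<A> x) \<and>
     (\<forall>c\<in>\<A>. x \<in> fst c \<longrightarrow> (\<forall>t\<in>I. ((\<lambda>s. v s c) has_vector_derivative
        (\<chi> j. - (1/2) * (\<Sum>l\<in>UNIV. \<Sum>i\<in>UNIV.
           inv_metric (loc_metric \<A> c (g t) (snd c x)) $ j $ l
           * vector_derivative (\<lambda>s. loc_metric \<A> c (g s) (snd c x) (axis i 1) (axis l 1)) (at t within I)
           * v t c $ i)))
        (at t within I)))"

definition extrinsically_parallel ::
  "real \<Rightarrow> real set \<Rightarrow> (real \<Rightarrow> 'a \<Rightarrow> ('n::finite, 'k::finite) osub) \<Rightarrow> 'a \<Rightarrow>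
   (real \<Rightarrow> real^('n + 'k)) \<Rightarrow> bool" where
  "extrinsically_parallel \<epsilon> I \<rho> x w \<longleftrightarrow>
     (\<forall>t\<in>I. w t \<in> subspace_of (\<rho> t x) \<and>
        (\<exists>w'. (w has_vector_derivative w') (at t within I) \<and> tan_proj \<epsilon> (subspace_of (\<rho> t x)) w' = 0))"

definition parallel_family ::
  "real \<Rightarrow> ('a, 'n::finite) chart set \<Rightarrow> real set \<Rightarrow> (real \<Rightarrow> 'a \<Rightarrow> ('n, 'k::finite) osub) \<Rightarrow>
   (real \<Rightarrow> ('a, 'n) mmetric) \<Rightarrow> ('a \<Rightarrow> real^('n + 'k)) \<Rightarrow>
   (real \<Rightarrow> 'a \<Rightarrow> ('a, 'n) tvec \<Rightarrow> real^('n + 'k)) \<Rightarrow> bool" where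
  "parallel_family \<epsilon> \<A> I \<rho> g X0 \<Phi> \<longleftrightarrow> (\<forall>x\<in>(\<Union>c\<in>\<A>. fst c).
     (\<forall>t\<in>I. \<forall>v\<in>tangent_space \<A> x. \<Phi> t x v \<in> subspace_of (\<rho> t x) \<and>
        (\<forall>w\<in>tangent_space \<A> x. \<forall>a b. \<Phi> t x (tlin a v b w) = a *\<^sub>R \<Phi> t x v + b *\<^sub>R \<Phi> t x w)) \<and>
     (\<forall>v\<in>tangent_space \<A> x. \<Phi> 0 x v = mdiff \<A> X0 x v) \<and>
     (\<forall>v. intrinsically_parallel \<A> I g x v \<longrightarrow> extrinsically_parallel \<epsilon> I \<rho> x (\<lambda>t. \<Phi> t x (v t))))"

definition isometry_onto ::
  "real \<Rightarrow> ('a, 'n::finite) chart set \<Rightarrow> ('a, 'n) mmetric \<Rightarrow> 'a \<Rightarrow>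
   (('a, 'n) tvec \<Rightarrow> real^('n + 'k::finite)) \<Rightarrow> ('n, 'k) osub \<Rightarrow> bool" where
  "isometry_onto \<epsilon> \<A> g x \<phi> P \<longleftrightarrow> \<phi> ` tangent_space \<A> x = subspace_of P \<and>
     (\<forall>v\<in>tangent_space \<A> x. \<forall>w\<in>tangent_space \<A> x. flat_form \<epsilon> (\<phi> v) (\<phi> w) = g x v w)"

definition tr_Phi ::
  "real \<Rightarrow> ('a, 'n::finite) chart set \<Rightarrow> ('a \<Rightarrow> ('n, 'k::finite) osub) \<Rightarrow> ('a, 'n) mmetric \<Rightarrow> 'a \<Rightarrow>
   (('a, 'n) tvec \<Rightarrow> real^('n + 'k)) \<Rightarrow> real^('n + 'k)" where
  "tr_Phi \<epsilon> \<A> \<rho> g x \<phi> =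
     (let E = (SOME E :: 'n \<Rightarrow> ('a, 'n) tvec. \<forall>i j. E i \<in> tangent_space \<A> x \<and>
                 g x (E i) (E j) = (if i = j then 1 else 0))
      in \<Sum>i\<in>UNIV. grass_diff \<epsilon> \<A> \<rho> x (E i) (\<phi> (E i)))"

definition reconstruction_ODE ::
  "real \<Rightarrow> ('a, 'n::finite) chart set \<Rightarrow> real set \<Rightarrow> (real \<Rightarrow> 'a \<Rightarrow> ('n, 'k::finite) osub) \<Rightarrow>
   (real \<Rightarrow> ('a, 'n) mmetric) \<Rightarrow> ('a \<Rightarrow> real^('n + 'k)) \<Rightarrow>
   (real \<Rightarrow> 'a \<Rightarrow> ('a, 'n) tvec \<Rightarrow> real^('n + 'k)) \<Rightarrow> (real \<Rightarrow> 'a \<Rightarrow> real^('n + 'k)) \<Rightarrow> bool" where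
  "reconstruction_ODE \<epsilon> \<A> I \<rho> g X0 \<Phi> Z \<longleftrightarrow> (\<forall>x\<in>(\<Union>c\<in>\<A>. fst c). Z 0 x = X0 x \<and>
     (\<forall>t\<in>I. ((\<lambda>s. Z s x) has_vector_derivative tr_Phi \<epsilon> \<A> (\<rho> t) (g t) x (\<Phi> t x)) (at t within I)))"

end

theory Submission
  imports Defs
begin

text \<open>Along the mean curvature flow the Gauss map and the induced metric evolve by the harmonic-Ricci
  flow, so the assumed uniqueness of the latter identifies them with \<open>\<rho>\<close> and \<open>g\<close>. For the metric,
  \<open>\<partial>\<^sub>t g = -2\<langle>H, A\<rangle>\<close>, and the trace of the Gauss equation is \<open>\<langle>H, A\<rangle> = Ric + \<epsilon> d\<rho> \<otimes> d\<rho>\<close>. For the Gauss map,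
  let \<open>L\<close> be its coordinate in a graph chart and \<open>\<lambda>(w) = \<pi>\<^sub>N w - L \<pi>\<^sub>F w\<close>, a linear map whose kernel is the tangent
  plane. Differentiating \<open>\<lambda>(dX(w)) = 0\<close> gives \<open>dL(u) \<pi>\<^sub>F dX(w) = \<lambda>(A(u,w))\<close> and, with one more derivative, expresses
  the tension field of \<open>L\<close> by the covariant derivative of \<open>A\<close>; by the symmetry of third derivatives of \<open>X\<close> this is
  \<open>\<lambda>(dH)\<close>, which is also what \<open>\<partial>\<^sub>t X = H\<close> gives for \<open>\<partial>\<^sub>t L\<close>.

  The tangential part of \<open>\<partial>\<^sub>t (dX(v))\<close> vanishes exactly for intrinsically parallel \<open>v\<close>, so \<open>\<Phi> = dX\<close>, and then
  \<open>tr\<^sub>\<Phi> d\<rho> = tr A = H\<close>.\<close>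

text \<open>The coupling \<open>- \<epsilon>\<close> comes from the sign in the Grassmannian metric:
  the pullback is \<open>\<epsilon>\<close> times the trace of \<open><A(u,.), A(v,.)>\<close>, and
  \<open>\<epsilon> * \<epsilon> = 1\<close> turns it, in both signatures, into the term that the
  traced Gauss equation subtracts in the Ricci tensor. The obstacle for the Gauss map is that its
  tension field contains the Christoffel symbols of the Grassmannian. They are computed in graph
  coordinates, where the metric becomes \<open>tr (M A^T K B)\<close> with two inverse Gram
  matrices. The resulting terms are quadratic in \<open>dL\<close>; they cancel those that arise
  because the normal part of the second derivative of \<open>X\<close> has a nonzero component along
  the reference plane. At \<open>t = 0\<close> only one-sided time derivatives exist, so smoothness
  and the symmetry of mixed derivatives are developed on domains with such a boundary. Finally, a
  family \<open>\<Phi>\<close> is constrained only along intrinsically parallel curves. That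
  \<open>dX\<close> is the only such family therefore requires a parallel curve through every
  tangent vector at every time, and hence solutions of linear equations on all of
  \<open>I\<close>.\<close>

section \<open>Smooth maps on sets with unique derivatives\<close>

text \<open>Derivatives within such a set are unique, so \<open>frechet_derivative\<close> within it is a derivative and not a
  junk value of the choice operator. Open sets and products of an open set with \<open>[0,T)\<close> are of this kind.\<close>

definition thick :: "'v::euclidean_space set \<Rightarrow> bool" where
  "thick S \<longleftrightarrow> (\<forall>x\<in>S. \<forall>i\<in>Basis. \<forall>e>0. \<exists>d. 0 < \<bar>d\<bar> \<and> \<bar>d\<bar> < e \<and> x + d *\<^sub>R i \<in> S)"

lemma thick_frechet_derivative:
  assumes "thick S" "p \<in> S" "(f has_derivative D) (at p within S)"
  shows "frechet_derivative f (at p within S) = D"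
proof -
  have "(f has_derivative frechet_derivative f (at p within S)) (at p within S)"
    using assms(3) frechet_derivative_works differentiable_def by blast
  then show ?thesis
    using assms by (intro frechet_derivative_unique_within[where x=p and S=S and f=f])
      (auto simp: thick_def)
qed

lemma thick_open: "open S \<Longrightarrow> thick S"
  unfolding thick_def
proof (intro ballI allI impI)
  fix x i :: 'a and e :: real assume S: "open S" "x \<in> S" and i: "i \<in> Basis" and e: "e > 0"
  obtain r where r: "r > 0" "ball x r \<subseteq> S" using S by (meson open_contains_ball)
  let ?d = "min (e/2) (r/2)"
  have "x + ?d *\<^sub>R i \<in> ball x r" using r e i by (auto simp: dist_norm)
  then show "\<exists>d. 0 < \<bar>d\<bar> \<and> \<bar>d\<bar> < e \<and> x + d *\<^sub>R i \<in> S"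
    using r e by (intro exI[of _ ?d]) auto
qed

lemma thick_Times: "thick A \<Longrightarrow> thick B \<Longrightarrow> thick (A \<times> B)"
  unfolding thick_def Basis_prod_def by fastforce

lemma thick_Int_open: "thick S \<Longrightarrow> open W \<Longrightarrow> thick (W \<inter> S)"
  unfolding thick_def
proof (intro ballI allI impI)
  fix x i :: 'a and e :: real
  assume S: "\<forall>x\<in>S. \<forall>i\<in>Basis. \<forall>e>0. \<exists>d. 0 < \<bar>d\<bar> \<and> \<bar>d\<bar> < e \<and> x + d *\<^sub>R i \<in> S" "open W"
    and x: "x \<in> W \<inter> S" and i: "i \<in> Basis" and e: "e > 0"
  obtain r where r: "r > 0" "ball x r \<subseteq> W" using S x by (meson open_contains_ball IntD1)
  obtain d where d: "0 < \<bar>d\<bar>" "\<bar>d\<bar> < min e r" "x + d *\<^sub>R i \<in> S"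
    using S(1) x i e r by (metis IntD2 min_less_iff_conj)
  have "x + d *\<^sub>R i \<in> ball x r" using d i by (auto simp: dist_norm)
  then show "\<exists>d. 0 < \<bar>d\<bar> \<and> \<bar>d\<bar> < e \<and> x + d *\<^sub>R i \<in> W \<inter> S"
    using d r by (intro exI[of _ d]) auto
qed

text \<open>Both functions have the same set of derivatives, so the choice operator picks the same
  element. This covers points without a derivative, where both sides are the same arbitrary
  value.\<close>

lemma frechet_derivative_cong_within:
  assumes "p \<in> S" "\<And>q. q \<in> S \<Longrightarrow> f q = g q"
  shows "frechet_derivative f (at p within S) = frechet_derivative g (at p within S)"
proof -
  have "(f has_derivative D) (at p within S) \<longleftrightarrow> (g has_derivative D) (at p within S)" for D
    using assms has_derivative_transform[of p S f g] has_derivative_transform[of p S g f] by metis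
  then show ?thesis unfolding frechet_derivative_def by simp
qed

lemma differentiable_cong_within:
  assumes "p \<in> S" "\<And>q. q \<in> S \<Longrightarrow> f q = g q"
  shows "f differentiable (at p within S) \<longleftrightarrow> g differentiable (at p within S)"
  using assms has_derivative_transform[of p S f g] has_derivative_transform[of p S g f]
  unfolding differentiable_def by metis

lemma Ck_on_cong:
  assumes "\<And>q. q \<in> S \<Longrightarrow> f q = g q"
  shows "Ck_on k S f \<longleftrightarrow> Ck_on k S g"
  using assms
proof (induction k arbitrary: f g)
  case 0 then show ?case by (auto intro: continuous_on_cong)
next
  case (Suc k)
  have "Ck_on k S (\<lambda>p. frechet_derivative f (at p within S) v) \<longleftrightarrow>
        Ck_on k S (\<lambda>p. frechet_derivative g (at p within S) v)" for v
    using Suc.prems frechet_derivative_cong_within[of _ S f g] by (intro Suc.IH) metis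
  then show ?case using Suc.prems differentiable_cong_within[of _ S f g] by auto
qed

lemma Ck_on_has_derivative:
  assumes "Ck_on (Suc k) S f" "p \<in> S"
  shows "(f has_derivative frechet_derivative f (at p within S)) (at p within S)"
  using assms frechet_derivative_works by auto

text \<open>On a thick set any explicit derivative is the chosen one. Smoothness of composite maps
  therefore follows by induction on \<open>k\<close> from a formula for their derivative.\<close>

lemma Ck_on_SucI:
  assumes "thick S" "\<And>p. p \<in> S \<Longrightarrow> (f has_derivative D p) (at p within S)"
    "\<And>v. Ck_on k S (\<lambda>p. D p v)"
  shows "Ck_on (Suc k) S f"
proof -
  have "Ck_on k S (\<lambda>p. frechet_derivative f (at p within S) v)" for v
    using assms(3)[of v] thick_frechet_derivative[OF assms(1) _ assms(2)]
    by (subst Ck_on_cong[where g="\<lambda>p. D p v"]) auto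
  then show ?thesis using assms(2) by (auto simp: differentiable_def)
qed

lemma Ck_on_SucD: "Ck_on (Suc k) S f \<Longrightarrow> Ck_on k S f"
proof (induction k arbitrary: f)
  case 0 then show ?case
    by (auto intro!: differentiable_imp_continuous_on simp: differentiable_on_def)
next
  case (Suc k) then show ?case by (metis Ck_on.simps(2))
qed

lemma Ck_on_const: "thick S \<Longrightarrow> Ck_on k S (\<lambda>p. a)"
proof (induction k arbitrary: a)
  case (Suc k)
  then show ?case by (intro Ck_on_SucI[where D="\<lambda>p v. 0"]) auto
qed simp

lemma Ck_on_linear:
  assumes "thick S" "bounded_linear T" shows "Ck_on k S T"
proof (cases k)
  case 0 then show ?thesis using assms(2) by (simp add: linear_continuous_on)
next
  case (Suc k)
  then show ?thesis
    using assms Ck_on_const[OF assms(1)] bounded_linear_imp_has_derivative[OF assms(2)]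
    by (simp only:) (rule Ck_on_SucI[where D="\<lambda>p. T"], auto)
qed

lemma Ck_on_compose_linear:
  assumes "thick S" "bounded_linear T" shows "Ck_on k S f \<Longrightarrow> Ck_on k S (\<lambda>p. T (f p))"
proof (induction k arbitrary: f)
  case 0 then show ?case using assms(2) by (simp add: bounded_linear.continuous_on)
next
  case (Suc k)
  show ?case
  proof (rule Ck_on_SucI[where D="\<lambda>p v. T (frechet_derivative f (at p within S) v)"])
    show "((\<lambda>p. T (f p)) has_derivative (\<lambda>v. T (frechet_derivative f (at p within S) v))) (at p within S)"
      if "p \<in> S" for p
      using Ck_on_has_derivative[OF Suc.prems that] bounded_linear.has_derivative[OF assms(2)] by blast
  qed (use Suc assms in auto)
qed

lemma Ck_on_add:
  assumes "thick S" shows "Ck_on k S f \<Longrightarrow> Ck_on k S g \<Longrightarrow> Ck_on k S (\<lambda>p. f p + g p)"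
proof (induction k arbitrary: f g)
  case 0 then show ?case by (simp add: continuous_on_add)
next
  case (Suc k)
  show ?case
    by (rule Ck_on_SucI[where D="\<lambda>p v. frechet_derivative f (at p within S) v +
        frechet_derivative g (at p within S) v"])
      (use Suc assms in \<open>auto intro!: has_derivative_add Ck_on_has_derivative\<close>)
qed

text \<open>The product rule writes the derivative as a sum of two products of the same kind, one
  order lower; hence the induction varies \<open>f\<close> and \<open>g\<close>. Real, scalar,
  matrix and matrix-vector products and the flat form are all instances.\<close>

lemma Ck_on_bilinear:
  assumes "thick S" and B: "bounded_bilinear B"
  shows "Ck_on k S f \<Longrightarrow> Ck_on k S g \<Longrightarrow> Ck_on k S (\<lambda>p. B (f p) (g p))"
proof (induction k arbitrary: f g)
  case 0 then show ?case using B by (simp add: bounded_bilinear.continuous_on)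
next
  case (Suc k)
  note fg = Suc.prems[THEN Ck_on_SucD]
  show ?case
    by (rule Ck_on_SucI[where D="\<lambda>p v. B (f p) (frechet_derivative g (at p within S) v) +
        B (frechet_derivative f (at p within S) v) (g p)"])
      (use Suc assms fg in \<open>auto intro!: bounded_bilinear.FDERIV[OF B] Ck_on_has_derivative Ck_on_add\<close>)
qed

lemma Ck_on_inverse:
  fixes f :: "'v::euclidean_space \<Rightarrow> real"
  assumes "thick S" "\<And>p. p \<in> S \<Longrightarrow> f p \<noteq> 0"
  shows "Ck_on k S f \<Longrightarrow> Ck_on k S (\<lambda>p. inverse (f p))"
proof (induction k)
  case 0 then show ?case using assms by (simp add: continuous_on_inverse)
next
  case (Suc k)
  \<comment> \<open>Regularity is bootstrapped: the derivative of the inverse is a product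
    containing the inverse itself, which is already known to be of class \<open>k\<close>.\<close>
  have "Ck_on k S (\<lambda>p. inverse (f p))" using Suc Ck_on_SucD by blast
  then have "Ck_on k S (\<lambda>p. - (inverse (f p) * frechet_derivative f (at p within S) v * inverse (f p)))" for v
    using Suc.prems assms(1)
    by (auto intro!: Ck_on_bilinear[OF _ bounded_bilinear_mult]
        Ck_on_compose_linear[OF _ bounded_linear_minus[OF bounded_linear_ident]])
  then show ?case
    using assms Ck_on_has_derivative[OF Suc.prems]
    by (intro Ck_on_SucI[where D="\<lambda>p v. - (inverse (f p) * frechet_derivative f (at p within S) v * inverse (f p))"])
       (auto intro!: has_derivative_inverse)
qed

lemma at_within_Int_open: "open W \<Longrightarrow> p \<in> W \<Longrightarrow> at p within (W \<inter> S) = at p within S"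
  by (rule at_within_nhd[of p W]) auto

lemma Ck_on_Int_open: "open W \<Longrightarrow> Ck_on k S f \<Longrightarrow> Ck_on k (W \<inter> S) f"
proof (induction k arbitrary: f)
  case 0 then show ?case by (auto intro: continuous_on_subset)
next
  case (Suc k)
  have "Ck_on k (W \<inter> S) (\<lambda>p. frechet_derivative f (at p within S) v)" for v
    using Suc by auto
  then have "Ck_on k (W \<inter> S) (\<lambda>p. frechet_derivative f (at p within W \<inter> S) v)" for v
    by (subst Ck_on_cong[where g="\<lambda>p. frechet_derivative f (at p within S) v"])
      (auto simp: at_within_Int_open Suc.prems(1))
  then show ?case using Suc.prems by (auto simp: at_within_Int_open)
qed

lemma smooth_on_cong:
  "(\<And>q. q \<in> S \<Longrightarrow> f q = g q) \<Longrightarrow> smooth_on S f \<longleftrightarrow> smooth_on S g"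
  unfolding smooth_on_def using Ck_on_cong by blast

lemma smooth_on_has_derivative:
  assumes "smooth_on S f" "p \<in> S"
  shows "(f has_derivative frechet_derivative f (at p within S)) (at p within S)"
  using assms Ck_on_has_derivative[of 0] unfolding smooth_on_def by blast

lemma smooth_on_frechet_derivative:
  "smooth_on S f \<Longrightarrow> smooth_on S (\<lambda>p. frechet_derivative f (at p within S) v)"
  unfolding smooth_on_def by (metis Ck_on.simps(2))

lemma smooth_on_continuous: "smooth_on S f \<Longrightarrow> continuous_on S f"
  unfolding smooth_on_def by (metis Ck_on.simps(1))

lemma smooth_on_Int_open: "smooth_on S f \<Longrightarrow> open W \<Longrightarrow> smooth_on (W \<inter> S) f"
  unfolding smooth_on_def using Ck_on_Int_open by blast

lemma smooth_on_open_subset: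
  "smooth_on S f \<Longrightarrow> open W \<Longrightarrow> W \<subseteq> S \<Longrightarrow> smooth_on W f"
  using smooth_on_Int_open[of S f W] by (simp add: Int_absorb2)

lemma smooth_on_const: "thick S \<Longrightarrow> smooth_on S (\<lambda>p. a)"
  unfolding smooth_on_def using Ck_on_const by blast

lemma smooth_on_compose_linear:
  "thick S \<Longrightarrow> bounded_linear T \<Longrightarrow> smooth_on S f \<Longrightarrow> smooth_on S (\<lambda>p. T (f p))"
  unfolding smooth_on_def using Ck_on_compose_linear by blast

lemma smooth_on_linear: "thick S \<Longrightarrow> bounded_linear T \<Longrightarrow> smooth_on S T"
  unfolding smooth_on_def using Ck_on_linear by blast

lemma smooth_on_add:
  "thick S \<Longrightarrow> smooth_on S f \<Longrightarrow> smooth_on S g \<Longrightarrow> smooth_on S (\<lambda>p. f p + g p)"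
  unfolding smooth_on_def using Ck_on_add by blast

lemma smooth_on_bilinear:
  "thick S \<Longrightarrow> bounded_bilinear B \<Longrightarrow> smooth_on S f \<Longrightarrow> smooth_on S g \<Longrightarrow> smooth_on S (\<lambda>p. B (f p) (g p))"
  unfolding smooth_on_def using Ck_on_bilinear by blast

lemma smooth_on_inverse:
  fixes f :: "'v::euclidean_space \<Rightarrow> real"
  shows "thick S \<Longrightarrow> (\<And>p. p \<in> S \<Longrightarrow> f p \<noteq> 0) \<Longrightarrow> smooth_on S f \<Longrightarrow> smooth_on S (\<lambda>p. inverse (f p))"
  unfolding smooth_on_def using Ck_on_inverse by blast

lemma smooth_on_sum:
  assumes "thick S" shows "finite J \<Longrightarrow> (\<And>j. j \<in> J \<Longrightarrow> smooth_on S (f j)) \<Longrightarrow> smooth_on S (\<lambda>p. \<Sum>j\<in>J. f j p)"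
  by (induction J rule: finite_induct) (auto intro: smooth_on_add smooth_on_const assms)

lemma smooth_on_prod:
  fixes f :: "'j \<Rightarrow> 'v::euclidean_space \<Rightarrow> real"
  assumes "thick S" shows "finite J \<Longrightarrow> (\<And>j. j \<in> J \<Longrightarrow> smooth_on S (f j)) \<Longrightarrow> smooth_on S (\<lambda>p. \<Prod>j\<in>J. f j p)"
  by (induction J rule: finite_induct)
    (auto intro: smooth_on_bilinear[OF _ bounded_bilinear_mult] smooth_on_const assms)

section \<open>Smooth dependence of determinants and inverse matrices\<close>

lemma linear_axis: "linear (axis i :: 'w::real_vector \<Rightarrow> 'w^'n)"
  by (auto intro!: linearI simp: vec_eq_iff axis_def)

lemma vec_lambda_sum_axis: "(\<chi> i. a i) = (\<Sum>i\<in>UNIV. axis i (a i))"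
  by (simp add: vec_eq_iff axis_def sum.delta')

lemma smooth_on_vec_lambda:
  fixes f :: "'n::finite \<Rightarrow> 'v::euclidean_space \<Rightarrow> 'w::euclidean_space"
  assumes "thick S" "\<And>i. smooth_on S (f i)" shows "smooth_on S (\<lambda>p. \<chi> i. f i p)"
  unfolding vec_lambda_sum_axis
  by (intro smooth_on_sum smooth_on_compose_linear[OF _ linear_axis[THEN linear_conv_bounded_linear[THEN iffD1]]] assms) auto

lemma smooth_on_vec_nth: "thick S \<Longrightarrow> smooth_on S f \<Longrightarrow> smooth_on S (\<lambda>p. f p $ i)"
  by (rule smooth_on_compose_linear[OF _ bounded_linear_vec_nth])

lemma smooth_on_det:
  fixes A :: "'v::euclidean_space \<Rightarrow> real^'n^'n"
  assumes "thick S" "\<And>i j. smooth_on S (\<lambda>p. A p $ i $ j)" shows "smooth_on S (\<lambda>p. det (A p))"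
  unfolding det_def
  by (intro smooth_on_sum smooth_on_prod smooth_on_bilinear[OF _ bounded_bilinear_mult] smooth_on_const assms)
    (auto simp: finite_permutations)

lemma matrix_inv_mult:
  fixes A :: "real^'n^'n"
  assumes "det A \<noteq> 0"
  shows matrix_inv_mult_right: "A ** matrix_inv A = mat 1"
    and matrix_inv_mult_left: "matrix_inv A ** A = mat 1"
proof -
  have "\<exists>A'. A ** A' = mat 1 \<and> A' ** A = mat 1"
    using assms by (simp add: invertible_det_nz flip: invertible_def)
  from someI_ex[OF this] show "A ** matrix_inv A = mat 1" "matrix_inv A ** A = mat 1"
    by (auto simp: matrix_inv_def)
qed

lemma matrix_inv_unique:
  fixes A B :: "real^'n^'n"
  assumes "A ** B = mat 1" shows "matrix_inv A = B"
proof -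
  have "det A \<noteq> 0" using assms by (metis det_I det_mul mult_eq_0_iff zero_neq_one)
  then show ?thesis
    by (metis assms matrix_inv_mult_left matrix_mul_assoc matrix_mul_lid matrix_mul_rid)
qed

text \<open>Cramer's rule for the columns of the inverse. It exhibits the entries as rational
  functions of the entries of \<open>A\<close>, which gives their smoothness.\<close>

lemma matrix_inv_entry:
  fixes A :: "real^'n^'n"
  assumes "det A \<noteq> 0"
  shows "matrix_inv A $ k $ j =
    det (\<chi> i l. if l = k then (axis j 1 :: real^'n) $ i else A $ i $ l) * inverse (det A)"
proof -
  have "A *v (matrix_inv A *v axis j 1) = axis j 1"
    using assms by (simp add: matrix_inv_mult matrix_vector_mul_assoc)
  then have "(matrix_inv A *v axis j 1) $ k =
      det (\<chi> i l. if l = k then (axis j 1 :: real^'n) $ i else A $ i $ l) / det A"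
    using cramer[OF assms, of "matrix_inv A *v axis j 1" "axis j 1"] by simp
  moreover have "(matrix_inv A *v axis j 1) $ k = matrix_inv A $ k $ j"
    by (simp add: matrix_vector_mult_basis column_def)
  ultimately show ?thesis by (simp add: divide_inverse)
qed

lemma smooth_on_matrix_inv:
  fixes A :: "'v::euclidean_space \<Rightarrow> real^'n^'n"
  assumes "thick S" "smooth_on S A" "\<And>p. p \<in> S \<Longrightarrow> det (A p) \<noteq> 0"
  shows "smooth_on S (\<lambda>p. matrix_inv (A p))"
proof -
  have A: "smooth_on S (\<lambda>p. A p $ i $ j)" for i j
    by (intro smooth_on_vec_nth assms)
  have "smooth_on S (\<lambda>p. matrix_inv (A p) $ k $ j)" for k j
  proof -
    have *: "smooth_on S (\<lambda>p. if l = k then (axis j 1 :: real^'n) $ i else A p $ i $ l)" for i l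
      by (cases "l = k") (use smooth_on_const[OF assms(1)] A in auto)
    show ?thesis
      by (subst smooth_on_cong[OF matrix_inv_entry[OF assms(3)]])
        (auto intro!: smooth_on_bilinear[OF _ bounded_bilinear_mult] smooth_on_det smooth_on_inverse * assms A)
  qed
  then have "smooth_on S (\<lambda>p. \<chi> k j. matrix_inv (A p) $ k $ j)"
    by (intro smooth_on_vec_lambda assms) auto
  then show ?thesis by (simp only: vec_nth_inverse)
qed

section \<open>Calculus with \<open>Dd\<close> at interior points\<close>

lemma Dd_eqI: "(f has_derivative D) (at p) \<Longrightarrow> Dd f p = D"
  by (rule frechet_derivative_at[symmetric])

lemma Dd_cong:
  assumes "open U" "p \<in> U" "\<And>q. q \<in> U \<Longrightarrow> f q = g q"
  shows "Dd f p = Dd g p"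
  using frechet_derivative_cong_within[OF assms(2,3)] at_within_open[OF assms(2,1)] by simp

lemma differentiable_cong_open:
  assumes "open U" "p \<in> U" "\<And>q. q \<in> U \<Longrightarrow> f q = g q"
  shows "f differentiable (at p) \<longleftrightarrow> g differentiable (at p)"
  using differentiable_cong_within[OF assms(2,3)] at_within_open[OF assms(2,1)] by simp

lemma smooth_on_Dd:
  assumes "open U" "smooth_on U f" shows "smooth_on U (\<lambda>q. Dd f q v)"
proof -
  have "frechet_derivative f (at q within U) v = Dd f q v" if "q \<in> U" for q
    using at_within_open[OF that assms(1)] by simp
  then have "smooth_on U (\<lambda>q. frechet_derivative f (at q within U) v) \<longleftrightarrow> smooth_on U (\<lambda>q. Dd f q v)"
    by (rule smooth_on_cong)
  then show ?thesis using smooth_on_frechet_derivative[OF assms(2)] by simp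
qed

lemma smooth_on_differentiable:
  assumes "open U" "smooth_on U f" "p \<in> U" shows "f differentiable (at p)"
  using smooth_on_has_derivative[OF assms(2,3), unfolded at_within_open[OF assms(3,1)]]
  by (rule differentiableI)

lemma Dd_works: "f differentiable (at p) \<Longrightarrow> (f has_derivative Dd f p) (at p)"
  by (simp add: frechet_derivative_works)

lemma linear_Dd: "f differentiable (at p) \<Longrightarrow> linear (Dd f p)"
  using Dd_works has_derivative_linear by blast

lemma Dd_const [simp]: "Dd (\<lambda>q. a) p v = 0"
  by (subst Dd_eqI[of _ "\<lambda>v. 0"]) auto

lemma Dd_diff:
  "f differentiable (at p) \<Longrightarrow> g differentiable (at p) \<Longrightarrow> Dd (\<lambda>q. f q - g q) p v = Dd f p v - Dd g p v"
  by (subst Dd_eqI[OF has_derivative_diff[OF Dd_works Dd_works]]) auto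

lemma Dd_sum:
  "(\<And>i. i \<in> J \<Longrightarrow> f i differentiable (at p)) \<Longrightarrow> Dd (\<lambda>q. \<Sum>i\<in>J. f i q) p v = (\<Sum>i\<in>J. Dd (f i) p v)"
  by (subst Dd_eqI[OF has_derivative_sum[where f'="\<lambda>i. Dd (f i) p"]]) (auto intro: Dd_works)

lemma Dd_linear:
  assumes "bounded_linear T" "f differentiable (at p)" shows "Dd (\<lambda>q. T (f q)) p v = T (Dd f p v)"
  by (subst Dd_eqI[OF bounded_linear.has_derivative[OF assms(1) Dd_works[OF assms(2)]]]) auto

lemma Dd_bilinear:
  assumes "bounded_bilinear B" "f differentiable (at p)" "g differentiable (at p)"
  shows "Dd (\<lambda>q. B (f q) (g q)) p v = B (f p) (Dd g p v) + B (Dd f p v) (g p)"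
  by (subst Dd_eqI[OF bounded_bilinear.FDERIV[OF assms(1) Dd_works[OF assms(2)] Dd_works[OF assms(3)]]]) auto

lemma differentiable_linear:
  "bounded_linear T \<Longrightarrow> f differentiable F \<Longrightarrow> (\<lambda>q. T (f q)) differentiable F"
  unfolding differentiable_def using bounded_linear.has_derivative by blast

lemma differentiable_bilinear:
  "bounded_bilinear B \<Longrightarrow> f differentiable (at p within S) \<Longrightarrow> g differentiable (at p within S) \<Longrightarrow>
    (\<lambda>q. B (f q) (g q)) differentiable (at p within S)"
  unfolding differentiable_def using bounded_bilinear.FDERIV by blast

lemma bounded_bilinear_matrix_vector: "bounded_bilinear ((*v) :: real^'n^'m \<Rightarrow> real^'n \<Rightarrow> real^'m)"
  by (intro bilinear_conv_bounded_bilinear[THEN iffD1])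
    (auto simp: bilinear_def matrix_vector_right_distrib matrix_vector_mult_add_rdistrib
      scaleR_matrix_vector_assoc matrix_vector_mult_scaleR intro!: linearI)

lemma scaleR_matrix_mult:
  fixes A :: "real^'n^'m" and B :: "real^'l^'n"
  shows "(c *\<^sub>R A) ** B = c *\<^sub>R (A ** B)" "A ** (c *\<^sub>R B) = c *\<^sub>R (A ** B)"
  by (simp_all add: matrix_matrix_mult_def vec_eq_iff sum_distrib_left mult_ac)

lemma matrix_add_rdistrib': "(B + C) ** (A :: real^'l^'n) = B ** A + C ** A" for B C :: "real^'n^'m"
  by (simp add: matrix_matrix_mult_def vec_eq_iff sum.distrib distrib_right)

lemma bounded_bilinear_matrix_mult:
  "bounded_bilinear ((**) :: real^'n^'m \<Rightarrow> real^'l^'n \<Rightarrow> real^'l^'m)"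
  by (intro bilinear_conv_bounded_bilinear[THEN iffD1])
    (auto simp: bilinear_def matrix_add_ldistrib matrix_add_rdistrib' scaleR_matrix_mult intro!: linearI)

lemma bounded_linear_transpose: "bounded_linear (transpose :: real^'n^'m \<Rightarrow> real^'m^'n)"
  by (intro linear_conv_bounded_linear[THEN iffD1] linearI) (auto simp: transpose_def vec_eq_iff)

text \<open>Obtained by differentiating \<open>A q ** matrix_inv (A q) = mat 1\<close>, an identity
  on \<open>U\<close>, and multiplying by the inverse from the left.\<close>

lemma Dd_matrix_inv:
  fixes A :: "'v::euclidean_space \<Rightarrow> real^'n^'n"
  assumes "open U" "smooth_on U A" "\<And>p. p \<in> U \<Longrightarrow> det (A p) \<noteq> 0" "p \<in> U"
  shows "Dd (\<lambda>q. matrix_inv (A q)) p v = - (matrix_inv (A p) ** Dd A p v ** matrix_inv (A p))"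
proof -
  let ?R = "\<lambda>q. matrix_inv (A q)"
  have d: "A differentiable (at p)" "?R differentiable (at p)"
    using assms smooth_on_matrix_inv[OF thick_open] by (auto intro: smooth_on_differentiable)
  have "Dd (\<lambda>q. A q ** ?R q) p v = Dd (\<lambda>q. mat 1) p v"
    by (rule fun_cong[OF Dd_cong[OF assms(1,4)]]) (simp add: matrix_inv_mult_right assms(3))
  then have "A p ** Dd ?R p v = - (Dd A p v ** ?R p)"
    by (simp add: Dd_bilinear[OF bounded_bilinear_matrix_mult d] eq_neg_iff_add_eq_0)
  then have "?R p ** (A p ** Dd ?R p v) = ?R p ** - (Dd A p v ** ?R p)" by simp
  then show ?thesis
    using matrix_inv_mult_left[OF assms(3)[OF assms(4)]]
    unfolding bounded_bilinear.minus_right[OF bounded_bilinear_matrix_mult]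
    by (simp add: matrix_mul_assoc)
qed

subsection \<open>Symmetry of second derivatives\<close>

lemma smooth_on_along_line:
  assumes "smooth_on S f" "\<And>s. s \<in> {0..r} \<Longrightarrow> x + s *\<^sub>R u \<in> S" "s \<in> {0..r}"
  shows "((\<lambda>s. f (x + s *\<^sub>R u)) has_derivative
    (\<lambda>c. c *\<^sub>R frechet_derivative f (at (x + s *\<^sub>R u) within S) u)) (at s within {0..r})"
proof -
  let ?D = "frechet_derivative f (at (x + s *\<^sub>R u) within S)"
  have D: "(f has_derivative ?D) (at (x + s *\<^sub>R u) within S)"
    using smooth_on_has_derivative[OF assms(1)] assms by blast
  have "((\<lambda>s. x + s *\<^sub>R u) has_derivative (\<lambda>c. c *\<^sub>R u)) (at s within {0..r})"
    by (auto intro!: derivative_eq_intros)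
  moreover have "(f has_derivative ?D) (at (x + s *\<^sub>R u) within ((\<lambda>s. x + s *\<^sub>R u) ` {0..r}))"
    using assms(2) by (intro has_derivative_subset[OF D]) auto
  ultimately have "((\<lambda>s. f (x + s *\<^sub>R u)) has_derivative (\<lambda>c. ?D (c *\<^sub>R u))) (at s within {0..r})"
    by (rule has_derivative_in_compose)
  then show ?thesis using has_derivative_linear[OF D] by (simp add: linear_scale)
qed

text \<open>The double difference of \<open>f\<close> over a small parallelogram is a mixed derivative at an intermediate
  point. The parallelogram may have \<open>p\<close> as a corner, so that \<open>p\<close> may lie on the boundary of \<open>S\<close>.\<close>

lemma double_difference_mean_value:
  fixes f :: "'v::euclidean_space \<Rightarrow> real"
  assumes "smooth_on S f" "r > 0"
    and box: "\<And>s t. s \<in> {0..r} \<Longrightarrow> t \<in> {0..r} \<Longrightarrow> p + s *\<^sub>R u + t *\<^sub>R v \<in> S"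
  shows "\<exists>s\<in>{0..r}. \<exists>t\<in>{0..r}. f (p + r *\<^sub>R u + r *\<^sub>R v) - f (p + r *\<^sub>R u) - f (p + r *\<^sub>R v) + f p =
     r\<^sup>2 * frechet_derivative (\<lambda>q. frechet_derivative f (at q within S) u) (at (p + s *\<^sub>R u + t *\<^sub>R v) within S) v"
proof -
  let ?D = "\<lambda>q. frechet_derivative f (at q within S) u"
  \<comment> \<open>The mean value theorem is applied twice: in \<open>s\<close> to the increment of
    \<open>f\<close> across the parallelogram in direction \<open>v\<close>, then in
    \<open>t\<close> to the derivative of \<open>f\<close> along \<open>u\<close>. Each application
    contributes one factor \<open>r\<close>.\<close>
  have 1: "((\<lambda>s. f (p + r *\<^sub>R v + s *\<^sub>R u) - f (p + s *\<^sub>R u)) has_derivative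
      (\<lambda>c. c *\<^sub>R ?D (p + r *\<^sub>R v + s *\<^sub>R u) - c *\<^sub>R ?D (p + s *\<^sub>R u))) (at s within {0..r})"
    if "s \<in> {0..r}" for s
    using box[of _ r] box[of _ 0] assms(2) that
    by (intro has_derivative_diff smooth_on_along_line[OF assms(1)]) (auto simp: add.assoc add.commute[of "_ *\<^sub>R v"])
  from mvt_simple[OF assms(2), of "\<lambda>s. f (p + r *\<^sub>R v + s *\<^sub>R u) - f (p + s *\<^sub>R u)", OF 1]
  obtain s where s: "s \<in> {0..r}" and
    "f (p + r *\<^sub>R v + r *\<^sub>R u) - f (p + r *\<^sub>R u) - (f (p + r *\<^sub>R v) - f p) =
       r * (?D (p + r *\<^sub>R v + s *\<^sub>R u) - ?D (p + s *\<^sub>R u))"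
    by (auto simp: right_diff_distrib) (metis greaterThanLessThan_iff atLeastAtMost_iff less_imp_le)
  moreover
  have 2: "((\<lambda>t. ?D (p + s *\<^sub>R u + t *\<^sub>R v)) has_derivative
      (\<lambda>c. c *\<^sub>R frechet_derivative ?D (at (p + s *\<^sub>R u + t *\<^sub>R v) within S) v)) (at t within {0..r})"
    if "t \<in> {0..r}" for t
    using box s that
    by (intro smooth_on_along_line smooth_on_frechet_derivative assms) auto
  from mvt_simple[OF assms(2), of "\<lambda>t. ?D (p + s *\<^sub>R u + t *\<^sub>R v)", OF 2]
  obtain t where "t \<in> {0..r}"
    "?D (p + s *\<^sub>R u + r *\<^sub>R v) - ?D (p + s *\<^sub>R u) =
      r * frechet_derivative ?D (at (p + s *\<^sub>R u + t *\<^sub>R v) within S) v"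
    by auto (metis greaterThanLessThan_iff atLeastAtMost_iff less_imp_le)
  ultimately show ?thesis
    by (intro bexI[of _ s] bexI[of _ t]) (auto simp: power2_eq_square algebra_simps)
qed

text \<open>The double difference is symmetric in \<open>u\<close> and \<open>v\<close>, so the two
  mixed derivatives agree at two intermediate points of a parallelogram of size \<open>r\<close>.
  For small \<open>r\<close> both points are near \<open>p\<close>, and continuity of the mixed
  derivatives makes their values at \<open>p\<close> differ by less than any
  \<open>e\<close>.\<close>

lemma second_derivative_commute_real:
  fixes f :: "'v::euclidean_space \<Rightarrow> real"
  assumes "smooth_on S f" "h > 0"
    and box: "\<And>s t. s \<in> {0..h} \<Longrightarrow> t \<in> {0..h} \<Longrightarrow> p + s *\<^sub>R u + t *\<^sub>R v \<in> S"
  shows "frechet_derivative (\<lambda>q. frechet_derivative f (at q within S) u) (at p within S) v =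
    frechet_derivative (\<lambda>q. frechet_derivative f (at q within S) v) (at p within S) u"
proof -
  let ?F = "\<lambda>a b x. frechet_derivative (\<lambda>q. frechet_derivative f (at q within S) a) (at x within S) b"
  have p: "p \<in> S" using box[of 0 0] assms(2) by simp
  have c: "continuous_on S (?F a b)" for a b
    by (intro smooth_on_continuous smooth_on_frechet_derivative assms)
  have "\<bar>?F u v p - ?F v u p\<bar> < e" if e: "e > 0" for e
  proof -
    obtain d1 where d1: "d1 > 0" "\<And>x. x \<in> S \<Longrightarrow> dist x p < d1 \<Longrightarrow> dist (?F u v x) (?F u v p) < e/2"
      using c[of u v] p e unfolding continuous_on_iff by (meson half_gt_zero)
    obtain d2 where d2: "d2 > 0" "\<And>x. x \<in> S \<Longrightarrow> dist x p < d2 \<Longrightarrow> dist (?F v u x) (?F v u p) < e/2"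
      using c[of v u] p e unfolding continuous_on_iff by (meson half_gt_zero)
    \<comment> \<open>The bound by \<open>h\<close> keeps the parallelogram in \<open>S\<close>; the
      quotient keeps its points within \<open>d1\<close> and \<open>d2\<close> of \<open>p\<close>.
      The summand 1 prevents division by zero and makes the estimate strict.\<close>
    define r where "r = min h (min d1 d2 / (norm u + norm v + 1))"
    have r: "r > 0" "r \<le> h" using d1 d2 assms(2) by (auto simp: r_def add_nonneg_pos)
    have "r * (norm u + norm v + 1) \<le> min d1 d2"
      using mult_right_mono[of r "min d1 d2 / (norm u + norm v + 1)" "norm u + norm v + 1"]
        add_nonneg_pos[of "norm u + norm v" 1] by (auto simp: r_def)
    then have r': "r * (norm u + norm v) < min d1 d2" using r by (simp add: algebra_simps)
    have near: "dist (p + s *\<^sub>R a + t *\<^sub>R b) p < min d1 d2"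
      if "s \<in> {0..r}" "t \<in> {0..r}" "norm a + norm b = norm u + norm v" for s t a b
    proof -
      have "norm (s *\<^sub>R a + t *\<^sub>R b) \<le> r * norm a + r * norm b"
        using that by (intro order_trans[OF norm_triangle_ineq] add_mono) (auto intro: mult_right_mono)
      also have "\<dots> = r * (norm u + norm v)" using that by (metis distrib_left)
      finally show ?thesis using r' by (simp add: dist_norm add.assoc)
    qed
    have box': "p + s *\<^sub>R v + t *\<^sub>R u \<in> S" if "s \<in> {0..h}" "t \<in> {0..h}" for s t
      using box[OF that(2,1)] by (simp add: algebra_simps)
    obtain s t where 1: "s \<in> {0..r}" "t \<in> {0..r}"
      "f (p + r *\<^sub>R u + r *\<^sub>R v) - f (p + r *\<^sub>R u) - f (p + r *\<^sub>R v) + f p = r\<^sup>2 * ?F u v (p + s *\<^sub>R u + t *\<^sub>R v)"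
      using double_difference_mean_value[OF assms(1) r(1), of p u v] box r by fastforce
    obtain s' t' where 2: "s' \<in> {0..r}" "t' \<in> {0..r}"
      "f (p + r *\<^sub>R v + r *\<^sub>R u) - f (p + r *\<^sub>R v) - f (p + r *\<^sub>R u) + f p = r\<^sup>2 * ?F v u (p + s' *\<^sub>R v + t' *\<^sub>R u)"
      using double_difference_mean_value[OF assms(1) r(1), of p v u] box' r by fastforce
    have "p + r *\<^sub>R v + r *\<^sub>R u = p + r *\<^sub>R u + r *\<^sub>R v" by simp
    then have "?F u v (p + s *\<^sub>R u + t *\<^sub>R v) = ?F v u (p + s' *\<^sub>R v + t' *\<^sub>R u)"
      using 1(3) 2(3) r(1) by (simp add: algebra_simps)
    moreover have "dist (?F u v (p + s *\<^sub>R u + t *\<^sub>R v)) (?F u v p) < e/2"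
      using d1(2) near[of s t u v] box[of s t] 1 r by auto
    moreover have "dist (?F v u (p + s' *\<^sub>R v + t' *\<^sub>R u)) (?F v u p) < e/2"
      using d2(2) near[of s' t' v u] box'[of s' t'] 2 r by auto
    ultimately show ?thesis unfolding dist_real_def by linarith
  qed
  from this[of "\<bar>?F u v p - ?F v u p\<bar>"] show ?thesis by (cases "?F u v p = ?F v u p") auto
qed

text \<open>The mean value argument needs real values, so the vector-valued case is taken component
  by component.\<close>

lemma second_derivative_commute:
  fixes f :: "'v::euclidean_space \<Rightarrow> 'w::euclidean_space"
  assumes S: "thick S" and f: "smooth_on S f" "h > 0"
    and box: "\<And>s t. s \<in> {0..h} \<Longrightarrow> t \<in> {0..h} \<Longrightarrow> p + s *\<^sub>R u + t *\<^sub>R v \<in> S"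
  shows "frechet_derivative (\<lambda>q. frechet_derivative f (at q within S) u) (at p within S) v =
    frechet_derivative (\<lambda>q. frechet_derivative f (at q within S) v) (at p within S) u"
proof (rule euclidean_eqI)
  fix e :: 'w assume "e \<in> Basis"
  have p: "p \<in> S" using box[of 0 0] f(2) by simp
  have inner: "frechet_derivative (\<lambda>q. F q \<bullet> e) (at x within S) b = frechet_derivative F (at x within S) b \<bullet> e"
    if "x \<in> S" "smooth_on S F" for F :: "'v \<Rightarrow> 'w" and x b
    using thick_frechet_derivative[OF S that(1) bounded_linear.has_derivative[OF bounded_linear_inner_left
          smooth_on_has_derivative[OF that(2,1)]], of e] by metis
  have "frechet_derivative (\<lambda>q. frechet_derivative (\<lambda>q. f q \<bullet> e) (at q within S) a) (at p within S) b =
      frechet_derivative (\<lambda>q. frechet_derivative f (at q within S) a) (at p within S) b \<bullet> e" for a b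
    using frechet_derivative_cong_within[OF p, of "\<lambda>q. frechet_derivative (\<lambda>q. f q \<bullet> e) (at q within S) a"
        "\<lambda>q. frechet_derivative f (at q within S) a \<bullet> e"] inner[OF _ f(1)]
      inner[OF p smooth_on_frechet_derivative[OF f(1)]] by metis
  then show "frechet_derivative (\<lambda>q. frechet_derivative f (at q within S) u) (at p within S) v \<bullet> e =
    frechet_derivative (\<lambda>q. frechet_derivative f (at q within S) v) (at p within S) u \<bullet> e"
    using second_derivative_commute_real[of S "\<lambda>q. f q \<bullet> e" h p u v] f box
      smooth_on_compose_linear[OF S bounded_linear_inner_left f(1), of e] by metis
qed

lemma Dd_commute:
  fixes f :: "'v::euclidean_space \<Rightarrow> 'w::euclidean_space"
  assumes U: "open U" and f: "smooth_on U f" and p: "p \<in> U"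
  shows "Dd (\<lambda>q. Dd f q u) p v = Dd (\<lambda>q. Dd f q v) p u"
proof -
  obtain r where r: "r > 0" "ball p r \<subseteq> U" using U p by (meson open_contains_ball)
  \<comment> \<open>Small enough for the whole parallelogram to stay inside the ball of radius
    \<open>r\<close>; the summand 1 covers \<open>u = v = 0\<close>.\<close>
  define h where "h = r / (norm u + norm v + 1)"
  have h: "h > 0" using r by (simp add: h_def add_nonneg_pos)
  have "p + s *\<^sub>R u + t *\<^sub>R v \<in> U" if "s \<in> {0..h}" "t \<in> {0..h}" for s t
  proof -
    have "norm (s *\<^sub>R u + t *\<^sub>R v) \<le> h * norm u + h * norm v"
      using that by (intro order_trans[OF norm_triangle_ineq] add_mono) (auto intro: mult_right_mono)
    also have "\<dots> < h * (norm u + norm v + 1)" using h by (simp add: algebra_simps)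
    also have "\<dots> = r" using add_nonneg_pos[of "norm u + norm v" 1] by (simp add: h_def)
    finally have "p + s *\<^sub>R u + t *\<^sub>R v \<in> ball p r" by (simp add: dist_norm add.assoc add.commute[of "t *\<^sub>R v"] norm_minus_commute)
    then show ?thesis using r by blast
  qed
  from second_derivative_commute[OF thick_open[OF U] f h this] have
    "frechet_derivative (\<lambda>q. frechet_derivative f (at q within U) u) (at p within U) v =
    frechet_derivative (\<lambda>q. frechet_derivative f (at q within U) v) (at p within U) u" .
  moreover have "frechet_derivative (\<lambda>q. frechet_derivative f (at q within U) a) (at p within U) b =
      Dd (\<lambda>q. Dd f q a) p b" for a b
    using frechet_derivative_cong_within[OF p, of "\<lambda>q. frechet_derivative f (at q within U) a" "\<lambda>q. Dd f q a"]
      at_within_open[OF _ U] p by metis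
  ultimately show ?thesis by simp
qed

subsection \<open>Maps on space-time\<close>

text \<open>Abstracts from \<open>[0,T)\<close> what the calculus uses: room to the right of each
  time, \<open>0\<close> included. This makes one-sided derivatives unique and leaves space for
  parallelograms that have a given time as their earliest one.\<close>

definition right_open :: "real set \<Rightarrow> bool" where
  "right_open I \<longleftrightarrow> (\<forall>t\<in>I. \<exists>h>0. {t..t + h} \<subseteq> I)"

lemma right_openE:
  assumes "right_open I" "t \<in> I" obtains h where "h > 0" "\<And>s. s \<in> {0..h} \<Longrightarrow> t + s \<in> I"
proof -
  obtain h where h: "h > 0" "{t..t + h} \<subseteq> I" using assms by (auto simp: right_open_def)
  then show thesis by (intro that[of h]) auto
qed

lemma thick_right_open:
  assumes "right_open I" shows "thick I"
  unfolding thick_def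
proof (intro ballI allI impI)
  fix x i :: real and e :: real assume x: "x \<in> I" and i: "i \<in> Basis" and e: "e > 0"
  obtain h where h: "h > 0" "\<And>s. s \<in> {0..h} \<Longrightarrow> x + s \<in> I" using right_openE[OF assms x] by blast
  show "\<exists>d. 0 < \<bar>d\<bar> \<and> \<bar>d\<bar> < e \<and> x + d *\<^sub>R i \<in> I"
    using h e i by (intro exI[of _ "min h (e/2)"]) auto
qed

lemma right_open_not_bot:
  assumes "right_open I" "t \<in> I" shows "at t within I \<noteq> bot"
proof -
  obtain h where h: "h > 0" "\<And>s. s \<in> {0..h} \<Longrightarrow> t + s \<in> I" using right_openE[OF assms] by blast
  have "t islimpt {t..t+h}" using h(1) by (simp add: islimpt_Icc)
  moreover have "{t..t+h} \<subseteq> I" using h(2)[of "_ - t"] by force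
  ultimately have "t islimpt I" using islimpt_subset by blast
  then show ?thesis by (simp add: trivial_limit_within)
qed

lemma smooth_on_slice_space:
  assumes "open U" "smooth_on (U \<times> I) f" "p \<in> U" "t \<in> I"
  shows "((\<lambda>q. f (q, t)) has_derivative
    (\<lambda>v. frechet_derivative f (at (p, t) within U \<times> I) (v, 0))) (at p)"
proof -
  have "((\<lambda>q. (q, t)) has_derivative (\<lambda>v. (v, 0))) (at p within U)"
    by (auto intro!: derivative_eq_intros)
  moreover have "(f has_derivative frechet_derivative f (at (p, t) within U \<times> I))
      (at (p, t) within ((\<lambda>q. (q, t)) ` U))"
    using assms by (intro has_derivative_subset[OF smooth_on_has_derivative[OF assms(2)]]) auto
  ultimately have "((\<lambda>q. f (q, t)) has_derivative
    (\<lambda>v. frechet_derivative f (at (p, t) within U \<times> I) (v, 0))) (at p within U)"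
    by (rule has_derivative_in_compose)
  then show ?thesis by (simp only: at_within_open[OF assms(3,1)])
qed

lemma has_derivative_slice_time:
  assumes D: "(f has_derivative D) (at (p, t) within U \<times> I)" and p: "p \<in> U"
  shows "((\<lambda>s. f (p, s)) has_vector_derivative D (0, 1)) (at t within I)"
proof -
  have "((\<lambda>s. (p, s)) has_derivative (\<lambda>v. (0, v))) (at t within I)"
    by (auto intro!: derivative_eq_intros)
  moreover have "(f has_derivative D) (at (p, t) within ((\<lambda>s. (p, s)) ` I))"
    using p by (intro has_derivative_subset[OF D]) auto
  ultimately have "((\<lambda>s. f (p, s)) has_derivative (\<lambda>v. D (0, v))) (at t within I)"
    by (rule has_derivative_in_compose)
  moreover have "(\<lambda>v. D (0, v)) = (\<lambda>v. v *\<^sub>R D (0, 1))"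
  proof
    fix v :: real
    show "D (0, v) = v *\<^sub>R D (0, 1)"
      using linear_scale[OF has_derivative_linear[OF D], of v "(0, 1)"]
      by (simp only: scaleR_Pair scaleR_zero_right real_scaleR_def mult_1_right)
  qed
  ultimately show ?thesis by (simp only: has_vector_derivative_def)
qed

lemma smooth_on_slice_time:
  assumes "smooth_on (U \<times> I) f" "p \<in> U" "t \<in> I"
  shows "((\<lambda>s. f (p, s)) has_vector_derivative
    frechet_derivative f (at (p, t) within U \<times> I) (0, 1)) (at t within I)"
  using assms(2,3) by (intro has_derivative_slice_time[OF smooth_on_has_derivative[OF assms(1)]]) auto

lemma smooth_on_space_derivative:
  assumes "open U" "smooth_on (U \<times> I) f"
  shows "smooth_on (U \<times> I) (\<lambda>(p, t). Dd (\<lambda>q. f (q, t)) p v)"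
proof -
  have "smooth_on (U \<times> I) (\<lambda>z. frechet_derivative f (at z within U \<times> I) (v, 0)) \<longleftrightarrow>
    smooth_on (U \<times> I) (\<lambda>(p, t). Dd (\<lambda>q. f (q, t)) p v)"
    using Dd_eqI[OF smooth_on_slice_space[OF assms]] by (intro smooth_on_cong) auto
  then show ?thesis using smooth_on_frechet_derivative[OF assms(2)] by simp
qed

lemma smooth_on_time_derivative:
  assumes "right_open I" "smooth_on (U \<times> I) f"
  shows "smooth_on (U \<times> I) (\<lambda>(p, t). vector_derivative (\<lambda>s. f (p, s)) (at t within I))"
proof -
  have "smooth_on (U \<times> I) (\<lambda>z. frechet_derivative f (at z within U \<times> I) (0, 1)) \<longleftrightarrow>
    smooth_on (U \<times> I) (\<lambda>(p, t). vector_derivative (\<lambda>s. f (p, s)) (at t within I))"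
    using vector_derivative_within[OF right_open_not_bot[OF assms(1)] smooth_on_slice_time[OF assms(2)]]
    by (intro smooth_on_cong) auto
  then show ?thesis using smooth_on_frechet_derivative[OF assms(2)] by simp
qed

text \<open>Symmetry of second derivatives for the directions \<open>(v, 0)\<close> and
  \<open>(0, 1)\<close>, on a parallelogram with corner \<open>(p, t)\<close> that only uses later
  times. The velocity \<open>h\<close> is differentiable because it is a slice of the smooth time
  derivative of \<open>f\<close>.\<close>

lemma space_time_commute:
  fixes f :: "'v::euclidean_space \<times> real \<Rightarrow> 'w::euclidean_space"
  assumes U: "open U" and I: "right_open I" and f: "smooth_on (U \<times> I) f" and p: "p \<in> U" and t: "t \<in> I"
    and h: "\<And>q. q \<in> U \<Longrightarrow> ((\<lambda>s. f (q, s)) has_vector_derivative h q) (at t within I)"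
  shows "h differentiable (at p)"
    and "((\<lambda>s. Dd (\<lambda>q. f (q, s)) p v) has_vector_derivative Dd h p v) (at t within I)"
proof -
  let ?S = "U \<times> I"
  let ?ft = "\<lambda>z. frechet_derivative f (at z within ?S) (0, 1)"
  have S: "thick ?S" by (intro thick_Times thick_open U thick_right_open I)
  have h_eq: "h q = ?ft (q, t)" if "q \<in> U" for q
    using vector_derivative_unique_within[OF right_open_not_bot[OF I t] h[OF that]
        smooth_on_slice_time[OF f that t]] .
  have "((\<lambda>q. ?ft (q, t)) has_derivative (\<lambda>v. frechet_derivative ?ft (at (p, t) within ?S) (v, 0))) (at p)"
    by (intro smooth_on_slice_space[OF U smooth_on_frechet_derivative[OF f] p t])
  then have hd: "(h has_derivative (\<lambda>v. frechet_derivative ?ft (at (p, t) within ?S) (v, 0))) (at p)"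
    by (rule has_derivative_transform_within_open[OF _ U p]) (simp add: h_eq)
  then show "h differentiable (at p)" by (rule differentiableI)
  obtain r where r: "r > 0" "ball p r \<subseteq> U" using U p by (meson open_contains_ball)
  obtain e where e: "e > 0" "\<And>s. s \<in> {0..e} \<Longrightarrow> t + s \<in> I" using right_openE[OF I t] by blast
  \<comment> \<open>Keeps \<open>p + s *\<^sub>R v\<close> inside the ball of radius
    \<open>r\<close> and the time shift below \<open>e\<close>.\<close>
  define c where "c = min e (r / (norm v + 1))"
  have nv: "norm v + 1 > 0" by (simp add: add_nonneg_pos)
  have c: "c > 0" using r e nv by (simp add: c_def)
  have box: "(p, t) + s *\<^sub>R (v, 0) + s' *\<^sub>R (0, 1) \<in> ?S" if s: "s \<in> {0..c}" "s' \<in> {0..c}" for s s'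
  proof -
    have "s * norm v < s * (norm v + 1) \<or> s = 0" using s by (auto simp: algebra_simps)
    moreover have "s * (norm v + 1) \<le> r"
      using s nv by (auto simp: c_def pos_le_divide_eq)
    ultimately have "p + s *\<^sub>R v \<in> ball p r" using s r by (auto simp: dist_norm)
    then show ?thesis using r e(2)[of s'] s by (auto simp: c_def)
  qed
  have "((\<lambda>s. Dd (\<lambda>q. f (q, s)) p v) has_vector_derivative
    frechet_derivative (\<lambda>z. frechet_derivative f (at z within ?S) (v, 0)) (at (p, t) within ?S) (0, 1)) (at t within I)"
    using smooth_on_slice_time[OF smooth_on_frechet_derivative[OF f, of "(v, 0)"] p t]
  proof (rule has_vector_derivative_transform[OF t, rotated])
    show "Dd (\<lambda>q. f (q, s)) p v = frechet_derivative f (at (p, s) within ?S) (v, 0)" if "s \<in> I" for s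
      using Dd_eqI[OF smooth_on_slice_space[OF U f p that]] by simp
  qed
  then show "((\<lambda>s. Dd (\<lambda>q. f (q, s)) p v) has_vector_derivative Dd h p v) (at t within I)"
    using second_derivative_commute[OF S f c box] Dd_eqI[OF hd] by simp
qed

subsection \<open>Linear ordinary differential equations\<close>

text \<open>The solution is the sum of the increments \<open>u m\<close> of the Picard iteration, which are of size
  \<open>(M t)^m / m!\<close> on compact intervals.\<close>

lemma linear_ode_exists:
  fixes C :: "real \<Rightarrow> real^'n^'n"
  assumes I: "right_open I" "is_interval I" "0 \<in> I" "I \<subseteq> {0..}" and C: "continuous_on I C"
  obtains y where "y 0 = y0" "\<And>t. t \<in> I \<Longrightarrow> (y has_vector_derivative C t *v y t) (at t within I)"
proof -
  define u where "u = rec_nat (\<lambda>t. y0) (\<lambda>m u t. integral {0..t} (\<lambda>s. C s *v u s))"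
  have u0: "u 0 = (\<lambda>t. y0)" and uS: "\<And>m. u (Suc m) = (\<lambda>t. integral {0..t} (\<lambda>s. C s *v u m s))"
    by (auto simp: u_def)
  define y where "y = (\<lambda>t. \<Sum>m. u m t)"
  have "\<exists>K>0. \<forall>(A::real^'n^'n) x. norm (A *v x) \<le> norm A * norm x * K"
    by (rule bounded_bilinear.pos_bounded[OF bounded_bilinear_matrix_vector])
  then obtain K where K0: "K > 0 \<and> (\<forall>(A::real^'n^'n) x. norm (A *v x) \<le> norm A * norm x * K)" by (rule exE)
  then have K: "K > 0" "norm (A *v x) \<le> norm A * norm x * K" for A :: "real^'n^'n" and x
    by (rule conjunct1) (rule K0[THEN conjunct2, rule_format])
  \<comment> \<open>The estimates are made on each compact interval \<open>{0..b}\<close>. The sum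
    \<open>y\<close> does not depend on \<open>b\<close>, so these local statements concern one
    function on all of \<open>I\<close>.\<close>
  have main: "(\<lambda>m. u m t) sums y t \<and> (y has_vector_derivative C t *v y t) (at t within {0..b})"
    if b: "b \<in> I" and tb: "t \<in> {0..b}" for b t
  proof -
    have sub: "{0..b} \<subseteq> I" using mem_is_interval_1_I[OF I(2,3) b] by (intro subsetI) simp
    have Cb: "continuous_on {0..b} C" by (rule continuous_on_subset[OF C sub])
    have cu: "continuous_on {0..b} (u m)" for m
    proof (induction m)
      case (Suc m)
      then have "continuous_on {0..b} (\<lambda>s. C s *v u m s)"
        by (intro bounded_bilinear.continuous_on[OF bounded_bilinear_matrix_vector] Cb)
      from integral_has_vector_derivative[OF this] show ?case
        unfolding uS by (intro continuous_on_vector_derivative) auto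
    qed (simp add: u0)
    have cCu: "continuous_on {0..b} (\<lambda>s. C s *v u m s)" for m
      by (intro bounded_bilinear.continuous_on[OF bounded_bilinear_matrix_vector] Cb cu)
    have du: "(u (Suc m) has_vector_derivative C s *v u m s) (at s within {0..b})" if "s \<in> {0..b}" for s m
      using integral_has_vector_derivative[OF cCu that] by (simp add: uS)
    have "compact (C ` {0..b})" by (rule compact_continuous_image[OF Cb]) simp
    then have "\<exists>M0. \<forall>A\<in>C ` {0..b}. norm A \<le> M0"
      unfolding bounded_iff[symmetric] by (rule compact_imp_bounded)
    then obtain M0 where "\<forall>A\<in>C ` {0..b}. norm A \<le> M0" by (rule exE)
    then have M0: "norm (C s) \<le> M0" if "s \<in> {0..b}" for s using imageI[OF that, of C] by (rule bspec)
    define M where "M = max M0 0 * K"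
    have M: "M \<ge> 0" "norm (C s *v x) \<le> M * norm x" if "s \<in> {0..b}" for s x
    proof -
      have "norm (C s *v x) \<le> norm (C s) * norm x * K" by (rule K)
      also have "\<dots> \<le> max M0 0 * norm x * K"
        using M0[OF that] K by (intro mult_right_mono) auto
      finally show "norm (C s *v x) \<le> M * norm x" by (simp add: M_def mult_ac)
    qed (use K in \<open>simp add: M_def\<close>)
    have bound: "norm (u m s) \<le> norm y0 * (M * s) ^ m / fact m" if "s \<in> {0..b}" for s m
      using that
    proof (induction m arbitrary: s)
      case (Suc m)
      show ?case
      proof (cases "s = 0")
        case True then show ?thesis by (simp add: uS)
      next
        case False
        then have s: "0 < s" "s \<le> b" using Suc.prems by auto
        have at: "at x within {0..b} = at x" if "0 < x" "x < s" for x
          using that s by (intro at_within_interior) auto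
        \<comment> \<open>The increment vanishes at \<open>0\<close> and its derivative is at most
          \<open>M\<close> times the previous bound, so it is dominated by the scalar function with
          that derivative.\<close>
        have "norm (u (Suc m) s - u (Suc m) 0) \<le>
          (\<lambda>x. norm y0 * (M * x) ^ Suc m / fact (Suc m)) s - (\<lambda>x. norm y0 * (M * x) ^ Suc m / fact (Suc m)) 0"
        proof (rule differentiable_bound_general[OF s(1)])
          show "continuous_on {0..s} (u (Suc m))" using continuous_on_subset[OF cu[of "Suc m"], of "{0..s}"] s by auto
          show "(u (Suc m) has_vector_derivative C x *v u m x) (at x)" if "0 < x" "x < s" for x
            using du[of x m] at[OF that] that s by auto
          show "((\<lambda>x. norm y0 * (M * x) ^ Suc m / fact (Suc m)) has_vector_derivative
              M * (norm y0 * (M * x) ^ m / fact m)) (at x)" for x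
            unfolding has_real_derivative_iff_has_vector_derivative[symmetric]
            by (rule derivative_eq_intros refl | simp)+ 
          show "norm (C x *v u m x) \<le> M * (norm y0 * (M * x) ^ m / fact m)" if "0 < x" "x < s" for x
          proof -
            have x: "x \<in> {0..b}" using that s by auto
            show ?thesis by (rule order_trans[OF M(2)[OF x] mult_left_mono[OF Suc.IH[OF x] M(1)[OF x]]])
          qed
        qed (intro continuous_intros, auto)
        then show ?thesis by (simp add: uS)
      qed
    qed (simp add: u0)
    have bound': "norm (u m s) \<le> norm y0 * ((M * b) ^ m / fact m)" if "s \<in> {0..b}" for s m
    proof -
      have "(M * s) ^ m \<le> (M * b) ^ m" using that M(1)[OF that] by (intro power_mono mult_left_mono) auto
      then have "norm y0 * (M * s) ^ m / fact m \<le> norm y0 * (M * b) ^ m / fact m"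
        by (intro divide_right_mono mult_left_mono) auto
      then show ?thesis using bound[OF that, of m] by simp
    qed
    have summ: "summable (\<lambda>m. norm y0 * ((M * b) ^ m / fact m))"
      using summable_exp_generic[of "M * b"] by (intro summable_mult) (simp add: divide_inverse mult.commute)
    have lim: "uniform_limit {0..b} (\<lambda>n s. \<Sum>m<n. u m s) y sequentially"
      unfolding y_def using bound' summ by (rule Weierstrass_m_test)
    \<comment> \<open>Termwise derivatives with the index shifted by one: the derivative of
      \<open>u (Suc k)\<close> involves \<open>u k\<close>. Hence \<open>n + 1\<close> terms of the
      derived series equal \<open>C\<close> applied to \<open>n\<close> terms of the original
      one.\<close>
    define u' where "u' = (\<lambda>m s. case m of 0 \<Rightarrow> 0 | Suc k \<Rightarrow> C s *v u k s)"
    have u'sum: "(\<Sum>i<Suc n. u' i s) = C s *v (\<Sum>i<n. u i s)" for n s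
      by (subst sum.lessThan_Suc_shift)
        (simp add: u'_def linear_sum[OF matrix_vector_mul_linear])
    have sums_t: "(\<lambda>m. u m s) sums y s" if "s \<in> {0..b}" for s
      unfolding sums_def using tendsto_uniform_limitI[OF lim that] .
    have b0: "b \<ge> 0" using b I by auto
    have "\<exists>g. \<forall>x\<in>{0..b}. (\<lambda>n. u n x) sums g x \<and> (g has_derivative (\<lambda>h. h *\<^sub>R (C x *v y x))) (at x within {0..b})"
    proof (rule has_derivative_series[where f'="\<lambda>m s h. h *\<^sub>R u' m s"])
      show "(u n has_derivative (\<lambda>h. h *\<^sub>R u' n x)) (at x within {0..b})" if "x \<in> {0..b}" for n x
        using du[OF that] by (cases n) (auto simp: u'_def u0 has_vector_derivative_def)
      show "\<forall>\<^sub>F n in sequentially. \<forall>x\<in>{0..b}. \<forall>h. norm ((\<Sum>i<n. h *\<^sub>R u' i x) - h *\<^sub>R (C x *v y x)) \<le> e * norm h"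
        if e: "e > 0" for e
      proof -
        \<comment> \<open>The tolerance \<open>e / (M + 1)\<close> used below suffices because
          \<open>M * (e / (M + 1)) \<le> e\<close>, also when \<open>M = 0\<close>.\<close>
        have M0': "M \<ge> 0" using M(1)[of b] b0 by simp
        have "\<forall>\<^sub>F n in sequentially. \<forall>x\<in>{0..b}. dist (\<Sum>m<n. u m x) (y x) < e / (M + 1)"
          using uniform_limitD[OF lim, of "e / (M + 1)"] e M0' by simp
        then have "\<forall>\<^sub>F n in sequentially. \<forall>x\<in>{0..b}. \<forall>h.
            norm ((\<Sum>i<Suc n. h *\<^sub>R u' i x) - h *\<^sub>R (C x *v y x)) \<le> e * norm h"
        proof (eventually_elim, intro ballI allI)
          fix n x h assume n: "\<forall>x\<in>{0..b}. dist (\<Sum>m<n. u m x) (y x) < e / (M + 1)" and x: "x \<in> {0..b}"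
          have "(\<Sum>i<Suc n. h *\<^sub>R u' i x) - h *\<^sub>R (C x *v y x) = h *\<^sub>R (C x *v ((\<Sum>m<n. u m x) - y x))"
            by (simp only: scaleR_sum_right[symmetric] u'sum matrix_vector_mult_diff_distrib scaleR_diff_right)
          moreover have "norm (C x *v ((\<Sum>m<n. u m x) - y x)) \<le> M * (e / (M + 1))"
            using n x M0' by (intro order_trans[OF M(2)[OF x]] mult_left_mono) (auto simp: dist_norm less_imp_le)
          moreover have "M * (e / (M + 1)) \<le> e" using M0' e by (simp add: field_simps)
          ultimately show "norm ((\<Sum>i<Suc n. h *\<^sub>R u' i x) - h *\<^sub>R (C x *v y x)) \<le> e * norm h"
            by (simp only: norm_scaleR mult.commute[of e] real_norm_def) (intro mult_left_mono, auto)
        qed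
        then show ?thesis by (rule iffD1[OF eventually_sequentially_Suc])
      qed
      show "0 \<in> {0..b}" using b0 by simp
      show "(\<lambda>n. u n 0) sums y 0" by (rule sums_t) (simp add: b0)
    qed simp
    then obtain g where g: "\<And>x. x \<in> {0..b} \<Longrightarrow> (\<lambda>n. u n x) sums g x"
      "\<And>x. x \<in> {0..b} \<Longrightarrow> (g has_derivative (\<lambda>h. h *\<^sub>R (C x *v y x))) (at x within {0..b})" by blast
    have "g x = y x" if "x \<in> {0..b}" for x using sums_unique2[OF g(1)[OF that] sums_t[OF that]] .
    then have "(y has_derivative (\<lambda>h. h *\<^sub>R (C t *v y t))) (at t within {0..b})"
      by (intro has_derivative_transform[OF tb _ g(2)[OF tb]]) simp
    then show ?thesis using sums_t[OF tb] by (simp add: has_vector_derivative_def)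
  qed
  show thesis
  proof
    have "u n 0 = 0" if "n \<notin> {0}" for n using that by (cases n) (auto simp: uS)
    from sums_finite[of "{0}" "\<lambda>m. u m 0", OF _ this] have "(\<lambda>m. u m 0) sums y0" by (simp add: u0)
    moreover have "(\<lambda>m. u m 0) sums y 0" using main[OF I(3), of 0] by simp
    ultimately show "y 0 = y0" by (rule sums_unique2[symmetric])
  next
    fix t assume t: "t \<in> I"
    \<comment> \<open>The derivative within \<open>I\<close> at \<open>t\<close> needs an interval
      that reaches beyond \<open>t\<close>; with \<open>b = t + h\<close> the two domains agree near
      \<open>t\<close>.\<close>
    obtain h where h: "h > 0" "\<And>s. s \<in> {0..h} \<Longrightarrow> t + s \<in> I" using right_openE[OF I(1) t] by blast
    have b: "t + h \<in> I" "t \<in> {0..t + h}" using h t I by auto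
    have "at t within I = at t within ({..<t+h} \<inter> I)"
      using h by (intro at_within_Int_open[symmetric]) auto
    moreover have "{..<t+h} \<inter> I \<subseteq> {0..t + h}" using I by auto
    ultimately show "(y has_vector_derivative C t *v y t) (at t within I)"
      using has_vector_derivative_within_subset[OF main[OF b, THEN conjunct2]] by simp
  qed
qed

section \<open>Linear algebra\<close>

definition pos_form :: "(real^'n::finite \<Rightarrow> real^'n \<Rightarrow> real) \<Rightarrow> bool" where
  "pos_form G \<longleftrightarrow> bilinear G \<and> (\<forall>u v. G u v = G v u) \<and> (\<forall>u. u \<noteq> 0 \<longrightarrow> G u u > 0)"

lemma pos_formD:
  assumes "pos_form G"
  shows "bilinear G" "G u v = G v u" "u \<noteq> 0 \<Longrightarrow> G u u > 0"
  using assms by (auto simp: pos_form_def)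

definition orthonormal_family :: "(real^'n \<Rightarrow> real^'n \<Rightarrow> real) \<Rightarrow> ('n::finite \<Rightarrow> real^'n) \<Rightarrow> bool" where
  "orthonormal_family G E \<longleftrightarrow> (\<forall>i j. G (E i) (E j) = (if i = j then 1 else 0))"

lemma vec_sum_axis: "(\<Sum>i\<in>UNIV. (u $ i) *\<^sub>R axis i 1) = (u :: real^'n)"
  by (simp add: vec_eq_iff axis_def if_distrib[of "\<lambda>x. _ * x"] cong: if_cong)

lemma linear_axis_expand: "linear f \<Longrightarrow> f u = (\<Sum>i\<in>UNIV. (u $ i) *\<^sub>R f (axis i 1))" for u :: "real^'n"
  by (subst vec_sum_axis[symmetric]) (simp only: linear_sum linear_scale)

lemma bilinear_linear:
  assumes "bilinear B" shows "linear (\<lambda>u. B u v)" "linear (\<lambda>v. B u v)"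
  using assms by (auto simp: bilinear_def)

lemma bilinear_axis_expand:
  fixes u :: "real^'n" and v :: "real^'m"
  assumes "bilinear B"
  shows "B u v = (\<Sum>i\<in>UNIV. \<Sum>j\<in>UNIV. (u $ i * v $ j) *\<^sub>R B (axis i 1) (axis j 1))"
  by (subst linear_axis_expand[OF bilinear_linear(1)[OF assms]], subst linear_axis_expand[OF bilinear_linear(2)[OF assms]])
    (simp add: scaleR_sum_right)

text \<open>Orthonormal sets are independent, so one of maximal cardinality exists. If it did not
  span, a Gram-Schmidt step with a vector outside its span would enlarge it.\<close>

lemma pos_form_orthonormal_family:
  fixes G :: "real^'n \<Rightarrow> real^'n \<Rightarrow> real"
  assumes G: "pos_form G"
  shows "\<exists>E. orthonormal_family G E"
proof -
  note lin = bilinear_linear[OF pos_formD(1)[OF G]] and sym = pos_formD(2)[OF G] and pos = pos_formD(3)[OF G]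
  define P where "P S \<longleftrightarrow> finite S \<and> (\<forall>x\<in>S. \<forall>y\<in>S. G x y = (if x = y then 1 else 0))" for S
  have indep: "independent S" if S: "P S" for S
  proof (rule independent_if_scalars_zero)
    show "finite S" using S by (simp add: P_def)
    fix f x assume f: "(\<Sum>x\<in>S. f x *\<^sub>R x) = 0" and x: "x \<in> S"
    have "0 = G (\<Sum>x\<in>S. f x *\<^sub>R x) x" using linear_0[OF lin(1)] f by simp
    also have "\<dots> = (\<Sum>y\<in>S. f y * G y x)" by (simp add: linear_sum[OF lin(1)] linear_scale[OF lin(1)])
    also have "\<dots> = (\<Sum>y\<in>S. if y = x then f y else 0)" using S x by (intro sum.cong) (auto simp: P_def)
    also have "\<dots> = f x" using S x by (simp add: P_def)
    finally show "f x = 0" by simp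
  qed
  have "P {}" by (simp add: P_def)
  moreover have "card S \<le> DIM(real^'n)" if "P S" for S using independent_card_le[OF indep[OF that]] .
  ultimately obtain S where S: "P S" and max: "\<And>S'. P S' \<Longrightarrow> card S' \<le> card S"
    using ex_has_greatest_nat[of P "{}" card "Suc (DIM(real^'n))"] by (metis le_imp_less_Suc)
  have fin: "finite S" using S by (simp add: P_def)
  have "span S = UNIV"
  proof (rule ccontr)
    assume "span S \<noteq> UNIV"
    then obtain v where v: "v \<notin> span S" by blast
    define w where "w = v - (\<Sum>x\<in>S. G v x *\<^sub>R x)"
    have "(\<Sum>x\<in>S. G v x *\<^sub>R x) \<in> span S" by (intro span_sum span_scale span_base)
    then have w0: "w \<noteq> 0" using v by (auto simp: w_def)
    have wS: "G w y = 0" if y: "y \<in> S" for y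
    proof -
      have "G w y = G v y - (\<Sum>x\<in>S. G v x * G x y)"
        by (simp add: w_def linear_diff[OF lin(1)] linear_sum[OF lin(1)] linear_scale[OF lin(1)])
      also have "(\<Sum>x\<in>S. G v x * G x y) = (\<Sum>x\<in>S. if x = y then G v x else 0)"
        using S y by (intro sum.cong) (auto simp: P_def)
      finally show ?thesis using fin y by simp
    qed
    define z where "z = (1 / sqrt (G w w)) *\<^sub>R w"
    have z: "G z z = 1" "\<And>y. y \<in> S \<Longrightarrow> G z y = 0"
      using pos[OF w0] wS by (auto simp: z_def linear_scale[OF lin(1)] linear_scale[OF lin(2)])
    then have "z \<notin> S" by force
    moreover have "G y z = 0" if "y \<in> S" for y using z(2)[OF that] sym[of y z] by simp
    then have "P (insert z S)" using S z \<open>z \<notin> S\<close> by (auto simp: P_def)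
    ultimately show False using max[of "insert z S"] fin by simp
  qed
  then have "card S = CARD('n)" using basis_card_eq_dim[of S UNIV] indep[OF S] by simp
  then obtain E where E: "bij_betw E (UNIV :: 'n set) S"
    using finite_same_card_bij[of "UNIV :: 'n set" S] fin by auto
  then have "E i \<in> S" "E i = E j \<longleftrightarrow> i = j" for i j
    by (auto simp: bij_betw_def inj_def)
  then show ?thesis using S by (intro exI[of _ E]) (auto simp: orthonormal_family_def P_def)
qed

lemma orthonormal_family_matrix:
  assumes G: "bilinear G" and E: "orthonormal_family G E"
  shows "G ((\<chi> i j. E j $ i) *v u) ((\<chi> i j. E j $ i) *v v) = u \<bullet> v"
proof -
  have B: "bilinear (\<lambda>u v. G ((\<chi> i j. E j $ i) *v u) ((\<chi> i j. E j $ i) *v v))"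
    using G unfolding bilinear_def
    by (auto intro!: linear_compose[OF matrix_vector_mul_linear, unfolded o_def])
  have ax: "(\<chi> i j. E j $ i) *v axis m 1 = E m" for m
    by (simp add: matrix_vector_mult_basis column_def vec_eq_iff)
  show ?thesis
    using E by (subst bilinear_axis_expand[OF B])
      (simp add: ax orthonormal_family_def inner_vec_def if_distrib[of "\<lambda>x. _ * x"] cong: if_cong)
qed

lemma pos_form_orthonormal_matrix:
  fixes G :: "real^'n \<Rightarrow> real^'n \<Rightarrow> real"
  assumes G: "pos_form G"
  obtains Q :: "real^'n^'n" where "det Q > 0" "\<And>u v. G (Q *v u) (Q *v v) = u \<bullet> v"
proof -
  obtain E where E: "orthonormal_family G E" using pos_form_orthonormal_family[OF G] by blast
  define Q :: "real^'n^'n" where "Q = (\<chi> i j. E j $ i)"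
  have Q: "G (Q *v u) (Q *v v) = u \<bullet> v" for u v
    unfolding Q_def by (rule orthonormal_family_matrix[OF pos_formD(1)[OF G] E])
  have "Q *v u = 0 \<Longrightarrow> u = 0" for u
    using Q[of u u] linear_0[OF bilinear_linear(1)[OF pos_formD(1)[OF G]]] by simp
  then have Q0: "det Q \<noteq> 0"
    using matrix_left_invertible_ker[of Q] invertible_left_inverse[of Q] by (auto simp: invertible_det_nz)
  \<comment> \<open>If the orthonormal basis has negative determinant, it is composed with the
    reflection \<open>D\<close> in the \<open>k\<close>-th coordinate, which preserves the inner
    product and has determinant -1.\<close>
  fix k :: 'n
  define D :: "real^'n^'n" where "D = (\<chi> i j. if i = j then if i = k then -1 else 1 else 0)"
  have "det D = (\<Prod>i\<in>UNIV. if i = k then -1 else 1)"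
    by (subst det_diagonal) (auto simp: D_def)
  then have detD: "det D = -1" by simp
  have Dv: "(D *v u) $ i = (if i = k then - (u $ i) else u $ i)" for u i
  proof -
    have "(D *v u) $ i = (\<Sum>j\<in>UNIV. if i = j then (if i = k then - (u $ j) else u $ j) else 0)"
      unfolding matrix_vector_mult_def D_def vec_lambda_beta by (intro sum.cong) auto
    then show ?thesis by simp
  qed
  have DD: "(D *v u) \<bullet> (D *v v) = u \<bullet> v" for u v
    unfolding inner_vec_def by (intro sum.cong) (auto simp: Dv)
  show thesis
  proof (cases "det Q > 0")
    case True then show ?thesis using Q that by blast
  next
    case False
    show ?thesis
      by (rule that[of "Q ** D"]) (use False Q0 in \<open>auto simp: det_mul detD Q DD simp flip: matrix_vector_mul_assoc\<close>)
  qed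
qed

text \<open>With the vectors \<open>E m\<close> as columns of \<open>Q\<close>, orthonormality says
  \<open>transpose Q ** g ** Q = mat 1\<close>, so \<open>Q ** transpose Q\<close> is the inverse of
  the Gram matrix.\<close>

lemma inv_metric_orthonormal:
  fixes G :: "real^'n \<Rightarrow> real^'n \<Rightarrow> real"
  assumes G: "bilinear G" and E: "orthonormal_family G E"
  shows "inv_metric G $ i $ j = (\<Sum>m\<in>UNIV. E m $ i * E m $ j)"
proof -
  define Q where "Q = (\<chi> i j. E j $ i)"
  define g where "g = (\<chi> i j. G (axis i 1) (axis j 1))"
  have "(transpose Q ** g ** Q) $ a $ b = mat 1 $ a $ b" for a b
  proof -
    have "(transpose Q ** g ** Q) $ a $ b = (\<Sum>j\<in>UNIV. (\<Sum>i\<in>UNIV. E a $ i * G (axis i 1) (axis j 1)) * E b $ j)"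
      by (simp add: matrix_matrix_mult_def transpose_def Q_def g_def)
    also have "\<dots> = (\<Sum>j\<in>UNIV. \<Sum>i\<in>UNIV. (E a $ i * E b $ j) *\<^sub>R G (axis i 1) (axis j 1))"
      by (simp add: sum_distrib_left sum_distrib_right mult_ac)
    also have "\<dots> = G (E a) (E b)" by (subst bilinear_axis_expand[OF G, of "E a"], subst sum.swap) simp
    finally show ?thesis using E by (simp add: orthonormal_family_def mat_def)
  qed
  then have "(transpose Q ** g) ** Q = mat 1" by (simp add: vec_eq_iff)
  then have "Q ** (transpose Q ** g) = mat 1" by (rule matrix_left_right_inverse[THEN iffD1])
  then have "(Q ** transpose Q) ** g = mat 1" by (simp only: matrix_mul_assoc)
  then have "g ** (Q ** transpose Q) = mat 1" by (rule matrix_left_right_inverse[THEN iffD1])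
  then have "inv_metric G = Q ** transpose Q" by (simp add: inv_metric_def g_def matrix_inv_unique)
  then show ?thesis by (simp add: matrix_matrix_mult_def transpose_def Q_def)
qed

text \<open>Identifies the coordinate trace with the trace over any orthonormal basis. This makes
  the bases picked by the choice operator in \<open>grass_metric\<close> and \<open>tr_Phi\<close>
  harmless.\<close>

lemma tr_metric_orthonormal:
  fixes G :: "real^'n \<Rightarrow> real^'n \<Rightarrow> real"
  assumes G: "bilinear G" and E: "orthonormal_family G E" and B: "bilinear B"
  shows "tr_metric G B = (\<Sum>m\<in>UNIV. B (E m) (E m))"
proof -
  have "tr_metric G B = (\<Sum>i\<in>UNIV. \<Sum>j\<in>UNIV. \<Sum>m\<in>UNIV. (E m $ i * E m $ j) *\<^sub>R B (axis i 1) (axis j 1))"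
    by (simp add: tr_metric_def inv_metric_orthonormal[OF G E] scaleR_sum_left)
  also have "\<dots> = (\<Sum>i\<in>UNIV. \<Sum>m\<in>UNIV. \<Sum>j\<in>UNIV. (E m $ i * E m $ j) *\<^sub>R B (axis i 1) (axis j 1))"
    by (intro sum.cong refl sum.swap)
  also have "\<dots> = (\<Sum>m\<in>UNIV. \<Sum>i\<in>UNIV. \<Sum>j\<in>UNIV. (E m $ i * E m $ j) *\<^sub>R B (axis i 1) (axis j 1))"
    by (rule sum.swap)
  also have "\<dots> = (\<Sum>m\<in>UNIV. B (E m) (E m))"
    by (intro sum.cong refl bilinear_axis_expand[OF B, symmetric])
  finally show ?thesis .
qed

lemma orthonormal_expand:
  fixes G :: "real^'n \<Rightarrow> real^'n \<Rightarrow> real"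
  assumes G: "pos_form G" and E: "orthonormal_family G E"
  shows "(\<Sum>m\<in>UNIV. G u (E m) *\<^sub>R E m) = u"
proof -
  note lin = bilinear_linear[OF pos_formD(1)[OF G]]
  define Q where "Q = (\<chi> i j. E j $ i)"
  have Q: "G (Q *v u) (Q *v v) = u \<bullet> v" for u v
    unfolding Q_def by (rule orthonormal_family_matrix[OF pos_formD(1)[OF G] E])
  have ax: "Q *v axis m 1 = E m" for m
    by (simp add: Q_def matrix_vector_mult_basis column_def vec_eq_iff)
  have "Q *v u = 0 \<Longrightarrow> u = 0" for u
    using Q[of u u] linear_0[OF lin(1)] by simp
  then have "det Q \<noteq> 0"
    using matrix_left_invertible_ker[of Q] invertible_left_inverse[of Q] by (auto simp: invertible_det_nz)
  then have u: "u = Q *v (matrix_inv Q *v u)" by (simp add: matrix_vector_mul_assoc matrix_inv_mult_right)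
  define x where "x = matrix_inv Q *v u"
  have "G u (E m) = x $ m" for m
    using Q[of x "axis m 1"] u by (simp add: ax x_def inner_axis)
  then have "(\<Sum>m\<in>UNIV. G u (E m) *\<^sub>R E m) = (\<Sum>m\<in>UNIV. (x $ m) *\<^sub>R (Q *v axis m 1))" by (simp add: ax)
  also have "\<dots> = Q *v x" by (rule linear_axis_expand[OF matrix_vector_mul_linear, symmetric])
  finally show ?thesis using u by (simp add: x_def)
qed

text \<open>Brings the metric into the coordinate trace that defines \<open>ricci\<close>, so that
  the Gauss equation can be inserted.\<close>

lemma trace_orthonormal:
  fixes G :: "real^'n \<Rightarrow> real^'n \<Rightarrow> real"
  assumes G: "pos_form G" and E: "orthonormal_family G E" and T: "linear T"
  shows "(\<Sum>i\<in>UNIV. T (axis i 1) $ i) = (\<Sum>m\<in>UNIV. G (T (E m)) (E m))"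
proof -
  note lin = bilinear_linear[OF pos_formD(1)[OF G]]
  have "(\<Sum>i\<in>UNIV. T (axis i 1) $ i) = (\<Sum>i\<in>UNIV. \<Sum>m\<in>UNIV. G (T (axis i 1)) (E m) * E m $ i)"
    by (subst orthonormal_expand[OF G E, symmetric]) simp
  also have "\<dots> = (\<Sum>m\<in>UNIV. \<Sum>i\<in>UNIV. G (T (axis i 1)) (E m) * E m $ i)" by (rule sum.swap)
  also have "\<dots> = (\<Sum>m\<in>UNIV. G (T (E m)) (E m))"
    by (intro sum.cong refl, subst linear_axis_expand[OF linear_compose[OF T lin(1), unfolded o_def]])
      (simp add: mult.commute)
  finally show ?thesis .
qed

lemma pos_form_det:
  fixes G :: "real^'n \<Rightarrow> real^'n \<Rightarrow> real"
  assumes G: "pos_form G" shows "det (\<chi> i j. G (axis i 1) (axis j 1)) \<noteq> 0"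
proof -
  have "u = 0" if u: "(\<chi> i j. G (axis i 1) (axis j 1)) *v u = 0" for u
  proof -
    have "G (axis i 1) u = 0" for i
      using arg_cong[OF u, of "\<lambda>x. x $ i"] linear_axis_expand[OF bilinear_linear(2)[OF pos_formD(1)[OF G]], of "axis i 1" u]
      by (simp add: matrix_vector_mult_def mult.commute)
    then have "G u u = 0"
      using linear_axis_expand[OF bilinear_linear(1)[OF pos_formD(1)[OF G]], of u u] by simp
    then show "u = 0" using pos_formD(3)[OF G, of u] by force
  qed
  then show ?thesis
    using matrix_left_invertible_ker[of "\<chi> i j. G (axis i 1) (axis j 1)"] invertible_left_inverse by (auto simp: invertible_det_nz)
qed

text \<open>Raising an index: the vector that represents the covector \<open>T\<close>. It produces
  the tangential projection, the Christoffel vector and the coefficient of the parallel transport in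
  time.\<close>

lemma pos_form_inv_solve:
  fixes G :: "real^'n \<Rightarrow> real^'n \<Rightarrow> real"
  assumes G: "pos_form G" and T: "linear T"
  shows "G (inv_metric G *v (\<chi> l. T (axis l 1))) w = T w"
proof -
  let ?g = "\<chi> i j. G (axis i 1) (axis j 1)"
  let ?z = "inv_metric G *v (\<chi> l. T (axis l 1))"
  have "?g *v ?z = (\<chi> l. T (axis l 1))"
    using matrix_inv_mult_right[OF pos_form_det[OF G]] by (simp add: inv_metric_def matrix_vector_mul_assoc)
  then have "G (axis l 1) ?z = T (axis l 1)" for l
    using linear_axis_expand[OF bilinear_linear(2)[OF pos_formD(1)[OF G]], of "axis l 1" ?z]
    by (simp add: vec_eq_iff matrix_vector_mult_def[of ?g] mult.commute)
  then have "G w ?z = T w"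
    using linear_axis_expand[OF bilinear_linear(1)[OF pos_formD(1)[OF G]], of w ?z] linear_axis_expand[OF T, of w] by simp
  then show ?thesis using pos_formD(2)[OF G, of _ w] by simp
qed

lemma pos_form_eqI:
  assumes G: "pos_form G" and "\<And>w. G z w = G z' w" shows "z = z'"
  using pos_formD(3)[OF G, of "z - z'"] linear_diff[OF bilinear_linear(1)[OF pos_formD(1)[OF G]]] assms(2)
  by force

section \<open>Frames and charts of the Grassmannian\<close>

lemma bilinear_flat_form: "bilinear (flat_form \<epsilon>)"
  by (auto simp: bilinear_def flat_form_def algebra_simps sum.distrib sum_distrib_left intro!: linearI)

lemma flat_form_sym: "flat_form \<epsilon> v w = flat_form \<epsilon> w v"
  by (simp add: flat_form_def mult.commute)

lemmas linear_flat_form = bilinear_linear[OF bilinear_flat_form]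

lemmas bounded_bilinear_flat_form = bilinear_flat_form[THEN bilinear_conv_bounded_bilinear[THEN iffD1]]

lemma flat_form_simps:
  "flat_form \<epsilon> (u + v) w = flat_form \<epsilon> u w + flat_form \<epsilon> v w"
  "flat_form \<epsilon> w (u + v) = flat_form \<epsilon> w u + flat_form \<epsilon> w v"
  "flat_form \<epsilon> (u - v) w = flat_form \<epsilon> u w - flat_form \<epsilon> v w"
  "flat_form \<epsilon> w (u - v) = flat_form \<epsilon> w u - flat_form \<epsilon> w v"
  "flat_form \<epsilon> (c *\<^sub>R u) w = c * flat_form \<epsilon> u w"
  "flat_form \<epsilon> w (c *\<^sub>R u) = c * flat_form \<epsilon> w u"
  "flat_form \<epsilon> 0 w = 0" "flat_form \<epsilon> w 0 = 0"
  by (simp_all add: linear_add[OF linear_flat_form(1)] linear_add[OF linear_flat_form(2)]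
      linear_diff[OF linear_flat_form(1)] linear_diff[OF linear_flat_form(2)]
      linear_scale[OF linear_flat_form(1)] linear_scale[OF linear_flat_form(2)]
      linear_0[OF linear_flat_form(1)] linear_0[OF linear_flat_form(2)])

lemma sum_UNIV_Plus: "(\<Sum>i\<in>UNIV. f i) = (\<Sum>i\<in>UNIV. f (Inl i)) + (\<Sum>j\<in>UNIV. f (Inr j))"
  for f :: "'n::finite + 'k::finite \<Rightarrow> 'w::comm_monoid_add"
  by (simp add: UNIV_Plus_UNIV[symmetric] sum.Plus del: UNIV_Plus_UNIV)

lemma flat_form_inner: "flat_form 1 v w = v \<bullet> w"
  by (simp add: flat_form_def inner_vec_def sum_UNIV_Plus)

text \<open>The diagonal matrix that represents the flat form with respect to the Euclidean inner
  product. It reduces questions of dimension for orthogonal complements to the Euclidean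
  case.\<close>

definition sgn_flip :: "real \<Rightarrow> real^('n::finite + 'k::finite) \<Rightarrow> real^('n + 'k)" where
  "sgn_flip \<epsilon> w = (\<chi> i. case i of Inl a \<Rightarrow> w $ i | Inr b \<Rightarrow> \<epsilon> * w $ i)"

lemma linear_sgn_flip: "linear (sgn_flip \<epsilon>)"
  by (intro linearI) (auto simp: sgn_flip_def vec_eq_iff algebra_simps split: sum.split)

lemma flat_form_sgn_flip: "flat_form \<epsilon> v w = v \<bullet> sgn_flip \<epsilon> w"
  by (simp add: flat_form_def inner_vec_def sum_UNIV_Plus sgn_flip_def sum_distrib_left mult_ac)

lemma sgn_flip_eq_0: "\<epsilon> \<noteq> 0 \<Longrightarrow> sgn_flip \<epsilon> w = 0 \<Longrightarrow> w = 0"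
  unfolding sgn_flip_def vec_eq_iff vec_lambda_beta zero_index
proof (intro allI)
  fix i assume e: "\<epsilon> \<noteq> 0" and *: "\<forall>i. (case i of Inl a \<Rightarrow> w $ i | Inr b \<Rightarrow> \<epsilon> * w $ i) = 0"
  show "w $ i = 0" using e *[rule_format, of i] by (cases i) auto
qed

section \<open>Frames, induced forms and tangential projections\<close>

lemma frame_linear: "frame \<epsilon> f \<Longrightarrow> linear f"
  by (simp add: frame_def)

lemma frame_eq_0: "frame \<epsilon> f \<Longrightarrow> f u = 0 \<Longrightarrow> u = 0"
  using linear_injective_0[of f] by (auto simp: frame_def)

text \<open>For \<open>f = Dd Y p\<close> this is the first fundamental form in coordinates.\<close>

definition pull_form ::
  "real \<Rightarrow> (real^'n \<Rightarrow> real^('n::finite + 'k::finite)) \<Rightarrow> real^'n \<Rightarrow> real^'n \<Rightarrow> real" where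
  "pull_form \<epsilon> f u v = flat_form \<epsilon> (f u) (f v)"

text \<open>In the pseudo-Euclidean case positivity is part of \<open>frame\<close>; in the
  Euclidean case it follows from injectivity.\<close>

lemma pos_form_frame:
  fixes f :: "real^'n \<Rightarrow> real^('n::finite + 'k::finite)"
  assumes "\<epsilon> = 1 \<or> \<epsilon> = -1" "frame \<epsilon> f"
  shows "pos_form (pull_form \<epsilon> f)"
  unfolding pos_form_def
proof (intro conjI allI impI)
  show "bilinear (pull_form \<epsilon> f)"
    using frame_linear[OF assms(2)] by (auto simp: bilinear_def pull_form_def flat_form_simps linear_add linear_scale intro!: linearI)
  show "pull_form \<epsilon> f u v = pull_form \<epsilon> f v u" for u v by (simp add: pull_form_def flat_form_sym)
  fix u :: "real^'n" assume u: "u \<noteq> 0"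
  show "pull_form \<epsilon> f u u > 0"
  proof (cases "\<epsilon> = -1")
    case True then show ?thesis using assms(2) u by (simp add: frame_def pull_form_def)
  next
    case False
    then show ?thesis using assms u frame_eq_0[OF assms(2), of u] by (auto simp: pull_form_def flat_form_inner)
  qed
qed

text \<open>The flat form may be indefinite, but it is positive definite on the range of a frame,
  and this determines the tangential part.\<close>

lemma tan_proj_unique:
  assumes "\<epsilon> = 1 \<or> \<epsilon> = -1" "frame \<epsilon> f" and z: "\<And>u. flat_form \<epsilon> (w - f z) (f u) = 0"
  shows "tan_proj \<epsilon> (range f) w = f z"
  unfolding tan_proj_def
proof (rule the_equality)
  show "f z \<in> range f \<and> (\<forall>q\<in>range f. flat_form \<epsilon> (w - f z) q = 0)" using z by auto
next
  fix p assume p: "p \<in> range f \<and> (\<forall>q\<in>range f. flat_form \<epsilon> (w - p) q = 0)"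
  then obtain z' where z': "p = f z'" by auto
  have "pull_form \<epsilon> f z' u = pull_form \<epsilon> f z u" for u
    using z[of u] p by (auto simp: z' pull_form_def flat_form_simps)
  then show "p = f z" using pos_form_eqI[OF pos_form_frame[OF assms(1,2)]] z' by auto
qed

lemma tan_proj_frame:
  assumes "\<epsilon> = 1 \<or> \<epsilon> = -1" "frame \<epsilon> f"
  obtains z where "tan_proj \<epsilon> (range f) w = f z" "\<And>u. flat_form \<epsilon> (w - f z) (f u) = 0"
proof -
  let ?G = "pull_form \<epsilon> f"
  have T: "linear (\<lambda>u. flat_form \<epsilon> w (f u))"
    using linear_compose[OF frame_linear[OF assms(2)] linear_flat_form(2)] by (simp add: o_def)
  define z where "z = inv_metric ?G *v (\<chi> l. flat_form \<epsilon> w (f (axis l 1)))"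
  have z: "flat_form \<epsilon> (w - f z) (f u) = 0" for u
    using pos_form_inv_solve[OF pos_form_frame[OF assms] T, of u] by (simp add: z_def pull_form_def flat_form_simps)
  then show thesis using tan_proj_unique[OF assms z] that by blast
qed

lemma nor_proj_orth:
  assumes "\<epsilon> = 1 \<or> \<epsilon> = -1" "frame \<epsilon> f"
  shows "flat_form \<epsilon> (nor_proj \<epsilon> (range f) w) (f u) = 0"
  using tan_proj_frame[OF assms, of w] unfolding nor_proj_def by metis

lemma nor_proj_unique:
  assumes "\<epsilon> = 1 \<or> \<epsilon> = -1" "frame \<epsilon> f" "\<And>u. flat_form \<epsilon> x (f u) = 0" "w - x = f z"
  shows "nor_proj \<epsilon> (range f) w = x"
proof -
  have *: "w - f z = x" using assms(4) by (metis add_diff_cancel_left' diff_add_cancel diff_diff_eq2)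
  have "tan_proj \<epsilon> (range f) w = f z"
    by (rule tan_proj_unique[OF assms(1,2)]) (simp only: * assms(3))
  then show ?thesis using * by (simp add: nor_proj_def)
qed

lemma linear_nor_proj:
  assumes "\<epsilon> = 1 \<or> \<epsilon> = -1" "frame \<epsilon> f"
  shows "linear (nor_proj \<epsilon> (range f))"
proof -
  note f = frame_linear[OF assms(2)]
  have dec: "\<exists>z. w - nor_proj \<epsilon> (range f) w = f z" for w
  proof -
    obtain z where "tan_proj \<epsilon> (range f) w = f z" using tan_proj_frame[OF assms, of w] by blast
    then show ?thesis by (intro exI[of _ z]) (simp add: nor_proj_def)
  qed
  show ?thesis
  proof (rule linearI)
    fix x y
    obtain a b where ab: "x - nor_proj \<epsilon> (range f) x = f a" "y - nor_proj \<epsilon> (range f) y = f b" using dec by metis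
    show "nor_proj \<epsilon> (range f) (x + y) = nor_proj \<epsilon> (range f) x + nor_proj \<epsilon> (range f) y"
      by (rule nor_proj_unique[OF assms, where z="a + b"])
        (simp_all add: flat_form_simps nor_proj_orth[OF assms] linear_add[OF f] flip: ab(1) ab(2))
  next
    fix c x
    obtain a where a: "x - nor_proj \<epsilon> (range f) x = f a" using dec by metis
    show "nor_proj \<epsilon> (range f) (c *\<^sub>R x) = c *\<^sub>R nor_proj \<epsilon> (range f) x"
      by (rule nor_proj_unique[OF assms, where z="c *\<^sub>R a"])
        (simp_all add: flat_form_simps nor_proj_orth[OF assms] linear_scale[OF f] scaleR_diff_right flip: a)
  qed
qed

lemma nor_proj_tangent:
  assumes "\<epsilon> = 1 \<or> \<epsilon> = -1" "frame \<epsilon> f"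
  shows "nor_proj \<epsilon> (range f) (f u) = 0"
  by (rule nor_proj_unique[OF assms, where z=u]) (simp_all add: flat_form_simps)

lemma flat_form_nor_proj:
  assumes "\<epsilon> = 1 \<or> \<epsilon> = -1" "frame \<epsilon> f"
  shows "flat_form \<epsilon> (nor_proj \<epsilon> (range f) v) (nor_proj \<epsilon> (range f) w) = flat_form \<epsilon> (nor_proj \<epsilon> (range f) v) w"
proof -
  obtain z where "tan_proj \<epsilon> (range f) w = f z" using tan_proj_frame[OF assms] by metis
  then show ?thesis
    using nor_proj_orth[OF assms, of v z] by (simp add: nor_proj_def[of _ _ w] flat_form_simps)
qed

text \<open>The chosen orthonormal basis of the plane is pulled back by \<open>f\<close> to an
  orthonormal family of \<open>pull_form \<epsilon> f\<close>; the trace does not depend on which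
  one it is.\<close>

lemma grass_metric_frame:
  fixes f :: "real^'n \<Rightarrow> real^('n::finite + 'k::finite)"
  assumes "\<epsilon> = 1 \<or> \<epsilon> = -1" "frame \<epsilon> f" "linear (\<lambda>u. \<phi> (f u))" "linear (\<lambda>u. \<psi> (f u))"
  shows "grass_metric \<epsilon> (range f) \<phi> \<psi> = \<epsilon> * tr_metric (pull_form \<epsilon> f) (\<lambda>u v. flat_form \<epsilon> (\<phi> (f u)) (\<psi> (f v)))"
proof -
  let ?G = "pull_form \<epsilon> f"
  let ?C = "\<lambda>e :: 'n \<Rightarrow> real^('n + 'k). \<forall>i j. e i \<in> range f \<and> flat_form \<epsilon> (e i) (e j) = (if i = j then 1 else 0)"
  have G: "pos_form ?G" by (rule pos_form_frame[OF assms(1,2)])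
  obtain E where "orthonormal_family ?G E" using pos_form_orthonormal_family[OF G] by blast
  then have "?C (\<lambda>i. f (E i))" by (simp add: orthonormal_family_def pull_form_def)
  then have C: "?C (SOME e. ?C e)" by (rule someI[of ?C])
  define e where "e = (SOME e. ?C e)"
  have e: "e i \<in> range f" "flat_form \<epsilon> (e i) (e j) = (if i = j then 1 else 0)" for i j
    using C unfolding e_def by blast+
  define E where "E = (\<lambda>i. inv f (e i))"
  have E: "e i = f (E i)" for i using f_inv_into_f[OF e(1)] by (simp add: E_def)
  have ort: "orthonormal_family ?G E"
    using e(2) by (simp add: orthonormal_family_def pull_form_def flip: E)
  have B: "bilinear (\<lambda>u v. flat_form \<epsilon> (\<phi> (f u)) (\<psi> (f v)))"
    using linear_compose[OF assms(3) linear_flat_form(1)] linear_compose[OF assms(4) linear_flat_form(2)]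
    by (simp add: bilinear_def o_def)
  show ?thesis
    unfolding grass_metric_def e_def[symmetric] Let_def
    by (simp add: tr_metric_orthonormal[OF pos_formD(1)[OF G] ort B] E)
qed

lemma oriented_span_compose:
  assumes "det B > 0" shows "oriented_span (\<lambda>u. f (B *v u)) = oriented_span f"
proof -
  have "\<exists>C. (\<lambda>u. f (B *v (A *v u))) = (\<lambda>u. f (C *v u)) \<and> det C > 0" if "det A > 0" for A
    using assms that by (intro exI[of _ "B ** A"]) (simp add: det_mul matrix_vector_mul_assoc)
  moreover have "\<exists>C. (\<lambda>u. f (A *v u)) = (\<lambda>u. f (B *v (C *v u))) \<and> det C > 0" if "det A > 0" for A
  proof (intro exI conjI)
    have d: "det B \<noteq> 0" using assms by simp
    show "(\<lambda>u. f (A *v u)) = (\<lambda>u. f (B *v ((matrix_inv B ** A) *v u)))"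
      by (simp add: matrix_vector_mul_assoc matrix_mul_assoc matrix_inv_mult_right[OF d])
    have "det B * det (matrix_inv B) = 1" by (simp add: matrix_inv_mult_right[OF d] flip: det_mul)
    then show "det (matrix_inv B ** A) > 0"
      using assms that by (simp add: det_mul) (metis mult_pos_pos zero_less_mult_pos zero_less_one)
  qed
  ultimately show ?thesis unfolding oriented_span_def by (auto 0 3)
qed

lemma oriented_span_self: "f \<in> oriented_span f"
  unfolding oriented_span_def by (auto intro!: exI[of _ "mat 1"])

lemma subspace_of_oriented_span: "subspace_of (oriented_span f) = range f"
  using oriented_span_self[of f] by (force simp: subspace_of_def oriented_span_def)

section \<open>Graph coordinates of planes\<close>

text \<open>Coordinates of \<open>w\<close> along the reference plane of an adapted basis;
  \<open>pN\<close> gives those along its complement.\<close>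

definition pF :: "real \<Rightarrow> ('n::finite, 'k::finite) gchart \<Rightarrow> real^('n + 'k) \<Rightarrow> real^'n" where
  "pF \<epsilon> b w = (\<chi> i. flat_form \<epsilon> w (fst b (axis i 1)))"

text \<open>The factor \<open>\<epsilon>\<close> compensates the value \<open>\<epsilon>\<close> of
  the form on the normal basis vectors, since \<open>\<epsilon> * \<epsilon> = 1\<close>.\<close>

definition pN :: "real \<Rightarrow> ('n::finite, 'k::finite) gchart \<Rightarrow> real^('n + 'k) \<Rightarrow> real^'k" where
  "pN \<epsilon> b w = (\<chi> i. \<epsilon> * flat_form \<epsilon> w (snd b (axis i 1)))"

lemma linear_pF: "linear (pF \<epsilon> b)"
  by (intro linearI) (simp_all add: pF_def vec_eq_iff flat_form_simps)

lemma linear_pN: "linear (pN \<epsilon> b)"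
  by (intro linearI) (simp_all add: pN_def vec_eq_iff flat_form_simps algebra_simps)

lemma gchartsD:
  assumes "b \<in> gcharts \<epsilon>"
  shows "linear (fst b)" "linear (snd b)" "flat_form \<epsilon> (fst b u) (fst b v) = u \<bullet> v"
    "flat_form \<epsilon> (fst b u) (snd b z) = 0" "flat_form \<epsilon> (snd b z) (fst b u) = 0"
    "flat_form \<epsilon> (snd b z) (snd b z') = \<epsilon> * (z \<bullet> z')"
  using assms by (auto simp: gcharts_def flat_form_sym[of \<epsilon> "snd b z" "fst b u"])

lemma chart_projections:
  assumes "\<epsilon> = 1 \<or> \<epsilon> = -1" "b \<in> gcharts \<epsilon>"
  shows "pF \<epsilon> b (fst b u) = u" "pF \<epsilon> b (snd b z) = 0" "pN \<epsilon> b (fst b u) = 0" "pN \<epsilon> b (snd b z) = z"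
  using assms(1) by (auto simp: pF_def pN_def gchartsD[OF assms(2)] inner_axis vec_eq_iff)

text \<open>The map sending \<open>(u, z)\<close> to \<open>fst b u + snd b z\<close> is injective,
  as \<open>pF\<close> and \<open>pN\<close> recover \<open>u\<close> and \<open>z\<close>; by
  dimension it is onto.\<close>

lemma chart_decompose:
  fixes b :: "('n::finite, 'k::finite) gchart"
  assumes "\<epsilon> = 1 \<or> \<epsilon> = -1" "b \<in> gcharts \<epsilon>"
  shows "fst b (pF \<epsilon> b w) + snd b (pN \<epsilon> b w) = w"
proof -
  note b = gchartsD[OF assms(2)] and p = chart_projections[OF assms]
  define \<Psi> where "\<Psi> = (\<lambda>(u, z). fst b u + snd b z)"
  have lin: "linear \<Psi>"
    by (intro linearI) (auto simp: \<Psi>_def linear_add[OF b(1)] linear_add[OF b(2)] linear_scale[OF b(1)]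
        linear_scale[OF b(2)] scaleR_add_right)
  have inv: "pF \<epsilon> b (\<Psi> (u, z)) = u" "pN \<epsilon> b (\<Psi> (u, z)) = z" for u z
    by (simp_all add: \<Psi>_def linear_add[OF linear_pF] linear_add[OF linear_pN] p)
  have "inj \<Psi>" by (rule injI) (metis inv prod.exhaust)
  then have "dim (range \<Psi>) = DIM((real^'n) \<times> (real^'k))" using dim_image_eq[OF lin, of UNIV] by simp
  then have "dim (range \<Psi>) = DIM(real^('n + 'k))" by simp
  moreover have "subspace (range \<Psi>)" by (rule linear_subspace_image[OF lin subspace_UNIV])
  ultimately have "range \<Psi> = UNIV" by (metis dim_eq_full span_eq_iff)
  then obtain u z where "w = \<Psi> (u, z)" by (metis rangeE surj_pair UNIV_I)
  then show ?thesis using inv by (simp add: \<Psi>_def)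
qed

lemma linear_gframe: "b \<in> gcharts \<epsilon> \<Longrightarrow> linear (gframe b L)"
  unfolding gframe_def
  by (intro linear_compose_add gchartsD(1) linear_compose[OF matrix_vector_mul_linear gchartsD(2), unfolded o_def])

lemma gframe_proj:
  assumes "\<epsilon> = 1 \<or> \<epsilon> = -1" "b \<in> gcharts \<epsilon>"
  shows "pF \<epsilon> b (gframe b L u) = u" "pN \<epsilon> b (gframe b L u) = L *v u"
  by (simp_all add: gframe_def linear_add[OF linear_pF] linear_add[OF linear_pN] chart_projections[OF assms])

lemma gframe_eqI:
  assumes "\<epsilon> = 1 \<or> \<epsilon> = -1" "b \<in> gcharts \<epsilon>" "pN \<epsilon> b w = L *v pF \<epsilon> b w"
  shows "gframe b L (pF \<epsilon> b w) = w"
  using chart_decompose[OF assms(1,2), of w] assms(3) by (simp add: gframe_def)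

text \<open>Two graph frames of the same plane differ by a change of basis. Comparing components
  along the reference plane makes it the identity, and the remaining components give
  \<open>L = L'\<close>. Hence \<open>gcoord\<close> is well defined.\<close>

lemma gframe_span_inj:
  assumes "\<epsilon> = 1 \<or> \<epsilon> = -1" "b \<in> gcharts \<epsilon>" "oriented_span (gframe b L) = oriented_span (gframe b L')"
  shows "L = L'"
proof -
  obtain B where "gframe b L = (\<lambda>u. gframe b L' (B *v u))"
    using oriented_span_self[of "gframe b L"] assms(3) by (auto simp: oriented_span_def)
  then have B: "gframe b L u = gframe b L' (B *v u)" for u by metis
  have "u = B *v u" for u using arg_cong[OF B, of "pF \<epsilon> b" u] by (simp only: gframe_proj[OF assms(1,2)])
  then have "L *v u = L' *v u" for u
    using arg_cong[OF B, of "pN \<epsilon> b" u] by (simp only: gframe_proj[OF assms(1,2)])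
  then show ?thesis by (simp add: matrix_eq)
qed

lemma gcoord_gframe:
  assumes "\<epsilon> = 1 \<or> \<epsilon> = -1" "b \<in> gcharts \<epsilon>"
  shows "gcoord b (oriented_span (gframe b L)) = L"
  unfolding gcoord_def by (rule the_equality) (auto dest: gframe_span_inj[OF assms])

text \<open>The slope of the plane spanned by \<open>f\<close>: its normal part times the inverse of
  its part along the reference plane.\<close>

definition frame_coord :: "real \<Rightarrow> ('n::finite, 'k::finite) gchart \<Rightarrow> (real^'n \<Rightarrow> real^('n + 'k)) \<Rightarrow> real^'n^'k" where
  "frame_coord \<epsilon> b f = matrix (\<lambda>u. pN \<epsilon> b (f u)) ** matrix_inv (matrix (\<lambda>u. pF \<epsilon> b (f u)))"

text \<open>Positivity says that the plane projects isomorphically, with orientation, onto the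
  reference plane, which is membership in \<open>gdom\<close>.\<close>

definition frame_det :: "real \<Rightarrow> ('n::finite, 'k::finite) gchart \<Rightarrow> (real^'n \<Rightarrow> real^('n + 'k)) \<Rightarrow> real" where
  "frame_det \<epsilon> b f = det (matrix (\<lambda>u. pF \<epsilon> b (f u)))"

lemma matrix_of_linear:
  fixes f :: "real^'n \<Rightarrow> real^'m" shows "linear f \<Longrightarrow> matrix f *v x = f x"
  by (rule fun_cong[OF matrix_vector_mul(2)])

lemma frame_coord_works:
  assumes f: "linear f" and d: "frame_det \<epsilon> b f \<noteq> 0"
  shows "frame_coord \<epsilon> b f *v pF \<epsilon> b (f u) = pN \<epsilon> b (f u)"
proof -
  have l: "linear (\<lambda>u. pF \<epsilon> b (f u))" "linear (\<lambda>u. pN \<epsilon> b (f u))"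
    using linear_compose[OF f linear_pF] linear_compose[OF f linear_pN] by (simp_all add: o_def)
  have "pF \<epsilon> b (f u) = matrix (\<lambda>u. pF \<epsilon> b (f u)) *v u" "pN \<epsilon> b (f u) = matrix (\<lambda>u. pN \<epsilon> b (f u)) *v u"
    using matrix_of_linear[OF l(1), of u] matrix_of_linear[OF l(2), of u] by simp_all
  then show ?thesis
    using matrix_inv_mult_left[OF d[unfolded frame_det_def]]
    by (simp add: frame_coord_def matrix_vector_mul_assoc flip: matrix_mul_assoc)
qed

text \<open>The frame \<open>f\<close> is the graph frame precomposed with the matrix
  \<open>A\<close> of its projection to the reference plane, and \<open>det A > 0\<close> makes this
  an oriented change of basis.\<close>

lemma frame_span_chart:
  assumes e: "\<epsilon> = 1 \<or> \<epsilon> = -1" and b: "b \<in> gcharts \<epsilon>" and f: "frame \<epsilon> f" and d: "frame_det \<epsilon> b f > 0"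
  shows "oriented_span (gframe b (frame_coord \<epsilon> b f)) = oriented_span f"
    "frame \<epsilon> (gframe b (frame_coord \<epsilon> b f))"
    "gframe b (frame_coord \<epsilon> b f) (pF \<epsilon> b (f u)) = f u"
    "range (gframe b (frame_coord \<epsilon> b f)) = range f"
    "gcoord b (oriented_span f) = frame_coord \<epsilon> b f"
    "oriented_span f \<in> gdom \<epsilon> b"
proof -
  let ?L = "frame_coord \<epsilon> b f"
  define A where "A = matrix (\<lambda>u. pF \<epsilon> b (f u))"
  have A: "det A > 0" using d by (simp add: A_def frame_det_def)
  then have A0: "det A \<noteq> 0" by simp
  have lin: "linear f" using frame_linear[OF f] .
  show g: "gframe b ?L (pF \<epsilon> b (f u)) = f u" for u
    using d by (intro gframe_eqI[OF e b] frame_coord_works[OF lin, symmetric]) simp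
  have Au: "A *v u = pF \<epsilon> b (f u)" for u
    unfolding A_def using matrix_of_linear[OF linear_compose[OF lin linear_pF], of \<epsilon> b u] by (simp add: o_def)
  have fA: "f = (\<lambda>u. gframe b ?L (A *v u))" by (rule ext) (simp add: Au g)
  show s: "oriented_span (gframe b ?L) = oriented_span f"
    by (subst (2) fA) (rule oriented_span_compose[OF A, symmetric])
  have gf: "gframe b ?L u = f (matrix_inv A *v u)" for u
    by (subst (2) fA) (simp add: matrix_vector_mul_assoc matrix_inv_mult_right[OF A0])
  have i0: "matrix_inv A *v u = 0 \<Longrightarrow> u = 0" for u
    using matrix_inv_mult_right[OF A0] by (metis matrix_vector_mul_assoc matrix_vector_mul_lid matrix_vector_mult_0_right)
  have "gframe b ?L u = 0 \<Longrightarrow> u = 0" for u using gf frame_eq_0[OF f] i0 by metis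
  then have "inj (gframe b ?L)" using linear_injective_0[OF linear_gframe[OF b]] by blast
  moreover have "flat_form \<epsilon> (gframe b ?L u) (gframe b ?L u) > 0" if "\<epsilon> = -1" "u \<noteq> 0" for u
    unfolding gf using f that i0 unfolding frame_def by blast
  ultimately show fr: "frame \<epsilon> (gframe b ?L)" using linear_gframe[OF b] by (simp add: frame_def)
  show "range (gframe b ?L) = range f" using s subspace_of_oriented_span by metis
  show "gcoord b (oriented_span f) = ?L" using gcoord_gframe[OF e b, of ?L] s by simp
  have "oriented_span (gframe b ?L) \<in> gdom \<epsilon> b" using fr unfolding gdom_def by blast
  then show "oriented_span f \<in> gdom \<epsilon> b" by (simp only: s)
qed

lemma gdom_frame_det:
  assumes e: "\<epsilon> = 1 \<or> \<epsilon> = -1" and b: "b \<in> gcharts \<epsilon>" and f: "frame \<epsilon> f" and P: "oriented_span f \<in> gdom \<epsilon> b"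
  shows "frame_det \<epsilon> b f > 0"
proof -
  obtain L where "oriented_span f = oriented_span (gframe b L)" using P by (auto simp: gdom_def)
  then obtain B where B: "f = (\<lambda>u. gframe b L (B *v u))" "det B > 0"
    using oriented_span_self[of f] by (auto simp: oriented_span_def)
  have "(\<lambda>u. pF \<epsilon> b (f u)) = (\<lambda>u. B *v u)" by (rule ext) (simp add: B gframe_proj[OF e b])
  then show ?thesis using B by (simp add: frame_det_def)
qed

text \<open>The vectors \<open>f u + c *\<^sub>R w\<close> have \<open>n + 1\<close> parameters but
  only \<open>n\<close> positive coordinates, so for some nonzero parameter all positive coordinates
  vanish and the form is nonpositive. If \<open>w\<close> were not negative, the form would also be
  nonnegative there; then the vector is zero, which contradicts the choice of the parameter.\<close>

lemma neg_definite_complement: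
  fixes f :: "real^'n \<Rightarrow> real^('n::finite + 'k::finite)"
  assumes f: "frame (-1) f" and w: "\<And>u. flat_form (-1) w (f u) = 0" "w \<noteq> 0"
  shows "flat_form (-1) w w < 0"
proof (rule ccontr)
  assume neg: "\<not> flat_form (-1) w w < 0"
  define \<Psi> where "\<Psi> = (\<lambda>(u, c :: real). (\<chi> i. (f u + c *\<^sub>R w) $ Inl i) :: real^'n)"
  have lin: "linear \<Psi>"
    by (intro linearI) (auto simp: \<Psi>_def vec_eq_iff linear_add[OF frame_linear[OF f]] linear_scale[OF frame_linear[OF f]] algebra_simps)
  have "\<not> inj \<Psi>"
  proof
    assume "inj \<Psi>"
    then have "dim (range \<Psi>) = DIM((real^'n) \<times> real)" using dim_image_eq[OF lin, of UNIV] by simp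
    then show False using dim_subset_UNIV[of "range \<Psi>"] by simp
  qed
  then obtain x where "\<Psi> x = 0" "x \<noteq> 0" using linear_injective_0[OF lin] by blast
  then obtain u c where x: "\<Psi> (u, c) = 0" "u \<noteq> 0 \<or> c \<noteq> 0" by (cases x) (auto simp: zero_prod_def)
  define v where "v = f u + c *\<^sub>R w"
  have Inl: "v $ Inl i = 0" for i using x(1) by (simp add: \<Psi>_def v_def vec_eq_iff)
  have vu: "flat_form (-1) v (f u) = flat_form (-1) (f u) (f u)" by (simp add: v_def flat_form_simps w(1))
  have vv: "flat_form (-1) v v = flat_form (-1) (f u) (f u) + c\<^sup>2 * flat_form (-1) w w"
    using w(1)[of u] by (simp add: v_def flat_form_simps flat_form_sym[of _ "f u" w] power2_eq_square)
  have fu: "u \<noteq> 0 \<Longrightarrow> flat_form (-1) (f u) (f u) > 0" using f by (simp add: frame_def)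
  have "flat_form (-1) (f u) (f u) \<ge> 0"
    using fu linear_0[OF frame_linear[OF f]] by (cases "u = 0") (auto simp: flat_form_simps)
  then have "flat_form (-1) v v \<ge> 0" using neg vv by simp
  moreover have "flat_form (-1) v v = - (\<Sum>j\<in>UNIV. (v $ Inr j)\<^sup>2)"
    by (simp add: flat_form_def Inl power2_eq_square)
  ultimately have "(\<Sum>j\<in>UNIV. (v $ Inr j)\<^sup>2) = 0"
    using sum_nonneg[of UNIV "\<lambda>j. (v $ Inr j)\<^sup>2"] by simp
  then have "v $ Inr j = 0" for j by (simp add: sum_nonneg_eq_0_iff)
  then have v0: "v = 0" unfolding vec_eq_iff using Inl by (metis sum.exhaust zero_index)
  then have "u = 0" using vu fu by (force simp: flat_form_simps)
  then show False using v0 x(2) w(2) linear_0[OF frame_linear[OF f]] by (simp add: v_def)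
qed

text \<open>The chart is centred at the plane itself, which becomes the graph of \<open>0\<close>.
  The frame is orthonormalised with positive determinant; the complement \<open>V\<close> has
  dimension \<open>k\<close>, and \<open>\<epsilon>\<close> times the form is positive definite on
  it, so it can be orthonormalised in the same way.\<close>

lemma chart_exists:
  fixes f :: "real^'n \<Rightarrow> real^('n::finite + 'k::finite)"
  assumes e: "\<epsilon> = 1 \<or> \<epsilon> = -1" and f: "frame \<epsilon> f"
  shows "\<exists>b\<in>gcharts \<epsilon>. oriented_span f \<in> gdom \<epsilon> b"
proof -
  obtain Q :: "real^'n^'n" where Q: "det Q > 0" "\<And>u v. pull_form \<epsilon> f (Q *v u) (Q *v v) = u \<bullet> v"
    using pos_form_orthonormal_matrix[OF pos_form_frame[OF e f]] by blast
  define V where "V = {w. \<forall>u. flat_form \<epsilon> w (f u) = 0}"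
  have lin: "linear (\<lambda>u. sgn_flip \<epsilon> (f u))"
    using linear_compose[OF frame_linear[OF f] linear_sgn_flip] by (simp add: o_def)
  have e0: "\<epsilon> \<noteq> 0" using e by auto
  have inj: "inj (\<lambda>u. sgn_flip \<epsilon> (f u))"
    using linear_injective_0[OF lin] sgn_flip_eq_0[OF e0] frame_eq_0[OF f] by blast
  have "V = {y \<in> UNIV. \<forall>x\<in>range (\<lambda>u. sgn_flip \<epsilon> (f u)). orthogonal x y}"
    by (auto simp: V_def orthogonal_def flat_form_sgn_flip inner_commute)
  moreover have "dim (range (\<lambda>u. sgn_flip \<epsilon> (f u))) = CARD('n)"
    using dim_image_eq[OF lin, of UNIV] inj by simp
  ultimately have "dim V + CARD('n) = DIM(real^('n + 'k))"
    using dim_subspace_orthogonal_to_vectors[of "range (\<lambda>u. sgn_flip \<epsilon> (f u))" UNIV]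
      linear_subspace_image[OF lin subspace_UNIV] by simp
  then have dimV: "dim V = dim (UNIV :: (real^'k) set)" by simp
  have subV: "subspace V" by (auto simp: V_def subspace_def flat_form_simps)
  obtain g :: "real^'k \<Rightarrow> real^('n + 'k)" where g: "linear g" "range g = V" "inj g"
    using subspace_isomorphism[OF subspace_UNIV subV dimV[symmetric]] by metis
  have gV: "flat_form \<epsilon> (g z) (f u) = 0" for z u using g(2) by (auto simp: V_def)
  have "pos_form (\<lambda>z z'. \<epsilon> * flat_form \<epsilon> (g z) (g z'))"
    unfolding pos_form_def
  proof (intro conjI allI impI)
    show "bilinear (\<lambda>z z'. \<epsilon> * flat_form \<epsilon> (g z) (g z'))"
      by (auto simp: bilinear_def flat_form_simps linear_add[OF g(1)] linear_scale[OF g(1)] algebra_simps intro!: linearI)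
    show "\<epsilon> * flat_form \<epsilon> (g u) (g v) = \<epsilon> * flat_form \<epsilon> (g v) (g u)" for u v by (simp add: flat_form_sym)
    fix z :: "real^'k" assume "z \<noteq> 0"
    then have gz: "g z \<noteq> 0" using g linear_injective_0[OF g(1)] by blast
    show "\<epsilon> * flat_form \<epsilon> (g z) (g z) > 0"
    proof (cases "\<epsilon> = 1")
      case True then show ?thesis using gz by (simp add: flat_form_inner)
    next
      case False
      then have "\<epsilon> = -1" using e by simp
      then show ?thesis using neg_definite_complement[of f "g z"] f gV gz by simp
    qed
  qed
  from pos_form_orthonormal_matrix[OF this]
  obtain R :: "real^'k^'k" where R: "\<And>z z'. \<epsilon> * flat_form \<epsilon> (g (R *v z)) (g (R *v z')) = z \<bullet> z'" by blast
  have R': "flat_form \<epsilon> (g (R *v z)) (g (R *v z')) = \<epsilon> * (z \<bullet> z')" for z z'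
    using R[of z z'] e by auto
  define b where "b = ((\<lambda>u. f (Q *v u)), (\<lambda>z. g (R *v z)))"
  have b: "b \<in> gcharts \<epsilon>"
    using Q(2) R' gV linear_compose[OF matrix_vector_mul_linear frame_linear[OF f], of Q]
      linear_compose[OF matrix_vector_mul_linear g(1), of R]
    by (auto simp: gcharts_def b_def pull_form_def o_def flat_form_sym[of \<epsilon> "f _" "g _"])
  have "gframe b 0 = (\<lambda>u. f (Q *v u))"
    by (rule ext) (simp add: gframe_def b_def linear_0[OF g(1)])
  then have "oriented_span (gframe b 0) = oriented_span f" using oriented_span_compose[OF Q(1), of f] by simp
  moreover have "frame \<epsilon> (gframe b 0)"
    unfolding frame_def
  proof (intro conjI impI allI)
    show "linear (gframe b 0)" by (rule linear_gframe[OF b])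
    show "inj (gframe b 0)" using gframe_proj(1)[OF e b] by (metis injI)
    show "flat_form \<epsilon> (gframe b 0 u) (gframe b 0 u) > 0" if "u \<noteq> 0" for u
      using gchartsD(3)[OF b, of u u] that by (simp add: gframe_def linear_0[OF gchartsD(2)[OF b]])
  qed
  then have "oriented_span (gframe b 0) \<in> gdom \<epsilon> b" unfolding gdom_def by blast
  ultimately show ?thesis using b by (intro bexI[of _ b]) simp
qed

text \<open>The kernel of \<open>graph_defect \<epsilon> b L\<close> is the plane with coordinate \<open>L\<close>, so that it identifies the normal
  space with \<open>real^'k\<close>. It turns the extrinsic geometry of an immersion into derivatives of \<open>L\<close>.\<close>

definition graph_defect :: "real \<Rightarrow> ('n::finite, 'k::finite) gchart \<Rightarrow> real^'n^'k \<Rightarrow> real^('n + 'k) \<Rightarrow> real^'k" where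
  "graph_defect \<epsilon> b L w = pN \<epsilon> b w - L *v pF \<epsilon> b w"

lemma linear_graph_defect: "linear (graph_defect \<epsilon> b L)"
  by (intro linearI) (simp_all add: graph_defect_def linear_add[OF linear_pF] linear_add[OF linear_pN]
      linear_scale[OF linear_pF] linear_scale[OF linear_pN] algebra_simps matrix_vector_mult_scaleR)

context
  fixes \<epsilon> :: real and b :: "('n::finite, 'k::finite) gchart" and L :: "real^'n^'k"
  assumes e: "\<epsilon> = 1 \<or> \<epsilon> = -1" and b: "b \<in> gcharts \<epsilon>" and fr: "frame \<epsilon> (gframe b L)"
begin

lemma graph_defect_gframe: "graph_defect \<epsilon> b L (gframe b L u) = 0"
  by (simp add: graph_defect_def gframe_proj[OF e b])

lemma graph_defect_nor_proj: "graph_defect \<epsilon> b L (nor_proj \<epsilon> (range (gframe b L)) w) = graph_defect \<epsilon> b L w"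
proof -
  obtain z where "tan_proj \<epsilon> (range (gframe b L)) w = gframe b L z" using tan_proj_frame[OF e fr, of w] by blast
  then show ?thesis
    by (simp add: nor_proj_def linear_diff[OF linear_graph_defect] graph_defect_gframe)
qed

lemma graph_defect_nor_eqI:
  assumes "graph_defect \<epsilon> b L v = graph_defect \<epsilon> b L w"
  shows "nor_proj \<epsilon> (range (gframe b L)) v = nor_proj \<epsilon> (range (gframe b L)) w"
proof -
  have "graph_defect \<epsilon> b L (v - w) = 0" using assms by (simp add: linear_diff[OF linear_graph_defect])
  then have "v - w = gframe b L (pF \<epsilon> b (v - w))"
    using gframe_eqI[OF e b, of "v - w" L] by (simp add: graph_defect_def)
  then have "nor_proj \<epsilon> (range (gframe b L)) (v - w) = 0" using nor_proj_tangent[OF e fr] by metis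
  then show ?thesis by (simp add: linear_diff[OF linear_nor_proj[OF e fr]])
qed

lemma ghom_gframe: "ghom \<epsilon> b L A (gframe b L u) = nor_proj \<epsilon> (range (gframe b L)) (snd b (A *v u))"
proof -
  have "(THE u'. gframe b L u' = gframe b L u) = u"
    using fr by (auto simp: frame_def inj_def)
  then show ?thesis by (simp add: ghom_def)
qed

lemma flat_form_chart:
  "flat_form \<epsilon> w (fst b u) = pF \<epsilon> b w \<bullet> u" "flat_form \<epsilon> w (snd b z) = \<epsilon> * (pN \<epsilon> b w \<bullet> z)"
proof -
  have ee: "\<epsilon> * \<epsilon> = 1" using e by auto
  have w: "flat_form \<epsilon> w x = flat_form \<epsilon> (fst b (pF \<epsilon> b w) + snd b (pN \<epsilon> b w)) x" for x
    by (simp add: chart_decompose[OF e b])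
  show "flat_form \<epsilon> w (fst b u) = pF \<epsilon> b w \<bullet> u" "flat_form \<epsilon> w (snd b z) = \<epsilon> * (pN \<epsilon> b w \<bullet> z)"
    by (subst w, simp add: flat_form_simps gchartsD[OF b])+
qed

text \<open>Orthogonality to \<open>fst b u + snd b (L *v u)\<close> for all \<open>u\<close>
  expresses the component along the reference plane by the other one, so \<open>pN\<close>
  determines a normal vector.\<close>

lemma pF_normal:
  assumes "\<And>u. flat_form \<epsilon> n (gframe b L u) = 0"
  shows "pF \<epsilon> b n = - \<epsilon> *\<^sub>R (transpose L *v pN \<epsilon> b n)"
proof -
  have "pF \<epsilon> b n \<bullet> u + (\<epsilon> *\<^sub>R (transpose L *v pN \<epsilon> b n)) \<bullet> u = 0" for u
    using assms[of u] by (simp add: gframe_def flat_form_simps flat_form_chart dot_lmul_matrix[symmetric] transpose_matrix_vector)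
  then have "(pF \<epsilon> b n + \<epsilon> *\<^sub>R (transpose L *v pN \<epsilon> b n)) \<bullet> u = 0" for u by (simp add: inner_add_left)
  then show ?thesis by (metis inner_eq_zero_iff add_eq_0_iff2 scaleR_minus_left minus_unique add.commute)
qed

end

section \<open>The Grassmannian metric in graph coordinates\<close>

declare transpose_matrix_vector [simp del]

lemma matrix_minus_mult:
  fixes A :: "real^'n^'m" and B :: "real^'l^'n"
  shows "(- A) ** B = - (A ** B)" "A ** (- B) = - (A ** B)"
  by (simp_all add: bounded_bilinear.minus_left[OF bounded_bilinear_matrix_mult]
      bounded_bilinear.minus_right[OF bounded_bilinear_matrix_mult])

lemma matrix_diff_mult:
  fixes A :: "real^'n^'m" and B :: "real^'l^'n"
  shows "(A - A') ** B = A ** B - A' ** B" "A ** (B - B') = A ** B - A ** B'"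
  by (simp_all add: bounded_bilinear.diff_left[OF bounded_bilinear_matrix_mult]
      bounded_bilinear.diff_right[OF bounded_bilinear_matrix_mult])

lemma transpose_algebra:
  fixes A B :: "real^'n^'m"
  shows "transpose (A + B) = transpose A + transpose B" "transpose (- A) = - transpose A"
    "transpose (A - B) = transpose A - transpose B" "transpose (c *\<^sub>R A) = c *\<^sub>R transpose A"
  by (simp_all add: transpose_def vec_eq_iff)

lemma trace_algebra:
  fixes A B :: "real^'n^'n"
  shows "trace (- A) = - trace A" "trace (c *\<^sub>R A) = c * trace A" "trace (transpose A) = trace A"
  by (simp_all add: trace_def sum_negf sum_distrib_left transpose_def)

lemmas matrix_distribs = matrix_add_ldistrib matrix_add_rdistrib' scaleR_matrix_mult matrix_minus_mult
  matrix_diff_mult transpose_algebra trace_algebra trace_add trace_sub matrix_transpose_mul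

text \<open>Inverse Gram matrix of the graph basis of the plane with coordinate \<open>L\<close>.
  Its counterpart \<open>gramK\<close> recovers the \<open>pN\<close> component of a normal vector
  from its defect.\<close>

definition gramM :: "real \<Rightarrow> real^'n^'k \<Rightarrow> real^'n^'n" where
  "gramM \<epsilon> L = matrix_inv (mat 1 + \<epsilon> *\<^sub>R (transpose L ** L))"

definition gramK :: "real \<Rightarrow> real^'n^'k \<Rightarrow> real^'k^'k" where
  "gramK \<epsilon> L = matrix_inv (mat 1 + \<epsilon> *\<^sub>R (L ** transpose L))"

lemma matrix_vector_scaleR_distribs:
  fixes A :: "real^'n^'m"
  shows "(A + B) *v x = A *v x + B *v x" "(c *\<^sub>R A) *v x = c *\<^sub>R (A *v x)" "A *v (c *\<^sub>R x) = c *\<^sub>R (A *v x)"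
  by (simp_all add: matrix_vector_mult_add_rdistrib scaleR_matrix_vector_assoc matrix_vector_mult_scaleR)

lemma det_nz_iff_ker: "det (A :: real^'n^'n) \<noteq> 0 \<longleftrightarrow> (\<forall>x. A *v x = 0 \<longrightarrow> x = 0)"
  using matrix_left_invertible_ker[of A] invertible_left_inverse[of A] by (simp add: invertible_det_nz)

text \<open>If \<open>x\<close> is in the kernel of the second matrix, then
  \<open>transpose L *v x\<close> is in the kernel of the first, hence zero; then \<open>x\<close>
  is zero too.\<close>

lemma gram_det_swap:
  fixes L :: "real^'n^'k"
  assumes "det (mat 1 + \<epsilon> *\<^sub>R (transpose L ** L)) \<noteq> 0"
  shows "det (mat 1 + \<epsilon> *\<^sub>R (L ** transpose L)) \<noteq> 0"
  unfolding det_nz_iff_ker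
proof (intro allI impI)
  fix x assume x: "(mat 1 + \<epsilon> *\<^sub>R (L ** transpose L)) *v x = 0"
  then have x': "x + \<epsilon> *\<^sub>R (L *v (transpose L *v x)) = 0"
    by (simp add: matrix_vector_scaleR_distribs matrix_vector_mul_assoc)
  have "(mat 1 + \<epsilon> *\<^sub>R (transpose L ** L)) *v (transpose L *v x) = transpose L *v (x + \<epsilon> *\<^sub>R (L *v (transpose L *v x)))"
    by (simp add: matrix_vector_scaleR_distribs matrix_vector_mul_assoc matrix_mul_assoc matrix_vector_right_distrib matrix_distribs)
  then have "transpose L *v x = 0" using assms[unfolded det_nz_iff_ker] x' by simp
  then show "x = 0" using x' by simp
qed

lemma gram_sym:
  fixes L :: "real^'n^'k"
  assumes "det (mat 1 + \<epsilon> *\<^sub>R (transpose L ** L)) \<noteq> 0"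
  shows "transpose (gramM \<epsilon> L) = gramM \<epsilon> L" "transpose (gramK \<epsilon> L) = gramK \<epsilon> L"
proof -
  have *: "transpose (matrix_inv A) = matrix_inv A" if "det A \<noteq> 0" "transpose A = A" for A :: "real^'m^'m"
  proof -
    have "transpose (matrix_inv A ** A) = mat 1" using that by (simp add: matrix_inv_mult_left)
    then have "A ** transpose (matrix_inv A) = mat 1" using that by (simp add: matrix_transpose_mul)
    then show ?thesis using matrix_inv_unique by metis
  qed
  show "transpose (gramM \<epsilon> L) = gramM \<epsilon> L"
    unfolding gramM_def using assms by (intro *) (simp_all add: matrix_distribs)
  show "transpose (gramK \<epsilon> L) = gramK \<epsilon> L"
    unfolding gramK_def using gram_det_swap[OF assms] by (intro *) (simp_all add: matrix_distribs)
qed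

text \<open>The push-through identity: \<open>transpose L\<close> intertwines the two Gram matrices,
  and therefore their inverses.\<close>

lemma gram_commute:
  fixes L :: "real^'n^'k"
  assumes "det (mat 1 + \<epsilon> *\<^sub>R (transpose L ** L)) \<noteq> 0"
  shows "gramM \<epsilon> L ** transpose L = transpose L ** gramK \<epsilon> L" "L ** gramM \<epsilon> L = gramK \<epsilon> L ** L"
proof -
  let ?A = "mat 1 + \<epsilon> *\<^sub>R (transpose L ** L)" and ?B = "mat 1 + \<epsilon> *\<^sub>R (L ** transpose L)"
  have "?A ** transpose L = transpose L ** ?B" by (simp add: matrix_distribs matrix_mul_assoc)
  then have "gramM \<epsilon> L ** (?A ** transpose L) ** gramK \<epsilon> L = gramM \<epsilon> L ** (transpose L ** ?B) ** gramK \<epsilon> L" by simp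
  then have "(gramM \<epsilon> L ** ?A) ** transpose L ** gramK \<epsilon> L = gramM \<epsilon> L ** transpose L ** (?B ** gramK \<epsilon> L)"
    by (simp only: matrix_mul_assoc)
  then show 1: "gramM \<epsilon> L ** transpose L = transpose L ** gramK \<epsilon> L"
    by (simp add: gramM_def gramK_def matrix_inv_mult_left[OF assms] matrix_inv_mult_right[OF gram_det_swap[OF assms]])
  have "transpose (gramM \<epsilon> L ** transpose L) = transpose (transpose L ** gramK \<epsilon> L)" using 1 by simp
  then show "L ** gramM \<epsilon> L = gramK \<epsilon> L ** L" by (simp add: matrix_transpose_mul gram_sym[OF assms])
qed

lemma inv_metric_gframe:
  assumes e: "\<epsilon> = 1 \<or> \<epsilon> = -1" and b: "b \<in> gcharts \<epsilon>" and fr: "frame \<epsilon> (gframe b L)"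
  shows "inv_metric (pull_form \<epsilon> (gframe b L)) = gramM \<epsilon> L" "det (mat 1 + \<epsilon> *\<^sub>R (transpose L ** L)) \<noteq> 0"
proof -
  have "pull_form \<epsilon> (gframe b L) u v = u \<bullet> ((mat 1 + \<epsilon> *\<^sub>R (transpose L ** L)) *v v)" for u v
    by (simp add: pull_form_def gframe_def flat_form_simps gchartsD[OF b] matrix_vector_scaleR_distribs inner_add_right
        flip: matrix_vector_mul_assoc)
      (metis dot_lmul_matrix inner_commute transpose_matrix_vector)
  moreover have "axis i 1 \<bullet> (A *v axis j 1) = A $ i $ j" for A :: "real^'a^'a" and i j
    by (simp add: inner_axis' matrix_vector_mult_basis column_def)
  ultimately have *: "(\<chi> i j. pull_form \<epsilon> (gframe b L) (axis i 1) (axis j 1)) = mat 1 + \<epsilon> *\<^sub>R (transpose L ** L)"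
    by (simp add: vec_eq_iff)
  then show "inv_metric (pull_form \<epsilon> (gframe b L)) = gramM \<epsilon> L" by (simp add: inv_metric_def gramM_def)
  show "det (mat 1 + \<epsilon> *\<^sub>R (transpose L ** L)) \<noteq> 0" using pos_form_det[OF pos_form_frame[OF e fr]] * by simp
qed

text \<open>Inserting \<open>pF_normal\<close> into the defect yields
  \<open>mat 1 + \<epsilon> *\<^sub>R (L ** transpose L)\<close> applied to
  \<open>pN \<epsilon> b n\<close>, and this matrix is inverted.\<close>

lemma pN_normal:
  assumes e: "\<epsilon> = 1 \<or> \<epsilon> = -1" and b: "b \<in> gcharts \<epsilon>" and fr: "frame \<epsilon> (gframe b L)"
    and n: "\<And>u. flat_form \<epsilon> n (gframe b L u) = 0"
  shows "pN \<epsilon> b n = gramK \<epsilon> L *v graph_defect \<epsilon> b L n"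
    "pF \<epsilon> b n = - \<epsilon> *\<^sub>R (gramM \<epsilon> L *v (transpose L *v graph_defect \<epsilon> b L n))"
proof -
  note d = inv_metric_gframe(2)[OF e b fr]
  note pFn = pF_normal[OF e b fr n]
  have "graph_defect \<epsilon> b L n = (mat 1 + \<epsilon> *\<^sub>R (L ** transpose L)) *v pN \<epsilon> b n"
    by (simp add: graph_defect_def pFn matrix_vector_scaleR_distribs flip: matrix_vector_mul_assoc)
       (simp add: matrix_vector_scaleR_distribs flip: scaleR_minus_left)
  then show 1: "pN \<epsilon> b n = gramK \<epsilon> L *v graph_defect \<epsilon> b L n"
    by (simp add: matrix_vector_mul_assoc gramK_def matrix_inv_mult_left[OF gram_det_swap[OF d]])
  show "pF \<epsilon> b n = - \<epsilon> *\<^sub>R (gramM \<epsilon> L *v (transpose L *v graph_defect \<epsilon> b L n))"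
    by (simp add: pFn 1 matrix_vector_mul_assoc gram_commute(1)[OF d])
qed

text \<open>The weight \<open>gramM\<close> comes from tracing over the graph basis,
  \<open>gramK\<close> from projecting \<open>snd b z\<close> to the normal space. The sign in the
  metric cancels the sign of the form on the normal directions.\<close>

lemma gmetric_trace:
  assumes e: "\<epsilon> = 1 \<or> \<epsilon> = -1" and b: "b \<in> gcharts \<epsilon>" and fr: "frame \<epsilon> (gframe b L)"
  shows "gmetric \<epsilon> b L A B = trace (gramM \<epsilon> L ** transpose A ** gramK \<epsilon> L ** B)"
proof -
  note d = inv_metric_gframe(2)[OF e b fr]
  note lin = linear_nor_proj[OF e fr]
  let ?nor = "nor_proj \<epsilon> (range (gframe b L))"
  have nor: "\<epsilon> * flat_form \<epsilon> (?nor (snd b y)) (?nor (snd b z)) = (gramK \<epsilon> L *v y) \<bullet> z" for y z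
  proof -
    have "graph_defect \<epsilon> b L (?nor (snd b y)) = y"
      unfolding graph_defect_nor_proj[OF e b fr] by (simp add: graph_defect_def chart_projections[OF e b])
    then have "pN \<epsilon> b (?nor (snd b y)) = gramK \<epsilon> L *v y"
      using pN_normal(1)[OF e b fr nor_proj_orth[OF e fr]] by simp
    then show ?thesis
      using e by (auto simp: flat_form_nor_proj[OF e fr] flat_form_chart[OF e b fr])
  qed
  have ghom_lin: "linear (\<lambda>u. ghom \<epsilon> b L A (gframe b L u))" for A
    unfolding ghom_gframe[OF e b fr]
    using linear_compose[OF matrix_vector_mul_linear linear_compose[OF gchartsD(2)[OF b] lin]] by (simp add: o_def)
  have "gmetric \<epsilon> b L A B = tr_metric (pull_form \<epsilon> (gframe b L)) (\<lambda>u v. (gramK \<epsilon> L *v (A *v u)) \<bullet> (B *v v))"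
    unfolding gmetric_def grass_metric_frame[OF e fr ghom_lin ghom_lin] ghom_gframe[OF e b fr]
    by (simp add: tr_metric_def sum_distrib_left nor[symmetric] mult_ac)
  also have "\<dots> = (\<Sum>i\<in>UNIV. \<Sum>j\<in>UNIV. gramM \<epsilon> L $ i $ j * (transpose A ** gramK \<epsilon> L ** B) $ i $ j)"
  proof -
    have "(gramK \<epsilon> L *v (A *v axis i 1)) \<bullet> (B *v axis j 1) = (transpose A ** gramK \<epsilon> L ** B) $ i $ j" for i j
    proof -
      have "(transpose A ** gramK \<epsilon> L ** B) $ i $ j = axis i 1 \<bullet> ((transpose A ** gramK \<epsilon> L ** B) *v axis j 1)"
        by (simp add: inner_axis' matrix_vector_mult_basis column_def)
      also have "\<dots> = (A *v axis i 1) \<bullet> (gramK \<epsilon> L *v (B *v axis j 1))"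
        by (simp flip: matrix_vector_mul_assoc) (metis dot_lmul_matrix inner_commute transpose_matrix_vector)
      also have "\<dots> = (gramK \<epsilon> L *v (A *v axis i 1)) \<bullet> (B *v axis j 1)"
        by (metis dot_lmul_matrix gram_sym(2)[OF d] transpose_matrix_vector)
      finally show ?thesis by simp
    qed
    then show ?thesis by (simp add: tr_metric_def inv_metric_gframe(1)[OF e b fr])
  qed
  also have "\<dots> = trace (transpose (gramM \<epsilon> L) ** (transpose A ** gramK \<epsilon> L ** B))"
    unfolding trace_def matrix_matrix_mult_def[of "transpose (gramM \<epsilon> L)"]
    by (simp add: transpose_def[of "gramM \<epsilon> L"]) (rule sum.swap)
  finally show ?thesis by (simp add: gram_sym[OF d] matrix_mul_assoc)
qed

text \<open>For \<open>\<epsilon> = 1\<close> every graph is admissible. For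
  \<open>\<epsilon> = -1\<close> a graph is spacelike iff \<open>L\<close> shortens every nonzero
  vector; by compactness of the sphere this means operator norm below 1, and the operator norm is
  Lipschitz. Openness allows differentiating the metric in graph coordinates.\<close>

lemma frame_gframe_open:
  fixes b :: "('n::finite, 'k::finite) gchart"
  assumes e: "\<epsilon> = 1 \<or> \<epsilon> = -1" and b: "b \<in> gcharts \<epsilon>"
  shows "open {L. frame \<epsilon> (gframe b L)}"
proof -
  have fr: "frame \<epsilon> (gframe b L) \<longleftrightarrow> (\<epsilon> = -1 \<longrightarrow> (\<forall>u. u \<noteq> 0 \<longrightarrow> norm (L *v u) < norm u))" for L
  proof -
    have "inj (gframe b L)" using gframe_proj(1)[OF e b] by (metis injI)
    moreover have "flat_form \<epsilon> (gframe b L u) (gframe b L u) = u \<bullet> u + \<epsilon> * ((L *v u) \<bullet> (L *v u))" for u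
      by (simp add: gframe_def flat_form_simps gchartsD[OF b])
    then have "flat_form \<epsilon> (gframe b L u) (gframe b L u) > 0 \<longleftrightarrow> norm (L *v u) < norm u" if "\<epsilon> = -1" for u
      using that by (simp add: norm_lt)
    ultimately show ?thesis using linear_gframe[OF b] by (auto simp: frame_def)
  qed
  show ?thesis
  proof (cases "\<epsilon> = -1")
    case False then show ?thesis by (simp add: fr)
  next
    case True
    have "{L. frame \<epsilon> (gframe b L)} = {L. onorm ((*v) L) < 1}"
    proof (intro set_eqI iffI CollectI; drule CollectD)
      fix L :: "real^'n^'k" assume "frame \<epsilon> (gframe b L)"
      then have L: "\<And>u. u \<noteq> 0 \<Longrightarrow> norm (L *v u) < norm u" using fr True by simp
      have "continuous_on (sphere 0 1) (\<lambda>u. norm (L *v u))"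
        by (intro continuous_on_norm linear_continuous_on matrix_vector_mul_bounded_linear)
      moreover have "sphere (0::real^'n) 1 \<noteq> {}" by simp
      ultimately obtain x where x: "norm x = 1" "\<And>y. norm y = 1 \<Longrightarrow> norm (L *v y) \<le> norm (L *v x)"
        using continuous_attains_sup[OF compact_sphere, of 0 1 "\<lambda>u. norm (L *v u)"] by auto
      have "onorm ((*v) L) \<le> norm (L *v x)"
      proof (rule onorm_le)
        fix u show "norm (L *v u) \<le> norm (L *v x) * norm u"
        proof (cases "u = 0")
          case False
          then have "norm (L *v ((1 / norm u) *\<^sub>R u)) \<le> norm (L *v x)" by (intro x) simp
          then show ?thesis using False by (simp add: matrix_vector_mult_scaleR field_simps)
        qed simp
      qed
      also have "\<dots> < 1" using L[of x] x(1) by force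
      finally show "onorm ((*v) L) < 1" .
    next
      fix L :: "real^'n^'k" assume L: "onorm ((*v) L) < 1"
      have "norm (L *v u) < norm u" if "u \<noteq> 0" for u
        using order_le_less_trans[OF onorm[OF matrix_vector_mul_bounded_linear, of L u]
            mult_strict_right_mono[OF L, of "norm u"]] that by simp
      then show "frame \<epsilon> (gframe b L)" using fr by blast
    qed
    moreover have "continuous_on UNIV (\<lambda>L :: real^'n^'k. onorm ((*v) L))"
    proof -
      obtain K where K: "\<And>(A::real^'n^'k) x. norm (A *v x) \<le> norm A * norm x * K" "K > 0"
        using bounded_bilinear.pos_bounded[OF bounded_bilinear_matrix_vector[where 'n='n and 'm='k]] by auto
      have o: "onorm ((*v) A) \<le> K * norm A" for A :: "real^'n^'k"
        using K by (intro onorm_le) (simp add: mult_ac)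
      have t: "onorm ((*v) A) \<le> onorm ((*v) B) + onorm ((*v) (A - B))" for A B :: "real^'n^'k"
        using onorm_triangle[OF matrix_vector_mul_bounded_linear matrix_vector_mul_bounded_linear, of B "A - B"]
        by (simp add: matrix_vector_mult_diff_rdistrib)
      have "dist (onorm ((*v) A)) (onorm ((*v) B)) \<le> K * dist A B" for A B :: "real^'n^'k"
        using t[of A B] t[of B A] o[of "A - B"] o[of "B - A"]
        by (auto simp: dist_real_def dist_norm norm_minus_commute abs_le_iff)
      then have "K-lipschitz_on UNIV (\<lambda>L :: real^'n^'k. onorm ((*v) L))"
        using K(2) by (intro lipschitz_onI) auto
      then show ?thesis by (rule lipschitz_on_continuous_on)
    qed
    ultimately show ?thesis using open_Collect_less[of "\<lambda>L. onorm ((*v) L)" "\<lambda>L. 1"] by simp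
  qed
qed


lemma smooth_on_gram:
  fixes W :: "(real^'n^'k) set"
  assumes "open W"
  shows "smooth_on W (\<lambda>L. mat 1 + \<epsilon> *\<^sub>R (transpose L ** L))" "smooth_on W (\<lambda>L. mat 1 + \<epsilon> *\<^sub>R (L ** transpose L))"
proof -
  note W = thick_open[OF assms]
  have id: "smooth_on W (\<lambda>L. L)" by (rule smooth_on_linear[OF W bounded_linear_ident])
  have t: "smooth_on W (\<lambda>L. transpose L)" by (rule smooth_on_linear[OF W bounded_linear_transpose])
  note * = smooth_on_add[OF W smooth_on_const[OF W]] smooth_on_compose_linear[OF W bounded_linear_scaleR_right]
    smooth_on_bilinear[OF W bounded_bilinear_matrix_mult]
  show "smooth_on W (\<lambda>L. mat 1 + \<epsilon> *\<^sub>R (transpose L ** L))" "smooth_on W (\<lambda>L. mat 1 + \<epsilon> *\<^sub>R (L ** transpose L))"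
    by (rule * id t)+
qed

lemma Dd_gram:
  fixes L C :: "real^'n^'k"
  shows "Dd (\<lambda>L. mat 1 + \<epsilon> *\<^sub>R (transpose L ** L)) L C = \<epsilon> *\<^sub>R (transpose C ** L + transpose L ** C)"
    "Dd (\<lambda>L. mat 1 + \<epsilon> *\<^sub>R (L ** transpose L)) L C = \<epsilon> *\<^sub>R (C ** transpose L + L ** transpose C)"
proof -
  have t: "(transpose has_derivative transpose) (at L)"
    by (rule bounded_linear_imp_has_derivative[OF bounded_linear_transpose])
  have "((\<lambda>L. mat 1 + \<epsilon> *\<^sub>R (transpose L ** L)) has_derivative
      (\<lambda>C. 0 + \<epsilon> *\<^sub>R (transpose L ** C + transpose C ** L))) (at L)"
    by (intro has_derivative_add has_derivative_const has_derivative_scaleR_right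
        bounded_bilinear.FDERIV[OF bounded_bilinear_matrix_mult] t has_derivative_ident)
  from Dd_eqI[OF this] show "Dd (\<lambda>L. mat 1 + \<epsilon> *\<^sub>R (transpose L ** L)) L C = \<epsilon> *\<^sub>R (transpose C ** L + transpose L ** C)"
    by simp
  have "((\<lambda>L. mat 1 + \<epsilon> *\<^sub>R (L ** transpose L)) has_derivative
      (\<lambda>C. 0 + \<epsilon> *\<^sub>R (L ** transpose C + C ** transpose L))) (at L)"
    by (intro has_derivative_add has_derivative_const has_derivative_scaleR_right
        bounded_bilinear.FDERIV[OF bounded_bilinear_matrix_mult] t has_derivative_ident)
  from Dd_eqI[OF this] show "Dd (\<lambda>L. mat 1 + \<epsilon> *\<^sub>R (L ** transpose L)) L C = \<epsilon> *\<^sub>R (C ** transpose L + L ** transpose C)"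
    by simp
qed

context
  fixes \<epsilon> :: real and b :: "('n::finite, 'k::finite) gchart" and L :: "real^'n^'k"
  assumes e: "\<epsilon> = 1 \<or> \<epsilon> = -1" and b: "b \<in> gcharts \<epsilon>" and fr: "frame \<epsilon> (gframe b L)"
begin

lemma Dd_gmetric:
  "Dd (\<lambda>L. gmetric \<epsilon> b L A B) L C =
    - \<epsilon> * (trace (gramM \<epsilon> L ** (transpose C ** L + transpose L ** C) ** gramM \<epsilon> L ** transpose A ** gramK \<epsilon> L ** B)
        + trace (gramM \<epsilon> L ** transpose A ** gramK \<epsilon> L ** (C ** transpose L + L ** transpose C) ** gramK \<epsilon> L ** B))"
proof -
  let ?W = "{L. frame \<epsilon> (gframe b L)}"
  have W: "open ?W" by (rule frame_gframe_open[OF e b])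
  have L: "L \<in> ?W" using fr by simp
  have d: "det (mat 1 + \<epsilon> *\<^sub>R (transpose L ** L)) \<noteq> 0" if "L \<in> ?W" for L
    using inv_metric_gframe(2)[OF e b] that by blast
  note d' = gram_det_swap[OF d]
  have gM: "gramM \<epsilon> = (\<lambda>L :: real^'n^'k. matrix_inv (mat 1 + \<epsilon> *\<^sub>R (transpose L ** L)))"
    and gK: "gramK \<epsilon> = (\<lambda>L :: real^'n^'k. matrix_inv (mat 1 + \<epsilon> *\<^sub>R (L ** transpose L)))"
    by (auto simp: gramM_def gramK_def)
  have diffM: "gramM \<epsilon> differentiable (at L)" and diffK: "gramK \<epsilon> differentiable (at L)"
    unfolding gM gK
    using smooth_on_differentiable[OF W smooth_on_matrix_inv[OF thick_open[OF W] smooth_on_gram(1)[OF W] d] L]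
      smooth_on_differentiable[OF W smooth_on_matrix_inv[OF thick_open[OF W] smooth_on_gram(2)[OF W] d'] L] by auto
  have DM: "Dd (gramM \<epsilon>) L C = - \<epsilon> *\<^sub>R (gramM \<epsilon> L ** (transpose C ** L + transpose L ** C) ** gramM \<epsilon> L)"
    using Dd_matrix_inv[OF W smooth_on_gram(1)[OF W] d L, of C]
    by (simp add: Dd_gram gM matrix_distribs)
  have DK: "Dd (gramK \<epsilon>) L C = - \<epsilon> *\<^sub>R (gramK \<epsilon> L ** (C ** transpose L + L ** transpose C) ** gramK \<epsilon> L)"
    using Dd_matrix_inv[OF W smooth_on_gram(2)[OF W] d' L, of C]
    by (simp add: Dd_gram gK matrix_distribs)
  let ?T = "\<lambda>(X :: real^'n^'n) (Y :: real^'k^'k). trace (X ** (transpose A ** (Y ** B)))"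
  have "bilinear ?T"
    unfolding bilinear_def by (auto intro!: linearI simp: matrix_distribs)
  then have T: "bounded_bilinear ?T" by (simp add: bilinear_conv_bounded_bilinear)
  have "Dd (\<lambda>L. gmetric \<epsilon> b L A B) L = Dd (\<lambda>L. ?T (gramM \<epsilon> L) (gramK \<epsilon> L)) L"
    by (rule Dd_cong[OF W L]) (simp add: gmetric_trace[OF e b] matrix_mul_assoc)
  then have "Dd (\<lambda>L. gmetric \<epsilon> b L A B) L C = ?T (gramM \<epsilon> L) (Dd (gramK \<epsilon>) L C) + ?T (Dd (gramM \<epsilon>) L C) (gramK \<epsilon> L)"
    by (simp only: Dd_bilinear[OF T diffM diffK])
  then show ?thesis
    by (simp only: DM DK) (simp add: matrix_distribs matrix_mul_assoc algebra_simps)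
qed

text \<open>With \<open>X\<close> the weighted transpose of \<open>z - z'\<close>, the trace of
  \<open>X ** w\<close> vanishes for all \<open>w\<close>. Taking \<open>w = transpose X\<close>
  gives a vanishing sum of squares, and the weights are invertible.\<close>

lemma gmetric_nondegenerate:
  assumes "\<And>w. gmetric \<epsilon> b L z w = gmetric \<epsilon> b L z' w" shows "z = z'"
proof -
  note d = inv_metric_gframe(2)[OF e b fr]
  define X where "X = gramM \<epsilon> L ** transpose (z - z') ** gramK \<epsilon> L"
  have tr: "trace (X ** w) = 0" for w
  proof -
    have "gmetric \<epsilon> b L (z - z') w = gmetric \<epsilon> b L z w - gmetric \<epsilon> b L z' w"
      unfolding gmetric_trace[OF e b fr] diff_conv_add_uminus
      by (simp only: matrix_distribs)
    then show ?thesis using assms[of w] by (simp add: gmetric_trace[OF e b fr] X_def)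
  qed
  have "trace (X ** transpose X) = (\<Sum>i\<in>UNIV. \<Sum>j\<in>UNIV. (X $ i $ j)\<^sup>2)"
    by (simp add: trace_def matrix_matrix_mult_def transpose_def power2_eq_square)
  then have "(\<Sum>i\<in>UNIV. \<Sum>j\<in>UNIV. (X $ i $ j)\<^sup>2) = 0" using tr by simp
  then have "X = 0" by (simp add: sum_nonneg_eq_0_iff sum_nonneg vec_eq_iff)
  then have "(mat 1 + \<epsilon> *\<^sub>R (transpose L ** L)) ** X ** (mat 1 + \<epsilon> *\<^sub>R (L ** transpose L)) = 0"
    using bounded_bilinear.zero_left[OF bounded_bilinear_matrix_mult] bounded_bilinear.zero_right[OF bounded_bilinear_matrix_mult]
    by metis
  moreover have "(mat 1 + \<epsilon> *\<^sub>R (transpose L ** L)) ** X ** (mat 1 + \<epsilon> *\<^sub>R (L ** transpose L)) =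
      ((mat 1 + \<epsilon> *\<^sub>R (transpose L ** L)) ** gramM \<epsilon> L) ** transpose (z - z') **
      (gramK \<epsilon> L ** (mat 1 + \<epsilon> *\<^sub>R (L ** transpose L)))" by (simp only: X_def matrix_mul_assoc)
  moreover have "\<dots> = transpose (z - z')"
    by (simp add: gramM_def gramK_def matrix_inv_mult_right[OF d] matrix_inv_mult_left[OF gram_det_swap[OF d]])
  ultimately have "transpose (z - z') = 0" by simp
  then show ?thesis by (simp add: transpose_def vec_eq_iff)
qed

text \<open>The Koszul expression consists of six kinds of traces. Those named \<open>t2\<close>,
  \<open>t3\<close>, \<open>t5\<close>, \<open>t6\<close> cancel, while \<open>t1\<close> and
  \<open>t4\<close> occur twice and form the metric product with the claimed vector.\<close>

lemma christoffel_gmetric: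
  "christoffel (gmetric \<epsilon> b) L A B = - \<epsilon> *\<^sub>R (A ** gramM \<epsilon> L ** transpose L ** B + B ** gramM \<epsilon> L ** transpose L ** A)"
  (is "_ = ?Z")
proof -
  note d = inv_metric_gframe(2)[OF e b fr]
  note sym = gram_sym[OF d] and com = gram_commute[OF d]
  note g = gmetric_trace[OF e b fr]
  let ?M = "gramM \<epsilon> L" and ?K = "gramK \<epsilon> L"
  define t1 t2 t3 t4 t5 t6 where
    "t1 C = trace (?M ** transpose A ** L ** ?M ** transpose B ** ?K ** C)" and
    "t2 C = trace (?M ** transpose L ** A ** ?M ** transpose B ** ?K ** C)" and
    "t3 C = trace (?M ** transpose B ** ?K ** A ** transpose L ** ?K ** C)" and
    "t4 C = trace (?M ** transpose B ** L ** ?M ** transpose A ** ?K ** C)" and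
    "t5 C = trace (?M ** transpose L ** B ** ?M ** transpose A ** ?K ** C)" and
    "t6 C = trace (?M ** transpose A ** ?K ** B ** transpose L ** ?K ** C)" for C
  have com': "X ** ?M ** transpose L = X ** transpose L ** ?K" "Y ** ?K ** L = Y ** L ** ?M"
    for X :: "real^'n^'a" and Y :: "real^'k^'b"
    using com by (simp_all flip: matrix_mul_assoc)
  have cyc: "trace (X ** Y) = trace (Y ** X)" for X :: "real^'c^'d" and Y :: "real^'d^'c" by (rule trace_mul_sym)
  have koszul: "gmetric \<epsilon> b L ?Z C = (Dd (\<lambda>q. gmetric \<epsilon> b q B C) L A + Dd (\<lambda>q. gmetric \<epsilon> b q A C) L B
      - Dd (\<lambda>q. gmetric \<epsilon> b q A B) L C) / 2" for C
  proof -
    have z: "gmetric \<epsilon> b L ?Z C = - \<epsilon> * (t1 C + t4 C)"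
      by (simp add: g matrix_distribs matrix_mul_assoc sym t1_def t4_def algebra_simps)
    have a: "Dd (\<lambda>q. gmetric \<epsilon> b q B C) L A = - \<epsilon> * (t1 C + t2 C + (t3 C + t4 C))"
      by (simp add: Dd_gmetric matrix_distribs matrix_mul_assoc t1_def t2_def t3_def t4_def com')
    have bb: "Dd (\<lambda>q. gmetric \<epsilon> b q A C) L B = - \<epsilon> * (t4 C + t5 C + (t6 C + t1 C))"
      by (simp add: Dd_gmetric matrix_distribs matrix_mul_assoc t1_def t4_def t5_def t6_def com')
    \<comment> \<open>In the third derivative of the Koszul formula \<open>C\<close> is the
      direction and sits inside the trace. Transposition and cyclic permutation move it to the end,
      where the traces can be matched with \<open>t3\<close>, \<open>t6\<close>, \<open>t5\<close>,
      \<open>t2\<close>.\<close>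
    have 5: "trace (?M ** transpose C ** L ** ?M ** transpose A ** ?K ** B) = t3 C"
    proof -
      have "trace (?M ** transpose C ** L ** ?M ** transpose A ** ?K ** B) =
          trace (transpose B ** ?K ** A ** ?M ** transpose L ** C ** ?M)"
        by (subst trace_algebra(3)[symmetric]) (simp only: matrix_transpose_mul transpose_transpose sym matrix_mul_assoc)
      also have "\<dots> = trace (?M ** (transpose B ** ?K ** A ** ?M ** transpose L ** C))" by (rule cyc)
      finally show ?thesis by (simp only: t3_def matrix_mul_assoc com')
    qed
    have 6: "trace (?M ** transpose L ** C ** ?M ** transpose A ** ?K ** B) = t6 C"
    proof -
      have "trace (?M ** transpose L ** C ** ?M ** transpose A ** ?K ** B) =
         trace ((?M ** transpose L ** C) ** (?M ** transpose A ** ?K ** B))" by (simp only: matrix_mul_assoc)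
      also have "\<dots> = trace ((?M ** transpose A ** ?K ** B) ** (?M ** transpose L ** C))" by (rule cyc)
      finally show ?thesis by (simp only: t6_def matrix_mul_assoc com')
    qed
    have 7: "trace (?M ** transpose A ** ?K ** C ** transpose L ** ?K ** B) = t5 C"
    proof -
      have "trace (?M ** transpose A ** ?K ** C ** transpose L ** ?K ** B) =
         trace ((?M ** transpose A ** ?K ** C) ** (transpose L ** ?K ** B))" by (simp only: matrix_mul_assoc)
      also have "\<dots> = trace ((transpose L ** ?K ** B) ** (?M ** transpose A ** ?K ** C))" by (rule cyc)
      finally show ?thesis by (simp only: t5_def matrix_mul_assoc com(1)[symmetric])
    qed
    have 8: "trace (?M ** transpose A ** ?K ** L ** transpose C ** ?K ** B) = t2 C"
    proof -
      have "trace (?M ** transpose A ** ?K ** L ** transpose C ** ?K ** B) =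
          trace ((transpose B ** ?K ** C) ** (transpose L ** ?K ** A ** ?M))"
        by (subst trace_algebra(3)[symmetric]) (simp only: matrix_transpose_mul transpose_transpose sym matrix_mul_assoc)
      also have "\<dots> = trace ((transpose L ** ?K ** A ** ?M) ** (transpose B ** ?K ** C))" by (rule cyc)
      finally show ?thesis by (simp only: t2_def matrix_mul_assoc com(1)[symmetric])
    qed
    have c: "Dd (\<lambda>q. gmetric \<epsilon> b q A B) L C = - \<epsilon> * (t3 C + t6 C + (t5 C + t2 C))"
      unfolding Dd_gmetric by (simp only: 5 6 7 8 trace_add matrix_add_ldistrib matrix_add_rdistrib' matrix_mul_assoc)
    show ?thesis unfolding z a bb c by (simp add: algebra_simps)
  qed
  show ?thesis
    unfolding christoffel_def
  proof (rule the_equality)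
    fix z assume "\<forall>w. gmetric \<epsilon> b L z w = (Dd (\<lambda>q. gmetric \<epsilon> b q B w) L A + Dd (\<lambda>q. gmetric \<epsilon> b q A w) L B
      - Dd (\<lambda>q. gmetric \<epsilon> b q A B) L w) / 2"
    then show "z = ?Z" using koszul gmetric_nondegenerate[of z ?Z] by metis
  qed (use koszul in blast)
qed

end

section \<open>Local geometry of immersions\<close>

lemma tr_metric_linear: "linear T \<Longrightarrow> T (tr_metric G B) = tr_metric G (\<lambda>u v. T (B u v))"
  by (simp add: tr_metric_def linear_sum linear_scale)

lemma tr_metric_diff: "tr_metric G B - tr_metric G B' = tr_metric G (\<lambda>u v. B u v - B' u v)"
  by (simp add: tr_metric_def scaleR_diff_right sum_subtractf)

lemma tr_metric_add: "tr_metric G B + tr_metric G B' = tr_metric G (\<lambda>u v. B u v + B' u v)"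
  by (simp add: tr_metric_def scaleR_add_right sum.distrib)

lemma matrix_nth: "matrix f $ i $ j = f (axis j 1) $ i"
  by (simp add: matrix_def)

lemma smooth_on_frame_coord:
  fixes f :: "'v::euclidean_space \<Rightarrow> real^'n \<Rightarrow> real^('n::finite + 'k::finite)"
  assumes S: "thick S" and f: "\<And>u. smooth_on S (\<lambda>q. f q u)"
  shows "smooth_on S (\<lambda>q. frame_det \<epsilon> b (f q))"
    and "(\<And>q. q \<in> S \<Longrightarrow> frame_det \<epsilon> b (f q) \<noteq> 0) \<Longrightarrow> smooth_on S (\<lambda>q. frame_coord \<epsilon> b (f q))"
proof -
  have 1: "smooth_on S (\<lambda>q. matrix (\<lambda>u. pF \<epsilon> b (f q u)))"
    unfolding matrix_def
    by (intro smooth_on_vec_lambda[OF S] smooth_on_vec_nth[OF S] smooth_on_compose_linear[OF S _ f]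
        linear_conv_bounded_linear[THEN iffD1] linear_pF)
  have 2: "smooth_on S (\<lambda>q. matrix (\<lambda>u. pN \<epsilon> b (f q u)))"
    unfolding matrix_def
    by (intro smooth_on_vec_lambda[OF S] smooth_on_vec_nth[OF S] smooth_on_compose_linear[OF S _ f]
        linear_conv_bounded_linear[THEN iffD1] linear_pN)
  show "smooth_on S (\<lambda>q. frame_det \<epsilon> b (f q))"
    unfolding frame_det_def by (intro smooth_on_det[OF S] smooth_on_vec_nth[OF S] 1)
  show "smooth_on S (\<lambda>q. frame_coord \<epsilon> b (f q))" if "\<And>q. q \<in> S \<Longrightarrow> frame_det \<epsilon> b (f q) \<noteq> 0"
    unfolding frame_coord_def using that[unfolded frame_det_def]
    by (intro smooth_on_bilinear[OF S bounded_bilinear_matrix_mult] 2 smooth_on_matrix_inv[OF S 1])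
qed

text \<open>If \<open>A\<close> is the matrix of \<open>C\<close> and \<open>g\<close> the Gram
  matrix, then \<open>D = transpose A ** g + g ** A\<close>, and multiplying by the inverse on both
  sides leaves one factor on each side. Used with \<open>C\<close> a Christoffel map, for the
  derivative of the inverse metric.\<close>

lemma inv_metric_derivative:
  fixes G :: "real^'n \<Rightarrow> real^'n \<Rightarrow> real" and B :: "real^'n \<Rightarrow> real^'n \<Rightarrow> 'w::real_vector"
  assumes G: "pos_form G" and C: "linear C" and B: "bilinear B"
    and D: "\<And>l m. D $ l $ m = G (C (axis l 1)) (axis m 1) + G (axis l 1) (C (axis m 1))"
  shows "(\<Sum>i\<in>UNIV. \<Sum>j\<in>UNIV. (inv_metric G ** D ** inv_metric G) $ i $ j *\<^sub>R B (axis i 1) (axis j 1)) =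
    tr_metric G (\<lambda>u v. B (C u) v + B u (C v))"
proof -
  note lin = bilinear_linear[OF pos_formD(1)[OF G]]
  define g where "g = (\<chi> i j. G (axis i 1) (axis j 1))"
  define A where "A = matrix C"
  let ?I = "inv_metric G"
  have I: "?I = matrix_inv g" by (simp add: inv_metric_def g_def)
  have dg: "det g \<noteq> 0" using pos_form_det[OF G] by (simp add: g_def)
  have Ce: "C (axis l 1) = (\<Sum>i\<in>UNIV. A $ i $ l *\<^sub>R axis i 1)" for l
    by (subst vec_sum_axis[symmetric]) (simp add: A_def matrix_nth)
  have "D = transpose A ** g + g ** A"
    by (simp add: vec_eq_iff D Ce matrix_matrix_mult_def transpose_def g_def linear_sum[OF lin(1)] linear_sum[OF lin(2)]
        linear_scale[OF lin(1)] linear_scale[OF lin(2)] mult.commute)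
  then have "?I ** D ** ?I = ?I ** transpose A ** (g ** ?I) + (?I ** g) ** A ** ?I"
    by (simp only: matrix_add_ldistrib matrix_add_rdistrib' matrix_mul_assoc)
  then have ID: "?I ** D ** ?I = ?I ** transpose A + A ** ?I"
    by (simp add: I matrix_inv_mult_right[OF dg] matrix_inv_mult_left[OF dg])
  have 1: "(\<Sum>i\<in>UNIV. \<Sum>j\<in>UNIV. (A ** ?I) $ i $ j *\<^sub>R B (axis i 1) (axis j 1)) = tr_metric G (\<lambda>u v. B (C u) v)"
  proof -
    have "tr_metric G (\<lambda>u v. B (C u) v) =
      (\<Sum>l\<in>UNIV. \<Sum>j\<in>UNIV. \<Sum>i\<in>UNIV. (A $ i $ l * ?I $ l $ j) *\<^sub>R B (axis i 1) (axis j 1))"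
      by (simp add: tr_metric_def Ce linear_sum[OF bilinear_linear(1)[OF B]] linear_scale[OF bilinear_linear(1)[OF B]]
          scaleR_sum_right mult.commute)
    also have "\<dots> = (\<Sum>l\<in>UNIV. \<Sum>i\<in>UNIV. \<Sum>j\<in>UNIV. (A $ i $ l * ?I $ l $ j) *\<^sub>R B (axis i 1) (axis j 1))"
      by (intro sum.cong refl sum.swap)
    also have "\<dots> = (\<Sum>i\<in>UNIV. \<Sum>l\<in>UNIV. \<Sum>j\<in>UNIV. (A $ i $ l * ?I $ l $ j) *\<^sub>R B (axis i 1) (axis j 1))"
      by (rule sum.swap)
    also have "\<dots> = (\<Sum>i\<in>UNIV. \<Sum>j\<in>UNIV. \<Sum>l\<in>UNIV. (A $ i $ l * ?I $ l $ j) *\<^sub>R B (axis i 1) (axis j 1))"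
      by (intro sum.cong refl sum.swap)
    finally show ?thesis by (simp add: matrix_matrix_mult_def scaleR_sum_left)
  qed
  have 2: "(\<Sum>i\<in>UNIV. \<Sum>j\<in>UNIV. (?I ** transpose A) $ i $ j *\<^sub>R B (axis i 1) (axis j 1)) = tr_metric G (\<lambda>u v. B u (C v))"
  proof -
    have "tr_metric G (\<lambda>u v. B u (C v)) =
      (\<Sum>i\<in>UNIV. \<Sum>l\<in>UNIV. \<Sum>j\<in>UNIV. (?I $ i $ l * A $ j $ l) *\<^sub>R B (axis i 1) (axis j 1))"
      by (simp add: tr_metric_def Ce linear_sum[OF bilinear_linear(2)[OF B]] linear_scale[OF bilinear_linear(2)[OF B]]
          scaleR_sum_right)
    also have "\<dots> = (\<Sum>i\<in>UNIV. \<Sum>j\<in>UNIV. \<Sum>l\<in>UNIV. (?I $ i $ l * A $ j $ l) *\<^sub>R B (axis i 1) (axis j 1))"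
      by (intro sum.cong refl sum.swap)
    finally show ?thesis by (simp add: matrix_matrix_mult_def transpose_def scaleR_sum_left)
  qed
  show ?thesis
    unfolding ID tr_metric_add[symmetric] 1[symmetric] 2[symmetric]
    by (simp add: scaleR_add_left sum.distrib add.commute)
qed

section \<open>Gauss formula, Gauss equation and Ricci tensor of an immersion\<close>

locale local_immersion =
  fixes \<epsilon> :: real and U :: "(real^'n) set" and Y :: "real^'n \<Rightarrow> real^('n::finite + 'k::finite)"
  assumes e: "\<epsilon> = 1 \<or> \<epsilon> = -1" and U: "open U" and Y: "smooth_on U Y"
    and fr: "\<And>p. p \<in> U \<Longrightarrow> frame \<epsilon> (Dd Y p)"
begin

definition Y2 where "Y2 p u v = Dd (\<lambda>q. Dd Y q v) p u"
definition Y3 where "Y3 p u v w = Dd (\<lambda>q. Y2 q v w) p u"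
abbreviation G where "G p \<equiv> pull_form \<epsilon> (Dd Y p)"
abbreviation A where "A \<equiv> second_fund \<epsilon> Y"
abbreviation \<Gamma> where "\<Gamma> \<equiv> christoffel G"
definition H where "H p = tr_metric (G p) (A p)"

lemma smooth_Y1: "smooth_on U (\<lambda>q. Dd Y q v)"
  by (rule smooth_on_Dd[OF U Y])

lemma smooth_Y2: "smooth_on U (\<lambda>q. Y2 q u v)"
  unfolding Y2_def by (rule smooth_on_Dd[OF U smooth_Y1])

lemmas diff_Y1 = smooth_on_differentiable[OF U smooth_Y1]
lemmas diff_Y2 = smooth_on_differentiable[OF U smooth_Y2]

lemma Y2_sym: "p \<in> U \<Longrightarrow> Y2 p u v = Y2 p v u"
  unfolding Y2_def by (rule Dd_commute[OF U Y])

text \<open>Moves \<open>w\<close> to the outermost derivative, which is how the trace over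
  \<open>u\<close> and \<open>v\<close> becomes comparable with the derivative of \<open>H\<close>
  along \<open>w\<close>.\<close>

lemma Y3_rotate:
  assumes p: "p \<in> U" shows "Y3 p u v w = Y3 p w u v"
proof -
  have "Y3 p u v w = Y3 p u w v"
    unfolding Y3_def by (rule fun_cong[OF Dd_cong[OF U p]]) (rule Y2_sym)
  also have "\<dots> = Y3 p w u v"
    unfolding Y3_def Y2_def by (rule Dd_commute[OF U smooth_Y1 p])
  finally show ?thesis .
qed

lemma linear_Y1: "p \<in> U \<Longrightarrow> linear (Dd Y p)"
  by (rule frame_linear[OF fr])

lemma bilinear_Y2:
  assumes p: "p \<in> U" shows "bilinear (Y2 p)"
proof -
  have 1: "linear (\<lambda>u. Y2 p u v)" for v unfolding Y2_def by (rule linear_Dd[OF diff_Y1[OF p]])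
  have "Y2 p u = (\<lambda>v. Y2 p v u)" for u by (rule ext) (rule Y2_sym[OF p])
  then have "linear (Y2 p u)" for u by (rule ssubst) (rule 1)
  with 1 show ?thesis by (simp add: bilinear_def)
qed

lemma pos_G: "p \<in> U \<Longrightarrow> pos_form (G p)"
  by (rule pos_form_frame[OF e fr])

lemma A_eq: "A p u v = nor_proj \<epsilon> (range (Dd Y p)) (Y2 p u v)"
  by (simp add: second_fund_def Y2_def)

lemma bilinear_A: "p \<in> U \<Longrightarrow> bilinear (A p)"
  using bilinear_Y2[of p] linear_compose[OF _ linear_nor_proj[OF e fr]]
  by (auto simp: bilinear_def A_eq o_def)

lemma A_sym: "p \<in> U \<Longrightarrow> A p u v = A p v u"
  by (simp add: A_eq Y2_sym[of p u v])

lemma A_normal: "p \<in> U \<Longrightarrow> flat_form \<epsilon> (A p u v) (Dd Y p w) = 0"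
  unfolding A_eq by (rule nor_proj_orth[OF e fr])

lemma H_normal: "p \<in> U \<Longrightarrow> flat_form \<epsilon> (H p) (Dd Y p w) = 0"
  unfolding H_def by (subst tr_metric_linear[OF linear_flat_form(1)]) (simp add: A_normal tr_metric_def)

lemma flat_form_A: "p \<in> U \<Longrightarrow> flat_form \<epsilon> (A p u v) (Y2 p x y) = flat_form \<epsilon> (A p u v) (A p x y)"
  unfolding A_eq by (rule flat_form_nor_proj[OF e fr, symmetric])

lemma flat_form_H: "p \<in> U \<Longrightarrow> flat_form \<epsilon> (H p) (Y2 p x y) = flat_form \<epsilon> (H p) (A p x y)"
  unfolding H_def by (subst (1 2) tr_metric_linear[OF linear_flat_form(1)]) (simp add: flat_form_A)

lemma Dd_G:
  assumes p: "p \<in> U"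
  shows "Dd (\<lambda>q. G q v w) p u = flat_form \<epsilon> (Y2 p u v) (Dd Y p w) + flat_form \<epsilon> (Dd Y p v) (Y2 p u w)"
  unfolding pull_form_def by (simp add: Dd_bilinear[OF bounded_bilinear_flat_form diff_Y1[OF p] diff_Y1[OF p]] Y2_def)

lemma linear_flat_Y1: "p \<in> U \<Longrightarrow> linear (\<lambda>w. flat_form \<epsilon> x (Dd Y p w))"
  using linear_compose[OF linear_Y1 linear_flat_form(2)] by (simp add: o_def)

text \<open>By symmetry of \<open>Y2\<close> the mixed terms of the Koszul expression cancel in
  pairs; what remains describes the tangential part of \<open>Y2 p u v\<close>.\<close>

lemma christoffel_formula:
  assumes p: "p \<in> U"
  shows "\<Gamma> p u v = inv_metric (G p) *v (\<chi> l. flat_form \<epsilon> (Y2 p u v) (Dd Y p (axis l 1)))"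
    and "G p (\<Gamma> p u v) w = flat_form \<epsilon> (Y2 p u v) (Dd Y p w)"
proof -
  let ?z = "inv_metric (G p) *v (\<chi> l. flat_form \<epsilon> (Y2 p u v) (Dd Y p (axis l 1)))"
  have z: "G p ?z w = flat_form \<epsilon> (Y2 p u v) (Dd Y p w)" for w
    by (rule pos_form_inv_solve[OF pos_G[OF p] linear_flat_Y1[OF p]])
  have k: "(Dd (\<lambda>q. G q v w) p u + Dd (\<lambda>q. G q u w) p v - Dd (\<lambda>q. G q u v) p w) / 2 =
      flat_form \<epsilon> (Y2 p u v) (Dd Y p w)" for w
    by (simp add: Dd_G[OF p] Y2_sym[OF p, of v u] Y2_sym[OF p, of w] flat_form_sym[of \<epsilon> "Dd Y p _"])
  show g: "\<Gamma> p u v = ?z"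
    unfolding christoffel_def k
  proof (rule the_equality)
    show "\<forall>w. G p ?z w = flat_form \<epsilon> (Y2 p u v) (Dd Y p w)" using z by blast
    show "z = ?z" if "\<forall>w. G p z w = flat_form \<epsilon> (Y2 p u v) (Dd Y p w)" for z
      by (rule pos_form_eqI[OF pos_G[OF p]]) (simp add: that z)
  qed
  show "G p (\<Gamma> p u v) w = flat_form \<epsilon> (Y2 p u v) (Dd Y p w)" unfolding g by (rule z)
qed

lemma christoffel_flat:
  "p \<in> U \<Longrightarrow> flat_form \<epsilon> (Dd Y p (\<Gamma> p u v)) (Dd Y p w) = flat_form \<epsilon> (Y2 p u v) (Dd Y p w)"
  using christoffel_formula(2)[of p u v w] pull_form_def[of \<epsilon> "Dd Y p" "\<Gamma> p u v" w] by simp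

lemma christoffel_sym: "p \<in> U \<Longrightarrow> \<Gamma> p u v = \<Gamma> p v u"
  by (simp add: christoffel_formula(1) Y2_sym[of p u v])

lemma gauss_formula:
  assumes p: "p \<in> U" shows "Y2 p u v = Dd Y p (\<Gamma> p u v) + A p u v"
proof -
  have "tan_proj \<epsilon> (range (Dd Y p)) (Y2 p u v) = Dd Y p (\<Gamma> p u v)"
    using christoffel_formula(2)[OF p, of u v]
    by (intro tan_proj_unique[OF e fr[OF p]]) (simp add: flat_form_simps pull_form_def)
  then show ?thesis by (simp add: A_eq nor_proj_def)
qed

lemma linear_christoffel:
  assumes p: "p \<in> U" shows "linear (\<Gamma> p u)"
proof -
  have "linear (\<lambda>v. \<chi> l. flat_form \<epsilon> (Y2 p u v) (Dd Y p (axis l 1)))"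
    using bilinear_linear(2)[OF bilinear_Y2[OF p], of u]
    by (intro linearI) (simp_all add: linear_add linear_scale flat_form_simps vec_eq_iff)
  from linear_compose[OF this matrix_vector_mul_linear, of "inv_metric (G p)"] show ?thesis
    by (simp add: o_def christoffel_formula(1)[OF p, symmetric])
qed

lemma smooth_gram: "smooth_on U (\<lambda>q. \<chi> i j. G q (axis i 1) (axis j 1))"
  unfolding pull_form_def
  by (intro smooth_on_vec_lambda[OF thick_open[OF U]] smooth_on_bilinear[OF thick_open[OF U] bounded_bilinear_flat_form] smooth_Y1)

lemma smooth_inv_metric: "smooth_on U (\<lambda>q. inv_metric (G q))"
  unfolding inv_metric_def
  by (rule smooth_on_matrix_inv[OF thick_open[OF U] smooth_gram pos_form_det[OF pos_G]])

lemma diff_christoffel: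
  assumes p: "p \<in> U" shows "(\<lambda>q. \<Gamma> q u v) differentiable (at p)"
proof -
  have "smooth_on U (\<lambda>q. inv_metric (G q) *v (\<chi> l. flat_form \<epsilon> (Y2 q u v) (Dd Y q (axis l 1))))"
    by (intro smooth_on_bilinear[OF thick_open[OF U] bounded_bilinear_matrix_vector] smooth_inv_metric
        smooth_on_vec_lambda[OF thick_open[OF U]] smooth_on_bilinear[OF thick_open[OF U] bounded_bilinear_flat_form]
        smooth_Y1 smooth_Y2)
  then have "(\<lambda>q. inv_metric (G q) *v (\<chi> l. flat_form \<epsilon> (Y2 q u v) (Dd Y q (axis l 1)))) differentiable (at p)"
    by (rule smooth_on_differentiable[OF U _ p])
  then show ?thesis
    using differentiable_cong_open[OF U p, of "\<lambda>q. \<Gamma> q u v"] christoffel_formula(1) by simp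
qed

text \<open>Differentiability of \<open>Dd Y q\<close> in \<open>q\<close> is available for fixed
  vectors, so the varying vector is expanded in the standard basis.\<close>

lemma Dd_Y1_apply:
  assumes p: "p \<in> U" and z: "z differentiable (at p)"
  shows "(\<lambda>q. Dd Y q (z q)) differentiable (at p)"
    and "Dd (\<lambda>q. Dd Y q (z q)) p u = Y2 p u (z p) + Dd Y p (Dd z p u)"
proof -
  have zi: "(\<lambda>q. z q $ i) differentiable (at p)" for i
    by (rule differentiable_linear[OF bounded_linear_vec_nth z])
  have Dzi: "Dd (\<lambda>q. z q $ i) p u = Dd z p u $ i" for i
    by (rule Dd_linear[OF bounded_linear_vec_nth z])
  have eq: "Dd Y q (z q) = (\<Sum>i\<in>UNIV. (z q $ i) *\<^sub>R Dd Y q (axis i 1))" if "q \<in> U" for q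
    by (rule linear_axis_expand[OF linear_Y1[OF that]])
  have dt: "(\<lambda>q. (z q $ i) *\<^sub>R Dd Y q (axis i 1)) differentiable (at p)" for i
    by (rule differentiable_bilinear[OF bounded_bilinear_scaleR zi diff_Y1[OF p]])
  have ds: "(\<lambda>q. \<Sum>i\<in>UNIV. (z q $ i) *\<^sub>R Dd Y q (axis i 1)) differentiable (at p)"
    by (intro differentiable_sum dt finite ballI)
  show "(\<lambda>q. Dd Y q (z q)) differentiable (at p)"
    by (rule iffD2[OF differentiable_cong_open[OF U p] ds]) (rule eq)
  have "Dd (\<lambda>q. Dd Y q (z q)) p u = Dd (\<lambda>q. \<Sum>i\<in>UNIV. (z q $ i) *\<^sub>R Dd Y q (axis i 1)) p u"
    by (rule fun_cong[OF Dd_cong[OF U p]]) (rule eq)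
  also have "\<dots> = (\<Sum>i\<in>UNIV. (z p $ i) *\<^sub>R Y2 p u (axis i 1) + (Dd z p u $ i) *\<^sub>R Dd Y p (axis i 1))"
    by (subst Dd_sum[OF dt], subst Dd_bilinear[OF bounded_bilinear_scaleR zi diff_Y1[OF p]]) (simp add: Dzi Y2_def)
  also have "\<dots> = Y2 p u (z p) + Dd Y p (Dd z p u)"
    by (simp add: sum.distrib linear_axis_expand[OF linear_Y1[OF p], of "Dd z p u"]
        linear_axis_expand[OF bilinear_linear(2)[OF bilinear_Y2[OF p]], of u "z p"])
  finally show "Dd (\<lambda>q. Dd Y q (z q)) p u = Y2 p u (z p) + Dd Y p (Dd z p u)" .
qed

text \<open>Differentiates the equation that characterises the Christoffel vector. By the Gauss
  formula the terms without third derivatives combine to a product of normal parts.\<close>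

lemma Dd_christoffel:
  assumes p: "p \<in> U"
  shows "G p (Dd (\<lambda>q. \<Gamma> q v w) p u + \<Gamma> p u (\<Gamma> p v w)) z =
    flat_form \<epsilon> (Y3 p u v w) (Dd Y p z) + flat_form \<epsilon> (A p v w) (A p u z)"
proof -
  let ?\<gamma> = "\<lambda>q. \<Gamma> q v w"
  note d = diff_christoffel[OF p, of v w]
  have "Dd (\<lambda>q. flat_form \<epsilon> (Dd Y q (?\<gamma> q)) (Dd Y q z)) p u = Dd (\<lambda>q. flat_form \<epsilon> (Y2 q v w) (Dd Y q z)) p u"
    by (rule fun_cong[OF Dd_cong[OF U p]]) (rule christoffel_flat)
  then have "flat_form \<epsilon> (Dd Y p (?\<gamma> p)) (Y2 p u z) + flat_form \<epsilon> (Y2 p u (?\<gamma> p) + Dd Y p (Dd ?\<gamma> p u)) (Dd Y p z) =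
      flat_form \<epsilon> (Y2 p v w) (Y2 p u z) + flat_form \<epsilon> (Y3 p u v w) (Dd Y p z)"
    by (simp add: Dd_bilinear[OF bounded_bilinear_flat_form Dd_Y1_apply(1)[OF p d] diff_Y1[OF p]]
        Dd_bilinear[OF bounded_bilinear_flat_form diff_Y2[OF p] diff_Y1[OF p]] Dd_Y1_apply(2)[OF p d]
        flip: Y2_def Y3_def)
  moreover have "G p (Dd ?\<gamma> p u + \<Gamma> p u (?\<gamma> p)) z =
      flat_form \<epsilon> (Dd Y p (Dd ?\<gamma> p u)) (Dd Y p z) + flat_form \<epsilon> (Y2 p u (?\<gamma> p)) (Dd Y p z)"
    using christoffel_formula(2)[OF p, of u "?\<gamma> p" z]
    by (simp add: pull_form_def linear_add[OF linear_Y1[OF p]] flat_form_simps)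
  moreover have "flat_form \<epsilon> (Y2 p v w) (Y2 p u z) - flat_form \<epsilon> (Dd Y p (?\<gamma> p)) (Y2 p u z) = flat_form \<epsilon> (A p v w) (A p u z)"
    by (simp add: gauss_formula[OF p, of v w] flat_form_simps flat_form_A[OF p])
  ultimately show ?thesis by (simp add: flat_form_simps)
qed

text \<open>Antisymmetrising \<open>Dd_christoffel\<close> in \<open>u\<close> and \<open>v\<close>
  removes the third derivatives of \<open>Y\<close>.\<close>

lemma gauss_equation:
  assumes p: "p \<in> U"
  shows "G p (riemann G p u v w) z = flat_form \<epsilon> (A p v w) (A p u z) - flat_form \<epsilon> (A p u w) (A p v z)"
proof -
  note lin = bilinear_linear[OF pos_formD(1)[OF pos_G[OF p]]]
  have "riemann G p u v w = (Dd (\<lambda>q. \<Gamma> q v w) p u + \<Gamma> p u (\<Gamma> p v w)) - (Dd (\<lambda>q. \<Gamma> q u w) p v + \<Gamma> p v (\<Gamma> p u w))"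
    by (simp add: riemann_def)
  moreover have "Y3 p w u v = Y3 p w v u"
    unfolding Y3_def by (rule fun_cong[OF Dd_cong[OF U p]]) (rule Y2_sym)
  then have "Y3 p u v w = Y3 p v u w" by (simp only: Y3_rotate[OF p, of u v w] Y3_rotate[OF p, of v u w])
  ultimately show ?thesis
    by (simp add: linear_diff[OF lin(1)] Dd_christoffel[OF p])
qed

lemma ricci_formula:
  assumes p: "p \<in> U"
  shows "ricci G p v w = flat_form \<epsilon> (A p v w) (H p) - tr_metric (G p) (\<lambda>a b. flat_form \<epsilon> (A p v a) (A p w b))"
proof -
  note g = pos_G[OF p] and bA = bilinear_A[OF p]
  obtain E where E: "orthonormal_family (G p) E" using pos_form_orthonormal_family[OF g] by blast
  note tr = tr_metric_orthonormal[OF pos_formD(1)[OF g] E]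
  note lA = bilinear_linear[OF bA]
  \<comment> \<open>Linearity in \<open>u\<close> is not visible in the definition of
    \<open>riemann\<close>; it is read off from the Gauss equation, tested against the
    metric.\<close>
  have T: "linear (\<lambda>u. riemann G p u v w)"
  proof (rule linearI; rule pos_form_eqI[OF g])
    note lin = bilinear_linear[OF pos_formD(1)[OF g]]
    show "G p (riemann G p (x + y) v w) z = G p (riemann G p x v w + riemann G p y v w) z" for x y z
      by (simp add: linear_add[OF lin(1)] gauss_equation[OF p] linear_add[OF lA(1)] flat_form_simps)
    show "G p (riemann G p (c *\<^sub>R x) v w) z = G p (c *\<^sub>R riemann G p x v w) z" for c x z
      by (simp add: linear_scale[OF lin(1)] gauss_equation[OF p] linear_scale[OF lA(1)] flat_form_simps algebra_simps)
  qed
  have B: "bilinear (\<lambda>a b. flat_form \<epsilon> (A p v a) (A p w b))"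
    using lA by (auto simp: bilinear_def linear_add linear_scale flat_form_simps intro!: linearI)
  have "ricci G p v w = (\<Sum>m\<in>UNIV. G p (riemann G p (E m) v w) (E m))"
    unfolding ricci_def by (rule trace_orthonormal[OF g E T])
  also have "\<dots> = (\<Sum>m\<in>UNIV. flat_form \<epsilon> (A p v w) (A p (E m) (E m))) - (\<Sum>m\<in>UNIV. flat_form \<epsilon> (A p v (E m)) (A p w (E m)))"
    by (simp add: gauss_equation[OF p] sum_subtractf A_sym[OF p, of _ w] flat_form_sym[of \<epsilon> "A p w _"])
  finally show ?thesis
    by (simp add: H_def tr[OF bA] tr[OF B] linear_sum[OF linear_flat_form(2)])
qed

text \<open>Differentiates the orthogonality of \<open>H\<close> to \<open>Dd Y q v\<close>. The
  field \<open>h\<close> stands for the velocity of the flow, whose differentiability is known from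
  smoothness in space-time.\<close>

lemma metric_velocity:
  assumes p: "p \<in> U" and h: "\<And>q. q \<in> U \<Longrightarrow> h q = H q" "h differentiable (at p)"
  shows "flat_form \<epsilon> (Dd h p u) (Dd Y p v) = - flat_form \<epsilon> (H p) (A p u v)"
proof -
  have "Dd (\<lambda>q. flat_form \<epsilon> (h q) (Dd Y q v)) p u = Dd (\<lambda>q. 0) p u"
    by (rule fun_cong[OF Dd_cong[OF U p]]) (simp add: h(1) H_normal)
  then show ?thesis
    using flat_form_H[OF p, of u v]
    by (simp add: Dd_bilinear[OF bounded_bilinear_flat_form h(2) diff_Y1[OF p]] h(1)[OF p] flip: Y2_def)
qed

end

lemma christoffel_cong:
  assumes "open U" "p \<in> U" "\<And>q. q \<in> U \<Longrightarrow> h q = h' q"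
  shows "christoffel h p = christoffel h' p"
proof (intro ext)
  fix u v
  have "Dd (\<lambda>q. h q a b) p = Dd (\<lambda>q. h' q a b) p" for a b
    by (rule Dd_cong[OF assms(1,2)]) (simp add: assms(3))
  then show "christoffel h p u v = christoffel h' p u v"
    unfolding christoffel_def by (simp only: assms(3)[OF assms(2)])
qed

lemma ricci_cong:
  assumes "open U" "p \<in> U" "\<And>q. q \<in> U \<Longrightarrow> h q = h' q"
  shows "ricci h p = ricci h' p"
proof (intro ext)
  fix v w
  have c: "christoffel h q = christoffel h' q" if "q \<in> U" for q
    by (rule christoffel_cong[OF assms(1) that assms(3)])
  have "Dd (\<lambda>q. christoffel h q a b) p = Dd (\<lambda>q. christoffel h' q a b) p" for a b
    by (rule Dd_cong[OF assms(1,2)]) (simp add: c)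
  then show "ricci h p v w = ricci h' p v w"
    unfolding ricci_def riemann_def by (simp only: c[OF assms(2)])
qed

lemma tension_cong:
  assumes "open U" "p \<in> U" "\<And>q. q \<in> U \<Longrightarrow> g q = g' q" "\<And>q. q \<in> U \<Longrightarrow> f q = f' q"
  shows "tension h g f p = tension h g' f' p"
proof -
  have f: "Dd f q = Dd f' q" if "q \<in> U" for q by (rule Dd_cong[OF assms(1) that assms(4)])
  have "Dd (\<lambda>q. Dd f q v) p = Dd (\<lambda>q. Dd f' q v) p" for v
    by (rule Dd_cong[OF assms(1,2)]) (simp add: f)
  then show ?thesis
    unfolding tension_def
    by (simp only: christoffel_cong[OF assms(1,2,3)] f[OF assms(2)] assms(3,4)[OF assms(2)])
qed

section \<open>The Gauss map in a graph chart and its tension field\<close>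

text \<open>The domain is so small that all tangent planes lie in one graph chart with the right
  orientation.\<close>

locale local_immersion_chart = local_immersion \<epsilon> U Y
  for \<epsilon> :: real and U :: "(real^'n) set" and Y :: "real^'n \<Rightarrow> real^('n::finite + 'k::finite)" +
  fixes b :: "('n, 'k) gchart"
  assumes b: "b \<in> gcharts \<epsilon>" and fd: "\<And>q. q \<in> U \<Longrightarrow> frame_det \<epsilon> b (Dd Y q) > 0"
begin

definition L where "L q = frame_coord \<epsilon> b (Dd Y q)"
abbreviation lam where "lam q \<equiv> graph_defect \<epsilon> b (L q)"

lemma chart_frame:
  assumes "q \<in> U"
  shows "frame \<epsilon> (gframe b (L q))" "gframe b (L q) (pF \<epsilon> b (Dd Y q u)) = Dd Y q u"
    "range (gframe b (L q)) = range (Dd Y q)" "gcoord b (oriented_span (Dd Y q)) = L q"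
  unfolding L_def using frame_span_chart[OF e b fr[OF assms] fd[OF assms]] by blast+

lemma L_pF: "q \<in> U \<Longrightarrow> L q *v pF \<epsilon> b (Dd Y q w) = pN \<epsilon> b (Dd Y q w)"
  unfolding L_def using fd by (intro frame_coord_works linear_Y1) force+

lemma smooth_L: "smooth_on U L"
  unfolding L_def using fd
  by (intro smooth_on_frame_coord[OF thick_open[OF U]] smooth_Y1) force+

lemmas diff_L = smooth_on_differentiable[OF U smooth_L]
lemmas diff_DL = smooth_on_differentiable[OF U smooth_on_Dd[OF U smooth_L]]

lemma bounded_linear_pFN: "bounded_linear (pF \<epsilon> b)" "bounded_linear (pN \<epsilon> b)"
  using linear_pF linear_pN linear_conv_bounded_linear by blast+

lemma Dd_lam:
  assumes p: "p \<in> U" and f: "f differentiable (at p)"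
  shows "(\<lambda>q. lam q (f q)) differentiable (at p)"
    and "Dd (\<lambda>q. lam q (f q)) p u = lam p (Dd f p u) - Dd L p u *v pF \<epsilon> b (f p)"
proof -
  note dF = differentiable_linear[OF bounded_linear_pFN(1) f] and dN = differentiable_linear[OF bounded_linear_pFN(2) f]
  note dL = differentiable_bilinear[OF bounded_bilinear_matrix_vector diff_L[OF p] dF]
  show "(\<lambda>q. lam q (f q)) differentiable (at p)"
    unfolding graph_defect_def by (rule differentiable_diff[OF dN dL])
  show "Dd (\<lambda>q. lam q (f q)) p u = lam p (Dd f p u) - Dd L p u *v pF \<epsilon> b (f p)"
    unfolding graph_defect_def
    by (simp add: Dd_diff[OF dN dL] Dd_bilinear[OF bounded_bilinear_matrix_vector diff_L[OF p] dF]
        Dd_linear[OF bounded_linear_pFN(1) f] Dd_linear[OF bounded_linear_pFN(2) f])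
qed

lemma lam_tangent: "q \<in> U \<Longrightarrow> lam q (Dd Y q u) = 0"
  using L_pF by (simp add: graph_defect_def)

lemma lam_A: "q \<in> U \<Longrightarrow> lam q (A q u v) = lam q (Y2 q u v)"
  using graph_defect_nor_proj[OF e b chart_frame(1)] chart_frame(3) by (simp add: A_eq)

lemma Dd_L:
  assumes p: "p \<in> U" shows "Dd L p u *v pF \<epsilon> b (Dd Y p w) = lam p (A p u w)"
proof -
  have "Dd (\<lambda>q. lam q (Dd Y q w)) p u = Dd (\<lambda>q. 0) p u"
    by (rule fun_cong[OF Dd_cong[OF U p]]) (rule lam_tangent)
  then show ?thesis by (simp add: Dd_lam(2)[OF p diff_Y1[OF p]] lam_A[OF p] flip: Y2_def)
qed

text \<open>Both sides are normal projections of vectors with equal defect. Under the identification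
  of tangent vectors of the Grassmannian with homomorphisms, the differential of the Gauss map is
  thus the second fundamental form.\<close>

lemma ghom_Dd_L:
  assumes p: "p \<in> U" shows "ghom \<epsilon> b (L p) (Dd L p u) (Dd Y p w) = A p u w"
proof -
  note f = chart_frame(1)[OF p]
  have "ghom \<epsilon> b (L p) (Dd L p u) (Dd Y p w) =
      nor_proj \<epsilon> (range (gframe b (L p))) (snd b (Dd L p u *v pF \<epsilon> b (Dd Y p w)))"
    using ghom_gframe[OF e b f, of "Dd L p u" "pF \<epsilon> b (Dd Y p w)"] by (simp add: chart_frame(2)[OF p])
  also have "\<dots> = nor_proj \<epsilon> (range (gframe b (L p))) (Y2 p u w)"
    by (rule graph_defect_nor_eqI[OF e b f])
      (simp add: Dd_L[OF p] lam_A[OF p] graph_defect_def[of _ _ _ "snd b _"] chart_projections[OF e b])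
  finally show ?thesis by (simp add: A_eq chart_frame(3)[OF p])
qed

lemma pF_A:
  assumes p: "p \<in> U"
  shows "pF \<epsilon> b (A p v w) = - \<epsilon> *\<^sub>R (gramM \<epsilon> (L p) *v (transpose (L p) *v (Dd L p v *v pF \<epsilon> b (Dd Y p w))))"
proof -
  have "flat_form \<epsilon> (A p v w) (gframe b (L p) u) = 0" for u
  proof -
    have "gframe b (L p) u \<in> range (Dd Y p)" using chart_frame(3)[OF p] by blast
    then show ?thesis using A_normal[OF p] by auto
  qed
  from pN_normal(2)[OF e b chart_frame(1)[OF p] this] show ?thesis by (simp add: Dd_L[OF p])
qed

text \<open>The Gauss formula splits \<open>Y2 p v w\<close>. The tangential part falls under
  \<open>Dd_L\<close>; the normal part has a component along the reference plane, by
  \<open>pF_A\<close>, and yields the quadratic term that matches one half of the Grassmannian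
  Christoffel vector.\<close>

lemma Dd_L_pF_Y2:
  assumes p: "p \<in> U"
  shows "Dd L p u *v pF \<epsilon> b (Y2 p v w) = lam p (A p u (\<Gamma> p v w)) -
    \<epsilon> *\<^sub>R ((Dd L p u ** gramM \<epsilon> (L p) ** transpose (L p) ** Dd L p v) *v pF \<epsilon> b (Dd Y p w))"
  by (simp add: gauss_formula[OF p] linear_add[OF linear_pF] matrix_vector_right_distrib Dd_L[OF p])
     (simp add: pF_A[OF p] matrix_vector_scaleR_distribs matrix_vector_mul_assoc matrix_mul_assoc
        flip: scaleR_minus_left)

text \<open>Differentiating \<open>Dd_L\<close> once more produces two terms treated by
  \<open>Dd_L_pF_Y2\<close>, whose quadratic parts cancel against the Christoffel vector of the
  Grassmannian. What remains on the right is the defect of the covariant derivative of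
  \<open>A\<close>.\<close>

lemma hessian_L:
  assumes p: "p \<in> U"
  shows "(Dd (\<lambda>q. Dd L q v) p u - Dd L p (\<Gamma> p u v) + christoffel (gmetric \<epsilon> b) (L p) (Dd L p u) (Dd L p v))
      *v pF \<epsilon> b (Dd Y p w) =
    lam p (Y3 p u v w) - lam p (A p u (\<Gamma> p v w)) - lam p (A p v (\<Gamma> p u w)) - lam p (A p (\<Gamma> p u v) w)"
proof -
  let ?a = "pF \<epsilon> b (Dd Y p w)"
  note dF = differentiable_linear[OF bounded_linear_pFN(1) diff_Y1[OF p]]
  have "Dd (\<lambda>q. Dd L q v *v pF \<epsilon> b (Dd Y q w)) p u = Dd (\<lambda>q. lam q (Y2 q v w)) p u"
    by (rule fun_cong[OF Dd_cong[OF U p]]) (simp add: Dd_L lam_A)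
  then have "Dd L p v *v pF \<epsilon> b (Y2 p u w) + Dd (\<lambda>q. Dd L q v) p u *v ?a =
      lam p (Y3 p u v w) - Dd L p u *v pF \<epsilon> b (Y2 p v w)"
    by (simp add: Dd_bilinear[OF bounded_bilinear_matrix_vector diff_DL[OF p] dF] Dd_lam(2)[OF p diff_Y2[OF p]]
        Dd_linear[OF bounded_linear_pFN(1) diff_Y1[OF p]] flip: Y2_def Y3_def)
  then have "Dd (\<lambda>q. Dd L q v) p u *v ?a = lam p (Y3 p u v w) - Dd L p u *v pF \<epsilon> b (Y2 p v w) - Dd L p v *v pF \<epsilon> b (Y2 p u w)"
    by (simp add: algebra_simps)
  then show ?thesis
    by (simp add: Dd_L_pF_Y2[OF p] christoffel_gmetric[OF e b chart_frame(1)[OF p]] matrix_vector_mult_add_rdistrib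
        matrix_vector_mult_diff_rdistrib Dd_L[OF p] matrix_vector_scaleR_distribs scaleR_add_right
        bounded_bilinear.minus_left[OF bounded_bilinear_matrix_vector])
qed

lemma tension_L:
  assumes p: "p \<in> U" and h: "\<And>q. q \<in> U \<Longrightarrow> h q = H q" "h differentiable (at p)"
  shows "tension (gmetric \<epsilon> b) G L p *v pF \<epsilon> b (Dd Y p w) = lam p (Dd h p w)"
proof -
  note g = pos_G[OF p]
  let ?I = "\<lambda>q. inv_metric (G q)"
  have linlam: "linear (lam q)" for q by (rule linear_graph_defect)
  have t: "tension (gmetric \<epsilon> b) G L p *v pF \<epsilon> b (Dd Y p w) = tr_metric (G p) (\<lambda>u v.
      lam p (Y3 p u v w) - lam p (A p u (\<Gamma> p v w)) - lam p (A p v (\<Gamma> p u w)) - lam p (A p (\<Gamma> p u v) w))"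
  proof -
    have T: "linear (\<lambda>A. A *v pF \<epsilon> b (Dd Y p w))"
      by (intro linearI) (simp_all add: matrix_vector_scaleR_distribs)
    show ?thesis unfolding tension_def tr_metric_linear[OF T] hessian_L[OF p] ..
  qed
  have lamH: "lam q (H q) = (\<Sum>i\<in>UNIV. \<Sum>j\<in>UNIV. (?I q $ i $ j) *\<^sub>R lam q (Y2 q (axis i 1) (axis j 1)))" if "q \<in> U" for q
    unfolding H_def tr_metric_linear[OF linlam] by (simp add: tr_metric_def lam_A[OF that])
  have dI: "?I differentiable (at p)" by (rule smooth_on_differentiable[OF U smooth_inv_metric p])
  have dIij: "(\<lambda>q. ?I q $ i $ j) differentiable (at p)" for i j
    by (intro differentiable_linear[OF bounded_linear_vec_nth] dI)
  have DIij: "Dd (\<lambda>q. ?I q $ i $ j) p w = Dd ?I p w $ i $ j" for i j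
    by (subst Dd_linear[OF bounded_linear_vec_nth differentiable_linear[OF bounded_linear_vec_nth dI]],
        subst Dd_linear[OF bounded_linear_vec_nth dI]) simp
  note dlam = Dd_lam(1)[OF p diff_Y2[OF p]]
  note dterm = differentiable_bilinear[OF bounded_bilinear_scaleR dIij dlam]
  \<comment> \<open>The defect of \<open>H\<close> is a trace with the inverse metric, so its
    derivative along \<open>w\<close> has three sources: the third derivatives of \<open>Y\<close>,
    the derivative of \<open>L\<close>, and that of the inverse metric.\<close>
  have "lam p (Dd h p w) - Dd L p w *v pF \<epsilon> b (H p) = Dd (\<lambda>q. lam q (h q)) p w"
    by (simp add: Dd_lam(2)[OF p h(2)] h(1)[OF p])
  also have "\<dots> = Dd (\<lambda>q. \<Sum>i\<in>UNIV. \<Sum>j\<in>UNIV. (?I q $ i $ j) *\<^sub>R lam q (Y2 q (axis i 1) (axis j 1))) p w"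
    by (rule fun_cong[OF Dd_cong[OF U p]]) (simp add: h(1) lamH)
  also have "\<dots> = (\<Sum>i\<in>UNIV. \<Sum>j\<in>UNIV. Dd (\<lambda>q. (?I q $ i $ j) *\<^sub>R lam q (Y2 q (axis i 1) (axis j 1))) p w)"
    by (subst Dd_sum, intro differentiable_sum dterm finite ballI, subst Dd_sum[OF dterm], rule refl)
  also have "\<dots> = (\<Sum>i\<in>UNIV. \<Sum>j\<in>UNIV.
      (?I p $ i $ j) *\<^sub>R (lam p (Y3 p w (axis i 1) (axis j 1)) - Dd L p w *v pF \<epsilon> b (Y2 p (axis i 1) (axis j 1)))
      + Dd ?I p w $ i $ j *\<^sub>R lam p (A p (axis i 1) (axis j 1)))"
    by (subst Dd_bilinear[OF bounded_bilinear_scaleR dIij dlam])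
      (simp add: DIij Dd_lam(2)[OF p diff_Y2[OF p]] lam_A[OF p] flip: Y3_def)
  also have "\<dots> = tr_metric (G p) (\<lambda>u v. lam p (Y3 p w u v) - Dd L p w *v pF \<epsilon> b (Y2 p u v)) +
     (\<Sum>i\<in>UNIV. \<Sum>j\<in>UNIV. Dd ?I p w $ i $ j *\<^sub>R lam p (A p (axis i 1) (axis j 1)))"
    by (simp add: tr_metric_def sum.distrib)
  also have "(\<Sum>i\<in>UNIV. \<Sum>j\<in>UNIV. Dd ?I p w $ i $ j *\<^sub>R lam p (A p (axis i 1) (axis j 1))) =
     - tr_metric (G p) (\<lambda>u v. lam p (A p (\<Gamma> p w u) v) + lam p (A p u (\<Gamma> p w v)))"
  proof -
    let ?g = "\<lambda>q. \<chi> i j. G q (axis i 1) (axis j 1)"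
    have dg: "?g differentiable (at p)" by (rule smooth_on_differentiable[OF U smooth_gram p])
    \<comment> \<open>Compatibility of the Christoffel vectors with the metric, in the shape that
      \<open>inv_metric_derivative\<close> expects with \<open>C = \<Gamma> p w\<close>.\<close>
    have D: "Dd ?g p w $ l $ m = G p (\<Gamma> p w (axis l 1)) (axis m 1) + G p (axis l 1) (\<Gamma> p w (axis m 1))" for l m
    proof -
      have "Dd ?g p w $ l $ m = Dd (\<lambda>q. ?g q $ l $ m) p w"
        by (subst Dd_linear[OF bounded_linear_vec_nth differentiable_linear[OF bounded_linear_vec_nth dg]],
            subst Dd_linear[OF bounded_linear_vec_nth dg]) simp
      also have "\<dots> = Dd (\<lambda>q. G q (axis l 1) (axis m 1)) p w" by simp
      also have "\<dots> = flat_form \<epsilon> (Y2 p w (axis l 1)) (Dd Y p (axis m 1)) + flat_form \<epsilon> (Dd Y p (axis l 1)) (Y2 p w (axis m 1))"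
        by (rule Dd_G[OF p])
      also have "\<dots> = G p (\<Gamma> p w (axis l 1)) (axis m 1) + G p (\<Gamma> p w (axis m 1)) (axis l 1)"
        by (simp only: christoffel_formula(2)[OF p] flat_form_sym[of \<epsilon> "Dd Y p (axis l 1)"])
      finally show ?thesis by (simp only: pos_formD(2)[OF g, of "\<Gamma> p w (axis m 1)"])
    qed
    have DI: "Dd ?I p w = - (?I p ** Dd ?g p w ** ?I p)"
      unfolding inv_metric_def by (rule Dd_matrix_inv[OF U smooth_gram pos_form_det[OF pos_G] p])
    have B: "bilinear (\<lambda>u v. lam p (A p u v))"
      using bilinear_A[OF p] linear_compose[OF _ linlam] by (auto simp: bilinear_def o_def)
    show ?thesis
      using inv_metric_derivative[OF g linear_christoffel[OF p, of w] B D]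
      by (simp add: DI sum_negf)
  qed
  finally have 1: "lam p (Dd h p w) = Dd L p w *v pF \<epsilon> b (H p) +
    (tr_metric (G p) (\<lambda>u v. lam p (Y3 p w u v) - Dd L p w *v pF \<epsilon> b (Y2 p u v)) +
     - tr_metric (G p) (\<lambda>u v. lam p (A p (\<Gamma> p w u) v) + lam p (A p u (\<Gamma> p w v))))"
    by (simp add: algebra_simps)
  have "linear (\<lambda>x. Dd L p w *v pF \<epsilon> b x)"
    using linear_compose[OF linear_pF matrix_vector_mul_linear] by (simp add: o_def)
  then have 2: "Dd L p w *v pF \<epsilon> b (H p) = tr_metric (G p) (\<lambda>u v. Dd L p w *v pF \<epsilon> b (A p u v))"
    unfolding H_def by (rule tr_metric_linear)
  \<comment> \<open>The two traces agree summand by summand: \<open>A\<close> minus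
    \<open>Y2\<close> leaves minus the tangential part, which supplies the term with
    \<open>\<Gamma> p u v\<close>, and the third derivative is rotated.\<close>
  have 3: "Dd L p w *v pF \<epsilon> b (A p u v) + (lam p (Y3 p w u v) - Dd L p w *v pF \<epsilon> b (Y2 p u v)
      - (lam p (A p (\<Gamma> p w u) v) + lam p (A p u (\<Gamma> p w v)))) =
    lam p (Y3 p u v w) - lam p (A p u (\<Gamma> p v w)) - lam p (A p v (\<Gamma> p u w)) - lam p (A p (\<Gamma> p u v) w)" for u v
    by (simp add: gauss_formula[OF p] linear_add[OF linear_pF] matrix_vector_right_distrib Dd_L[OF p] Y3_rotate[OF p, of u]
        A_sym[OF p, of v] A_sym[OF p, of w] christoffel_sym[OF p, of w])
  show ?thesis
    unfolding t 1 2 by (simp only: tr_metric_add tr_metric_diff 3 flip: diff_conv_add_uminus)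
qed

end

section \<open>Charts of the manifold\<close>

locale oriented_atlas =
  fixes S :: "'a topology" and \<A> :: "('a, 'n::finite) chart set"
  assumes M: "oriented_manifold S \<A>"
begin

lemma chart:
  assumes "c \<in> \<A>"
  shows "openin S (fst c)" "open (cimage c)"
    "homeomorphic_map (subtopology S (fst c)) (top_of_set (cimage c)) (snd c)"
  using M assms unfolding oriented_manifold_def by blast+

lemma topspace_eq: "(\<Union>c\<in>\<A>. fst c) = topspace S"
  using M by (simp add: oriented_manifold_def)

lemma chart_at: "x \<in> topspace S \<Longrightarrow> chart_at \<A> x \<in> \<A> \<and> x \<in> fst (chart_at \<A> x)"
  unfolding chart_at_def using topspace_eq by (intro someI_ex[of "\<lambda>c. c \<in> \<A> \<and> x \<in> fst c"]) blast

lemma chart_at': "c \<in> \<A> \<Longrightarrow> x \<in> fst c \<Longrightarrow> chart_at \<A> x \<in> \<A> \<and> x \<in> fst (chart_at \<A> x)"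
  using chart_at topspace_eq by blast

lemma inj_chart: "c \<in> \<A> \<Longrightarrow> inj_on (snd c) (fst c)"
  using homeomorphic_imp_injective_map[OF chart(3)] chart(1)[THEN openin_subset]
  by (simp add: topspace_subtopology Int_absorb1)

lemma cinv_left: "c \<in> \<A> \<Longrightarrow> x \<in> fst c \<Longrightarrow> cinv c (snd c x) = x"
  by (rule inv_into_f_f[OF inj_chart])

lemma cinv_right: "p \<in> cimage c \<Longrightarrow> snd c (cinv c p) = p"
  by (rule f_inv_into_f)

lemma cinv_mem: "p \<in> cimage c \<Longrightarrow> cinv c p \<in> fst c"
  by (rule inv_into_into)

lemma open_overlap:
  assumes c: "c \<in> \<A>" "c' \<in> \<A>" shows "open (snd c ` (fst c \<inter> fst c'))"
proof -
  have "openin (subtopology S (fst c)) (fst c \<inter> fst c')"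
    using chart(1)[OF c(2)] by (auto simp: openin_subtopology)
  then have "openin (top_of_set (cimage c)) (snd c ` (fst c \<inter> fst c'))"
    using homeomorphic_imp_open_map[OF chart(3)[OF c(1)]] by (auto simp: open_map_def)
  then show ?thesis using chart(2)[OF c(1)] by (simp add: openin_open_eq)
qed

lemma transition_differentiable:
  assumes "c \<in> \<A>" "c' \<in> \<A>" "x \<in> fst c" "x \<in> fst c'"
  shows "(snd c' \<circ> cinv c) differentiable (at (snd c x))"
  using M assms unfolding oriented_manifold_def
  by (intro smooth_on_differentiable[OF open_overlap[OF assms(1,2)]]) auto

lemma transition_det:
  assumes "c \<in> \<A>" "c' \<in> \<A>" "x \<in> fst c" "x \<in> fst c'"
  shows "det (matrix (Dd (snd c' \<circ> cinv c) (snd c x))) > 0"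
  using M assms unfolding oriented_manifold_def by blast

lemma chain_rule:
  assumes c: "c \<in> \<A>" "c' \<in> \<A>" "x \<in> fst c" "x \<in> fst c'" and f: "(f \<circ> cinv c') differentiable (at (snd c' x))"
  shows "Dd (f \<circ> cinv c) (snd c x) u = Dd (f \<circ> cinv c') (snd c' x) (Dd (snd c' \<circ> cinv c) (snd c x) u)"
proof -
  let ?\<tau> = "snd c' \<circ> cinv c"
  have \<tau>x: "?\<tau> (snd c x) = snd c' x" using cinv_left[OF c(1,3)] by simp
  have "((\<lambda>q. (f \<circ> cinv c') (?\<tau> q)) has_derivative (\<lambda>u. Dd (f \<circ> cinv c') (snd c' x) (Dd ?\<tau> (snd c x) u))) (at (snd c x))"
    by (rule has_derivative_compose[OF Dd_works[OF transition_differentiable[OF c]]])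
      (simp only: \<tau>x Dd_works[OF f])
  then have "Dd (\<lambda>q. (f \<circ> cinv c') (?\<tau> q)) (snd c x) u = Dd (f \<circ> cinv c') (snd c' x) (Dd ?\<tau> (snd c x) u)"
    by (simp only: Dd_eqI)
  moreover have "Dd (f \<circ> cinv c) (snd c x) = Dd (\<lambda>q. (f \<circ> cinv c') (?\<tau> q)) (snd c x)"
  proof (rule Dd_cong[OF open_overlap[OF c(1,2)]])
    show "snd c x \<in> snd c ` (fst c \<inter> fst c')" using c by blast
    fix q assume "q \<in> snd c ` (fst c \<inter> fst c')"
    then obtain y where y: "y \<in> fst c" "y \<in> fst c'" "q = snd c y" by blast
    then show "(f \<circ> cinv c) q = (f \<circ> cinv c') (?\<tau> q)"
      by (simp add: cinv_left[OF c(1)] cinv_left[OF c(2)])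
  qed
  ultimately show ?thesis by simp
qed

lemma transition_id:
  assumes c: "c \<in> \<A>" "x \<in> fst c" shows "Dd (snd c \<circ> cinv c) (snd c x) u = u"
proof -
  have "Dd (snd c \<circ> cinv c) (snd c x) = Dd (\<lambda>q. q) (snd c x)"
    by (rule Dd_cong[OF chart(2)[OF c(1)]]) (use c(2) in blast, simp only: o_def cinv_right)
  then show ?thesis by (simp add: Dd_eqI[OF has_derivative_ident])
qed

lemma coord_vec_tangent:
  assumes c: "c \<in> \<A>" "x \<in> fst c"
  shows "coord_vec \<A> c x u \<in> tangent_space \<A> x" "coord_vec \<A> c x u c = u"
proof -
  show "coord_vec \<A> c x u c = u" using c by (simp add: coord_vec_def transition_id)
  show "coord_vec \<A> c x u \<in> tangent_space \<A> x"
    unfolding tangent_space_def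
  proof (intro CollectI conjI ballI allI impI)
    fix c1 c2 assume 1: "c1 \<in> \<A>" "c2 \<in> \<A>" "x \<in> fst c1 \<inter> fst c2"
    then have x: "x \<in> fst c1" "x \<in> fst c2" by auto
    show "coord_vec \<A> c x u c2 = Dd (snd c2 \<circ> cinv c1) (snd c1 x) (coord_vec \<A> c x u c1)"
      using chain_rule[OF c(1) 1(1) c(2) x(1) transition_differentiable[OF 1(1,2) x]] 1 x
      by (simp add: coord_vec_def)
  next
    show "coord_vec \<A> c x u c' = 0" if "c' \<notin> \<A> \<or> x \<notin> fst c'" for c'
      using that by (auto simp: coord_vec_def)
  qed
qed

lemma tangent_eq_coord_vec:
  assumes c: "c \<in> \<A>" "x \<in> fst c" and v: "v \<in> tangent_space \<A> x"
  shows "v = coord_vec \<A> c x (v c)"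
proof (rule ext)
  fix c'
  show "v c' = coord_vec \<A> c x (v c) c'"
  proof (cases "c' \<in> \<A> \<and> x \<in> fst c'")
    case True
    then have "v c' = Dd (snd c' \<circ> cinv c) (snd c x) (v c)"
      using v c unfolding tangent_space_def by blast
    then show ?thesis using True by (simp add: coord_vec_def)
  next
    case False
    then have "v c' = 0" using v unfolding tangent_space_def by blast
    then show ?thesis using False by (auto simp: coord_vec_def)
  qed
qed

lemma coord_vec_linear:
  assumes c: "c \<in> \<A>" "x \<in> fst c"
  shows "coord_vec \<A> c x (a *\<^sub>R u + b *\<^sub>R v) = tlin a (coord_vec \<A> c x u) b (coord_vec \<A> c x v)"
proof (rule ext)
  fix c'
  show "coord_vec \<A> c x (a *\<^sub>R u + b *\<^sub>R v) c' = tlin a (coord_vec \<A> c x u) b (coord_vec \<A> c x v) c'"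
  proof (cases "c' \<in> \<A> \<and> x \<in> fst c'")
    case True
    then have "linear (Dd (snd c' \<circ> cinv c) (snd c x))"
      using c by (intro linear_Dd transition_differentiable) auto
    then show ?thesis using True by (simp add: coord_vec_def tlin_def linear_add linear_scale)
  next
    case False
    then have "coord_vec \<A> c x w c' = 0" for w by (auto simp: coord_vec_def)
    then show ?thesis by (simp add: tlin_def)
  qed
qed

lemma tlin_tangent:
  assumes "x \<in> topspace S" "v \<in> tangent_space \<A> x" "w \<in> tangent_space \<A> x"
  shows "tlin a v b w \<in> tangent_space \<A> x"
proof -
  define c where "c = chart_at \<A> x"
  have c: "c \<in> \<A>" "x \<in> fst c" using chart_at[OF assms(1)] by (auto simp: c_def)
  have "tlin a v b w = coord_vec \<A> c x (a *\<^sub>R v c + b *\<^sub>R w c)"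
    unfolding coord_vec_linear[OF c] by (simp only: tangent_eq_coord_vec[OF c assms(2), symmetric] tangent_eq_coord_vec[OF c assms(3), symmetric])
  then show ?thesis using coord_vec_tangent(1)[OF c] by simp
qed

lemma mdiff_chart:
  assumes c: "c \<in> \<A>" "x \<in> fst c" and v: "v \<in> tangent_space \<A> x" and f: "(f \<circ> cinv c) differentiable (at (snd c x))"
  shows "mdiff \<A> f x v = Dd (f \<circ> cinv c) (snd c x) (v c)"
proof -
  define c0 where "c0 = chart_at \<A> x"
  have c0: "c0 \<in> \<A>" "x \<in> fst c0" using chart_at'[OF c] by (auto simp: c0_def)
  have "v c = Dd (snd c \<circ> cinv c0) (snd c0 x) (v c0)"
    using v c c0 unfolding tangent_space_def by blast
  then show ?thesis
    using chain_rule[OF c0(1) c(1) c0(2) c(2) f, of "v c0"] by (simp add: mdiff_def Let_def flip: c0_def)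
qed

lemma mdiff_cong:
  assumes f: "\<And>y. y \<in> topspace S \<Longrightarrow> f y = g y" and x: "x \<in> topspace S"
  shows "mdiff \<A> f x = mdiff \<A> g x"
proof -
  define c where "c = chart_at \<A> x"
  have c: "c \<in> \<A>" "x \<in> fst c" using chart_at[OF x] by (auto simp: c_def)
  have "Dd (f \<circ> cinv c) (snd c x) = Dd (g \<circ> cinv c) (snd c x)"
  proof (rule Dd_cong[OF chart(2)[OF c(1)]])
    show "snd c x \<in> cimage c" using c(2) by blast
    show "(f \<circ> cinv c) q = (g \<circ> cinv c) q" if "q \<in> cimage c" for q
      using f[of "cinv c q"] c(1) cinv_mem[OF that] topspace_eq by auto
  qed
  then show ?thesis by (intro ext) (simp add: mdiff_def Let_def flip: c_def)
qed

definition patch :: "('a \<Rightarrow> 'w::real_normed_vector) \<Rightarrow> ('a, 'n) chart \<Rightarrow> real^'n \<Rightarrow> 'w" where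
  "patch X c p = X (cinv c p)"

lemma comp_cinv: "X \<circ> cinv c = patch X c"
  by (auto simp: patch_def)

lemma immersion_local:
  fixes X :: "'a \<Rightarrow> real^('n + 'k::finite)"
  assumes "\<epsilon> = 1 \<or> \<epsilon> = -1" "immersion \<epsilon> \<A> X" "c \<in> \<A>"
  shows "local_immersion \<epsilon> (cimage c) (patch X c)"
  using assms chart(2) by unfold_locales (auto simp: immersion_def comp_cinv)

lemma patch_differentiable:
  fixes X :: "'a \<Rightarrow> real^('n + 'k::finite)"
  assumes "immersion \<epsilon> \<A> X" "c \<in> \<A>" "p \<in> cimage c" shows "patch X c differentiable (at p)"
  using assms by (intro smooth_on_differentiable[OF chart(2)]) (auto simp: immersion_def comp_cinv)

lemma mdiff_immersion:
  fixes X :: "'a \<Rightarrow> real^('n + 'k::finite)"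
  assumes X: "immersion \<epsilon> \<A> X" and c: "c \<in> \<A>" "x \<in> fst c" and v: "v \<in> tangent_space \<A> x"
  shows "mdiff \<A> X x v = Dd (patch X c) (snd c x) (v c)"
  using mdiff_chart[OF c v, of X] patch_differentiable[OF X c(1)] c by (simp add: comp_cinv)

lemma frame_immersion:
  fixes X :: "'a \<Rightarrow> real^('n + 'k::finite)"
  assumes X: "immersion \<epsilon> \<A> X" and c: "c \<in> \<A>" "p \<in> cimage c"
  shows "frame \<epsilon> (Dd (patch X c) p)"
  using X c by (auto simp: immersion_def comp_cinv)

lemma induced_metric_chart:
  fixes X :: "'a \<Rightarrow> real^('n + 'k::finite)"
  assumes X: "immersion \<epsilon> \<A> X" and c: "c \<in> \<A>" "x \<in> fst c"
    and v: "v \<in> tangent_space \<A> x" "w \<in> tangent_space \<A> x"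
  shows "induced_metric \<epsilon> \<A> X x v w = pull_form \<epsilon> (Dd (patch X c) (snd c x)) (v c) (w c)"
  by (simp add: induced_metric_def pull_form_def mdiff_immersion[OF X c] v)

lemma loc_metric_induced:
  fixes X :: "'a \<Rightarrow> real^('n + 'k::finite)"
  assumes X: "immersion \<epsilon> \<A> X" and c: "c \<in> \<A>" and p: "p \<in> cimage c"
  shows "loc_metric \<A> c (induced_metric \<epsilon> \<A> X) p = pull_form \<epsilon> (Dd (patch X c) p)"
  using induced_metric_chart[OF X c cinv_mem[OF p]] coord_vec_tangent[OF c cinv_mem[OF p]] cinv_right[OF p]
  by (intro ext) (simp add: loc_metric_def)

text \<open>Changing from the chart used in the definition composes the frame with a Jacobian of
  positive determinant, which leaves the oriented span unchanged.\<close>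

lemma gauss_map_chart:
  fixes X :: "'a \<Rightarrow> real^('n + 'k::finite)"
  assumes X: "immersion \<epsilon> \<A> X" and c: "c \<in> \<A>" "x \<in> fst c"
  shows "gauss_map \<A> X x = oriented_span (Dd (patch X c) (snd c x))"
proof -
  define c0 where "c0 = chart_at \<A> x"
  have c0: "c0 \<in> \<A>" "x \<in> fst c0" using chart_at'[OF c] by (auto simp: c0_def)
  let ?J = "Dd (snd c \<circ> cinv c0) (snd c0 x)"
  have J: "linear ?J" by (rule linear_Dd[OF transition_differentiable[OF c0(1) c(1) c0(2) c(2)]])
  have "mdiff \<A> X x (coord_vec \<A> c0 x u) = Dd (patch X c) (snd c x) (matrix ?J *v u)" for u
  proof -
    have "coord_vec \<A> c0 x u c = ?J u" using c by (simp add: coord_vec_def)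
    then show ?thesis
      using mdiff_immersion[OF X c coord_vec_tangent(1)[OF c0], of u] by (simp add: matrix_of_linear[OF J])
  qed
  then show ?thesis
    using oriented_span_compose[OF transition_det[OF c0(1) c(1) c0(2) c(2)], of "Dd (patch X c) (snd c x)"]
    by (simp add: gauss_map_def flip: c0_def)
qed

lemma subspace_gauss_map:
  fixes X :: "'a \<Rightarrow> real^('n + 'k::finite)"
  assumes X: "immersion \<epsilon> \<A> X" and c: "c \<in> \<A>" "x \<in> fst c"
  shows "subspace_of (gauss_map \<A> X x) = range (Dd (patch X c) (snd c x))"
  by (simp add: gauss_map_chart[OF X c] subspace_of_oriented_span)

lemma metric_at_induced:
  fixes X :: "'a \<Rightarrow> real^('n + 'k::finite)"
  assumes e: "\<epsilon> = 1 \<or> \<epsilon> = -1" and X: "immersion \<epsilon> \<A> X" and c: "c \<in> \<A>" "x \<in> fst c"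
  shows "metric_at \<A> (induced_metric \<epsilon> \<A> X) x"
  unfolding metric_at_def
proof (intro ballI conjI impI allI)
  fix v w assume v: "v \<in> tangent_space \<A> x" and w: "w \<in> tangent_space \<A> x"
  note ind = induced_metric_chart[OF X c]
  note g = pos_form_frame[OF e frame_immersion[OF X c(1)], of "snd c x"]
  have p: "snd c x \<in> cimage c" using c by blast
  show "induced_metric \<epsilon> \<A> X x v w = induced_metric \<epsilon> \<A> X x w v"
    using pos_formD(2)[OF g[OF p], of "v c" "w c"] by (simp add: ind v w)
  show "induced_metric \<epsilon> \<A> X x v v > 0" if "v \<noteq> (\<lambda>c. 0)"
  proof -
    have "v c \<noteq> 0"
    proof
      assume "v c = 0"
      then have "v = coord_vec \<A> c x (0 *\<^sub>R 0 + 0 *\<^sub>R 0)" using tangent_eq_coord_vec[OF c v] by simp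
      then show False using that unfolding coord_vec_linear[OF c] by (simp add: tlin_def)
    qed
    then show ?thesis using pos_formD(3)[OF g[OF p]] by (simp add: ind v)
  qed
  fix v' a b assume v': "v' \<in> tangent_space \<A> x"
  have x: "x \<in> topspace S" using c topspace_eq by blast
  note lin = bilinear_linear(1)[OF pos_formD(1)[OF g[OF p]]]
  show "induced_metric \<epsilon> \<A> X x (tlin a v b v') w = a * induced_metric \<epsilon> \<A> X x v w + b * induced_metric \<epsilon> \<A> X x v' w"
    unfolding ind[OF tlin_tangent[OF x v v'] w] ind[OF v w] ind[OF v' w]
    by (simp add: tlin_def linear_add[OF lin] linear_scale[OF lin])
qed

text \<open>Continuity of \<open>frame_det\<close> makes the points whose tangent plane lies in a
  given graph chart an open set, on which the chart computations apply.\<close>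

lemma chart_domain:
  fixes X :: "'a \<Rightarrow> real^('n + 'k::finite)"
  assumes e: "\<epsilon> = 1 \<or> \<epsilon> = -1" and X: "immersion \<epsilon> \<A> X" and c: "c \<in> \<A>" and b: "b \<in> gcharts \<epsilon>"
  defines "V \<equiv> {q \<in> cimage c. frame_det \<epsilon> b (Dd (patch X c) q) > 0}"
  shows "open V" "local_immersion_chart \<epsilon> V (patch X c) b"
    "\<And>q. q \<in> V \<Longrightarrow> gcoord b (gauss_map \<A> X (cinv c q)) = frame_coord \<epsilon> b (Dd (patch X c) q)"
proof -
  interpret li: local_immersion \<epsilon> "cimage c" "patch X c" by (rule immersion_local[OF e X c])
  have "continuous_on (cimage c) (\<lambda>q. frame_det \<epsilon> b (Dd (patch X c) q))"
    by (intro smooth_on_continuous smooth_on_frame_coord(1)[OF thick_open[OF chart(2)[OF c]]] li.smooth_Y1)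
  from continuous_open_preimage[OF this chart(2)[OF c] open_greaterThan, of 0]
  show V: "open V" by (simp add: V_def vimage_def Int_def greaterThan_def)
  have sub: "V \<subseteq> cimage c" by (auto simp: V_def)
  show "local_immersion_chart \<epsilon> V (patch X c) b"
    by unfold_locales (use e V b li.fr smooth_on_open_subset[OF li.Y V sub] in \<open>auto simp: V_def\<close>)
  fix q assume q: "q \<in> V"
  then have "q \<in> cimage c" using sub by blast
  then have "gauss_map \<A> X (cinv c q) = oriented_span (Dd (patch X c) q)"
    using gauss_map_chart[OF X c cinv_mem] by (simp only: cinv_right)
  then show "gcoord b (gauss_map \<A> X (cinv c q)) = frame_coord \<epsilon> b (Dd (patch X c) q)"
    using frame_span_chart(5)[OF e b li.fr, of q] q by (simp add: V_def)
qed

lemma gdom_gauss_map: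
  fixes X :: "'a \<Rightarrow> real^('n + 'k::finite)"
  assumes e: "\<epsilon> = 1 \<or> \<epsilon> = -1" and X: "immersion \<epsilon> \<A> X" and c: "c \<in> \<A>" "x \<in> fst c"
    and b: "b \<in> gcharts \<epsilon>"
  shows "gauss_map \<A> X x \<in> gdom \<epsilon> b \<longleftrightarrow> frame_det \<epsilon> b (Dd (patch X c) (snd c x)) > 0"
proof -
  have f: "frame \<epsilon> (Dd (patch X c) (snd c x))" using frame_immersion[OF X c(1)] c by blast
  show ?thesis
    using gdom_frame_det[OF e b f] frame_span_chart(6)[OF e b f] by (auto simp: gauss_map_chart[OF X c])
qed

text \<open>The definition uses an unspecified graph chart around the plane. One exists by
  \<open>chart_exists\<close>, and \<open>ghom_Dd_L\<close> gives the same answer in each of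
  them.\<close>

lemma grass_diff_gauss:
  fixes X :: "'a \<Rightarrow> real^('n + 'k::finite)"
  assumes e: "\<epsilon> = 1 \<or> \<epsilon> = -1" and X: "immersion \<epsilon> \<A> X" and c: "c \<in> \<A>" "x \<in> fst c" and v: "v \<in> tangent_space \<A> x"
  shows "grass_diff \<epsilon> \<A> (gauss_map \<A> X) x v (Dd (patch X c) (snd c x) w) =
    second_fund \<epsilon> (patch X c) (snd c x) (v c) w"
proof -
  let ?p = "snd c x"
  have p: "?p \<in> cimage c" using c by blast
  define b where "b = (SOME b. b \<in> gcharts \<epsilon> \<and> gauss_map \<A> X x \<in> gdom \<epsilon> b)"
  have "\<exists>b. b \<in> gcharts \<epsilon> \<and> gauss_map \<A> X x \<in> gdom \<epsilon> b"
    using chart_exists[OF e frame_immersion[OF X c(1) p]] unfolding gauss_map_chart[OF X c] by blast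
  then have b: "b \<in> gcharts \<epsilon>" "gauss_map \<A> X x \<in> gdom \<epsilon> b"
    unfolding b_def using someI_ex[of "\<lambda>b. b \<in> gcharts \<epsilon> \<and> gauss_map \<A> X x \<in> gdom \<epsilon> b"] by auto
  define V where "V = {q \<in> cimage c. frame_det \<epsilon> b (Dd (patch X c) q) > 0}"
  have V: "open V" and ch: "local_immersion_chart \<epsilon> V (patch X c) b"
    and co: "\<And>q. q \<in> V \<Longrightarrow> gcoord b (gauss_map \<A> X (cinv c q)) = frame_coord \<epsilon> b (Dd (patch X c) q)"
    unfolding V_def by (rule chart_domain[OF e X c(1) b(1)])+
  interpret ch: local_immersion_chart \<epsilon> V "patch X c" b by (rule ch)
  have pV: "?p \<in> V" using gdom_gauss_map[OF e X c b(1)] b(2) p by (simp add: V_def)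
  let ?f = "\<lambda>y. gcoord b (gauss_map \<A> X y)"
  have f: "(?f \<circ> cinv c) q = ch.L q" if "q \<in> V" for q
    using co[OF that] by (simp add: ch.L_def)
  have "(?f \<circ> cinv c) differentiable (at ?p)"
    by (rule iffD2[OF differentiable_cong_open[OF V pV] ch.diff_L[OF pV]]) (rule f)
  then have "mdiff \<A> ?f x v = Dd (?f \<circ> cinv c) ?p (v c)" by (rule mdiff_chart[OF c v])
  also have "\<dots> = Dd ch.L ?p (v c)" by (rule fun_cong[OF Dd_cong[OF V pV]]) (rule f)
  finally have "mdiff \<A> ?f x v = Dd ch.L ?p (v c)" .
  moreover have "gcoord b (gauss_map \<A> X x) = ch.L ?p" using f[OF pV] by (simp add: cinv_left[OF c])
  ultimately show ?thesis
    using ch.ghom_Dd_L[OF pV, of "v c" w] by (simp add: grass_diff_def Let_def flip: b_def)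
qed

lemma grass_diff_cong:
  assumes "\<And>y. y \<in> topspace S \<Longrightarrow> \<rho> y = \<sigma> y" and x: "x \<in> topspace S"
  shows "grass_diff \<epsilon> \<A> \<rho> x = grass_diff \<epsilon> \<A> \<sigma> x"
proof -
  have "mdiff \<A> (\<lambda>y. gcoord b (\<rho> y)) x = mdiff \<A> (\<lambda>y. gcoord b (\<sigma> y)) x" for b
    by (rule mdiff_cong[OF _ x]) (simp add: assms(1))
  then show ?thesis unfolding grass_diff_def by (simp only: assms(1)[OF x])
qed

lemma pullback_gauss:
  fixes X :: "'a \<Rightarrow> real^('n + 'k::finite)"
  assumes e: "\<epsilon> = 1 \<or> \<epsilon> = -1" and X: "immersion \<epsilon> \<A> X" and c: "c \<in> \<A>" "x \<in> fst c"
  shows "loc_metric \<A> c (pullback_grass \<epsilon> \<A> (gauss_map \<A> X)) (snd c x) u v =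
    \<epsilon> * tr_metric (pull_form \<epsilon> (Dd (patch X c) (snd c x)))
      (\<lambda>a b. flat_form \<epsilon> (second_fund \<epsilon> (patch X c) (snd c x) u a) (second_fund \<epsilon> (patch X c) (snd c x) v b))"
proof -
  interpret li: local_immersion \<epsilon> "cimage c" "patch X c" by (rule immersion_local[OF e X c(1)])
  let ?p = "snd c x"
  have p: "?p \<in> cimage c" using c by blast
  note lin = bilinear_linear(2)[OF li.bilinear_A[OF p]]
  note gd = grass_diff_gauss[OF e X c coord_vec_tangent(1)[OF c], unfolded coord_vec_tangent(2)[OF c]]
  show ?thesis
    unfolding loc_metric_def cinv_left[OF c] pullback_grass_def subspace_gauss_map[OF X c]
    by (subst grass_metric_frame[OF e li.fr[OF p]]) (simp_all only: gd lin)
qed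

end

text \<open>Allows comparing two matrices only on the vectors
  \<open>pF \<epsilon> b (f w)\<close>.\<close>

lemma frame_det_surj:
  assumes f: "linear f" and d: "frame_det \<epsilon> b f \<noteq> 0"
  obtains w where "y = pF \<epsilon> b (f w)"
proof -
  let ?A = "matrix (\<lambda>u. pF \<epsilon> b (f u))"
  have "linear (\<lambda>u. pF \<epsilon> b (f u))" using linear_compose[OF f linear_pF] by (simp add: o_def)
  then have "?A *v w = pF \<epsilon> b (f w)" for w by (rule matrix_of_linear)
  moreover have "?A *v (matrix_inv ?A *v y) = y"
    using matrix_inv_mult_right[OF d[unfolded frame_det_def]] by (simp add: matrix_vector_mul_assoc)
  ultimately show thesis using that by metis
qed

section \<open>Mean curvature flow induces harmonic-Ricci flow\<close>

locale mcf_flow = oriented_atlas S \<A>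
  for S :: "'a topology" and \<A> :: "('a, 'n::finite) chart set" +
  fixes \<epsilon> :: real and I :: "real set" and X0 :: "'a \<Rightarrow> real^('n + 'k::finite)"
    and X :: "real \<Rightarrow> 'a \<Rightarrow> real^('n + 'k)"
  assumes e: "\<epsilon> = 1 \<or> \<epsilon> = -1" and I: "right_open I" and MCF: "MCF_solution \<epsilon> \<A> I X0 X"
begin

abbreviation Y where "Y c t \<equiv> patch (X t) c"
abbreviation G where "G c t p \<equiv> pull_form \<epsilon> (Dd (Y c t) p)"
abbreviation Hc where "Hc c t q \<equiv> mean_curvature \<epsilon> \<A> c (X t) (cinv c q)"

lemma imm: "t \<in> I \<Longrightarrow> immersion \<epsilon> \<A> (X t)"
  using MCF by (simp add: MCF_solution_def)

lemma local_imm: "c \<in> \<A> \<Longrightarrow> t \<in> I \<Longrightarrow> local_immersion \<epsilon> (cimage c) (Y c t)"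
  by (rule immersion_local[OF e imm])

lemma thick_space_time: "c \<in> \<A> \<Longrightarrow> thick (cimage c \<times> I)"
  by (intro thick_Times thick_open chart(2) thick_right_open I)

lemma smooth_Y: "c \<in> \<A> \<Longrightarrow> smooth_on (cimage c \<times> I) (\<lambda>(p, t). Y c t p)"
  using MCF by (simp add: MCF_solution_def patch_def)

lemma smooth_DY:
  assumes c: "c \<in> \<A>" shows "smooth_on (cimage c \<times> I) (\<lambda>(p, t). Dd (Y c t) p v)"
  using smooth_on_space_derivative[OF chart(2)[OF c] smooth_Y[OF c], of v] by simp

lemma mean_curvature_H:
  assumes c: "c \<in> \<A>" and t: "t \<in> I" and q: "q \<in> cimage c"
  shows "Hc c t q = tr_metric (G c t q) (second_fund \<epsilon> (Y c t) q)"
  unfolding mean_curvature_def cinv_right[OF q] loc_metric_induced[OF imm[OF t] c q] comp_cinv ..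

lemma Y_velocity:
  assumes c: "c \<in> \<A>" and t: "t \<in> I" and q: "q \<in> cimage c"
  shows "((\<lambda>s. Y c s q) has_vector_derivative Hc c t q) (at t within I)"
  using MCF c t cinv_mem[OF q] unfolding MCF_solution_def patch_def by blast

text \<open>Exchange of space and time derivatives: the differential of the immersion moves with the
  differential of the mean curvature vector, which is thereby seen to be differentiable in
  space.\<close>

lemma DY_velocity:
  assumes c: "c \<in> \<A>" and t: "t \<in> I" and p: "p \<in> cimage c"
  shows "Hc c t differentiable (at p)"
    and "((\<lambda>s. Dd (Y c s) p v) has_vector_derivative Dd (Hc c t) p v) (at t within I)"
  using space_time_commute[OF chart(2)[OF c] I smooth_Y[OF c] p t, of "Hc c t"] Y_velocity[OF c t] by simp_all

lemma pull_form_velocity: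
  assumes c: "c \<in> \<A>" and t: "t \<in> I" and p: "p \<in> cimage c"
  shows "((\<lambda>s. G c s p u v) has_vector_derivative
    - 2 * flat_form \<epsilon> (Hc c t p) (second_fund \<epsilon> (Y c t) p u v)) (at t within I)"
proof -
  interpret li: local_immersion \<epsilon> "cimage c" "Y c t" by (rule local_imm[OF c t])
  have h: "Hc c t q = li.H q" if "q \<in> cimage c" for q by (simp only: mean_curvature_H[OF c t that] li.H_def)
  have "((\<lambda>s. G c s p u v) has_vector_derivative
      flat_form \<epsilon> (Dd (Y c t) p u) (Dd (Hc c t) p v) + flat_form \<epsilon> (Dd (Hc c t) p u) (Dd (Y c t) p v)) (at t within I)"
    unfolding pull_form_def
    by (rule bounded_bilinear.has_vector_derivative[OF bounded_bilinear_flat_form DY_velocity(2)[OF c t p] DY_velocity(2)[OF c t p]])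
  moreover have "flat_form \<epsilon> (Dd (Hc c t) p a) (Dd (Y c t) p b) = - flat_form \<epsilon> (Hc c t p) (second_fund \<epsilon> (Y c t) p a b)" for a b
    unfolding h[OF p] by (rule li.metric_velocity[OF p h DY_velocity(1)[OF c t p]])
  ultimately show ?thesis
    using li.A_sym[OF p, of v u] flat_form_sym[of \<epsilon> "Dd (Y c t) p u"] by simp
qed

lemma smooth_metric_family_induced: "smooth_metric_family \<A> I (\<lambda>t. induced_metric \<epsilon> \<A> (X t))"
  unfolding smooth_metric_family_def
proof (intro ballI conjI allI)
  show "metric_at \<A> (induced_metric \<epsilon> \<A> (X t)) x" if "c \<in> \<A>" "t \<in> I" "x \<in> fst c" for c t x
    by (rule metric_at_induced[OF e imm[OF that(2)] that(1,3)])
  fix c u v assume c: "c \<in> \<A>"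
  have "smooth_on (cimage c \<times> I) (\<lambda>z. flat_form \<epsilon> (case z of (p, t) \<Rightarrow> Dd (Y c t) p u) (case z of (p, t) \<Rightarrow> Dd (Y c t) p v))"
    by (rule smooth_on_bilinear[OF thick_space_time[OF c] bounded_bilinear_flat_form smooth_DY[OF c] smooth_DY[OF c]])
  moreover have "smooth_on (cimage c \<times> I) (\<lambda>z. flat_form \<epsilon> (case z of (p, t) \<Rightarrow> Dd (Y c t) p u) (case z of (p, t) \<Rightarrow> Dd (Y c t) p v))
     \<longleftrightarrow> smooth_on (cimage c \<times> I) (\<lambda>(p, t). loc_metric \<A> c (induced_metric \<epsilon> \<A> (X t)) p u v)"
  proof (rule smooth_on_cong)
    fix z assume "z \<in> cimage c \<times> I"
    then obtain p t where z: "z = (p, t)" "p \<in> cimage c" "t \<in> I" by (cases z) auto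
    show "flat_form \<epsilon> (case z of (p, t) \<Rightarrow> Dd (Y c t) p u) (case z of (p, t) \<Rightarrow> Dd (Y c t) p v) =
        (case z of (p, t) \<Rightarrow> loc_metric \<A> c (induced_metric \<epsilon> \<A> (X t)) p u v)"
      by (simp only: z(1) prod.case loc_metric_induced[OF imm[OF z(3)] c z(2)] pull_form_def)
  qed
  ultimately show "smooth_on (cimage c \<times> I) (\<lambda>(p, t). loc_metric \<A> c (induced_metric \<epsilon> \<A> (X t)) p u v)" by simp
qed

text \<open>Positivity of \<open>frame_det\<close> is relatively open in space-time, so one graph
  chart serves for nearby points and nearby times together.\<close>

lemma gauss_neighbourhood:
  assumes c: "c \<in> \<A>" "x \<in> fst c" and t: "t \<in> I" and b: "b \<in> gcharts \<epsilon>" and g: "gauss_map \<A> (X t) x \<in> gdom \<epsilon> b"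
  obtains W where "open W" "(snd c x, t) \<in> W"
    "\<And>p s. (p, s) \<in> W \<Longrightarrow> p \<in> cimage c \<Longrightarrow> s \<in> I \<Longrightarrow> frame_det \<epsilon> b (Dd (Y c s) p) > 0 \<and>
      gauss_map \<A> (X s) (cinv c p) \<in> gdom \<epsilon> b \<and> gcoord b (gauss_map \<A> (X s) (cinv c p)) = frame_coord \<epsilon> b (Dd (Y c s) p)"
    "smooth_on (W \<inter> cimage c \<times> I) (\<lambda>(p, s). frame_coord \<epsilon> b (Dd (Y c s) p))"
proof -
  let ?S = "cimage c \<times> I"
  let ?f = "\<lambda>z u. case z of (p, s) \<Rightarrow> Dd (Y c s) p u"
  have "continuous_on ?S (\<lambda>z. frame_det \<epsilon> b (?f z))"
    by (rule smooth_on_continuous[OF smooth_on_frame_coord(1)[OF thick_space_time[OF c(1)] smooth_DY[OF c(1)]]])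
  from continuous_openin_preimage_gen[OF this open_greaterThan, of 0]
  obtain W where W: "open W" "?S \<inter> (\<lambda>z. frame_det \<epsilon> b (?f z)) -` {0<..} = ?S \<inter> W"
    by (auto simp: openin_open)
  have det: "frame_det \<epsilon> b (Dd (Y c s) p) > 0 \<longleftrightarrow> (p, s) \<in> W" if "p \<in> cimage c" "s \<in> I" for p s
  proof -
    have "(p, s) \<in> ?S \<inter> (\<lambda>z. frame_det \<epsilon> b (?f z)) -` {0<..} \<longleftrightarrow> (p, s) \<in> ?S \<inter> W" by (simp only: W(2))
    then show ?thesis using that by (simp add: case_prod_beta)
  qed
  show thesis
  proof (rule that[OF W(1)])
    show "(snd c x, t) \<in> W"
      using gdom_gauss_map[OF e imm[OF t] c b] g det[of "snd c x" t] c t by blast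
    fix p s assume ps: "(p, s) \<in> W" "p \<in> cimage c" "s \<in> I"
    then have d: "frame_det \<epsilon> b (Dd (Y c s) p) > 0" using det by blast
    have gm: "gauss_map \<A> (X s) (cinv c p) = oriented_span (Dd (Y c s) p)"
      using gauss_map_chart[OF imm[OF ps(3)] c(1) cinv_mem[OF ps(2)]] by (simp only: cinv_right[OF ps(2)])
    note fs = frame_span_chart(5,6)[OF e b frame_immersion[OF imm[OF ps(3)] c(1) ps(2)] d]
    show "frame_det \<epsilon> b (Dd (Y c s) p) > 0 \<and> gauss_map \<A> (X s) (cinv c p) \<in> gdom \<epsilon> b \<and>
      gcoord b (gauss_map \<A> (X s) (cinv c p)) = frame_coord \<epsilon> b (Dd (Y c s) p)"
      unfolding gm using d fs by blast
  next
    have "smooth_on (W \<inter> ?S) (\<lambda>z. frame_coord \<epsilon> b (?f z))"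
    proof (rule smooth_on_frame_coord(2)[OF thick_Int_open[OF thick_space_time[OF c(1)] W(1)]])
      show "smooth_on (W \<inter> ?S) (\<lambda>z. ?f z u)" for u
        by (rule smooth_on_Int_open[OF smooth_DY[OF c(1)] W(1)])
      fix z assume z: "z \<in> W \<inter> ?S"
      obtain p s where ps: "z = (p, s)" by (cases z)
      then show "frame_det \<epsilon> b (?f z) \<noteq> 0" using det[of p s] z by force
    qed
    then show "smooth_on (W \<inter> ?S) (\<lambda>(p, s). frame_coord \<epsilon> b (Dd (Y c s) p))"
      by (simp add: case_prod_unfold)
  qed
qed

lemma smooth_grass_family_gauss: "smooth_grass_family \<epsilon> \<A> I (\<lambda>t. gauss_map \<A> (X t))"
  unfolding smooth_grass_family_def
proof (intro ballI conjI impI)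
  fix c x t assume c: "c \<in> \<A>" "x \<in> fst c" and t: "t \<in> I"
  have "frame \<epsilon> (Dd (Y c t) (snd c x))" using frame_immersion[OF imm[OF t] c(1)] c(2) by blast
  then show "gauss_map \<A> (X t) x \<in> grassmannian \<epsilon>"
    unfolding gauss_map_chart[OF imm[OF t] c] grassmannian_def by blast
  fix b assume b: "b \<in> gcharts \<epsilon>" and g: "gauss_map \<A> (X t) x \<in> gdom \<epsilon> b"
  obtain W where W: "open W" "(snd c x, t) \<in> W"
    "\<And>p s. (p, s) \<in> W \<Longrightarrow> p \<in> cimage c \<Longrightarrow> s \<in> I \<Longrightarrow> frame_det \<epsilon> b (Dd (Y c s) p) > 0 \<and>
      gauss_map \<A> (X s) (cinv c p) \<in> gdom \<epsilon> b \<and> gcoord b (gauss_map \<A> (X s) (cinv c p)) = frame_coord \<epsilon> b (Dd (Y c s) p)"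
    "smooth_on (W \<inter> cimage c \<times> I) (\<lambda>(p, s). frame_coord \<epsilon> b (Dd (Y c s) p))"
    using gauss_neighbourhood[OF c t b g] by blast
  have "smooth_on (W \<inter> cimage c \<times> I) (\<lambda>(p, s). frame_coord \<epsilon> b (Dd (Y c s) p)) \<longleftrightarrow>
     smooth_on (W \<inter> cimage c \<times> I) (\<lambda>(p, s). gcoord b (gauss_map \<A> (X s) (cinv c p)))"
    using W(3) by (intro smooth_on_cong) auto
  then show "\<exists>W. open W \<and> (snd c x, t) \<in> W \<and>
             (\<forall>(p, s)\<in>W \<inter> cimage c \<times> I. gauss_map \<A> (X s) (cinv c p) \<in> gdom \<epsilon> b) \<and>
             smooth_on (W \<inter> cimage c \<times> I) (\<lambda>(p, s). gcoord b (gauss_map \<A> (X s) (cinv c p)))"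
    using W by (intro exI[of _ W]) auto
qed

lemma gauss_map_velocity:
  assumes c: "c \<in> \<A>" "x \<in> fst c" and t: "t \<in> I" and b: "b \<in> gcharts \<epsilon>" and g: "gauss_map \<A> (X t) x \<in> gdom \<epsilon> b"
  shows "((\<lambda>s. gcoord b (gauss_map \<A> (X s) x)) has_vector_derivative
     tension (gmetric \<epsilon> b) (loc_metric \<A> c (induced_metric \<epsilon> \<A> (X t)))
       (\<lambda>p. gcoord b (gauss_map \<A> (X t) (cinv c p))) (snd c x)) (at t within I)"
proof -
  define p where "p = snd c x"
  have p: "p \<in> cimage c" using c(2) by (auto simp: p_def)
  have px: "cinv c p = x" using cinv_left[OF c] by (simp add: p_def)
  obtain W where W: "open W" "(p, t) \<in> W"
    "\<And>p s. (p, s) \<in> W \<Longrightarrow> p \<in> cimage c \<Longrightarrow> s \<in> I \<Longrightarrow> frame_det \<epsilon> b (Dd (Y c s) p) > 0 \<and>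
      gauss_map \<A> (X s) (cinv c p) \<in> gdom \<epsilon> b \<and> gcoord b (gauss_map \<A> (X s) (cinv c p)) = frame_coord \<epsilon> b (Dd (Y c s) p)"
    "smooth_on (W \<inter> cimage c \<times> I) (\<lambda>(p, s). frame_coord \<epsilon> b (Dd (Y c s) p))"
    using gauss_neighbourhood[OF c t b g] unfolding p_def by blast
  obtain r where r: "r > 0" "ball (p, t) r \<subseteq> W" using W(1,2) by (meson open_contains_ball)
  have near: "(p, s) \<in> W" if "dist s t < r" for s
  proof -
    have "(p, s) \<in> ball (p, t) r" using that by (simp add: dist_Pair_Pair dist_commute)
    then show ?thesis using r(2) by blast
  qed
  let ?F = "\<lambda>s. frame_coord \<epsilon> b (Dd (Y c s) p)"
  \<comment> \<open>Joint smoothness supplies a velocity \<open>D (0, 1)\<close> of the coordinate;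
    its value is identified afterwards.\<close>
  have "((\<lambda>(p, s). frame_coord \<epsilon> b (Dd (Y c s) p)) has_derivative
      frechet_derivative (\<lambda>(p, s). frame_coord \<epsilon> b (Dd (Y c s) p)) (at (p, t) within W \<inter> cimage c \<times> I))
      (at (p, t) within W \<inter> cimage c \<times> I)"
    using W(2) p t by (intro smooth_on_has_derivative[OF W(4)]) auto
  then have "\<exists>D. ((\<lambda>(p, s). frame_coord \<epsilon> b (Dd (Y c s) p)) has_derivative D) (at (p, t) within cimage c \<times> I)"
    unfolding at_within_Int_open[OF W(1,2)] by blast
  then obtain D where "((\<lambda>(p, s). frame_coord \<epsilon> b (Dd (Y c s) p)) has_derivative D) (at (p, t) within cimage c \<times> I)" ..
  from has_derivative_slice_time[OF this p]
  have F: "(?F has_vector_derivative D (0, 1)) (at t within I)" by simp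
  then have gc: "((\<lambda>s. gcoord b (gauss_map \<A> (X s) x)) has_vector_derivative D (0, 1)) (at t within I)"
    by (rule has_vector_derivative_transform_within[OF _ r(1) t]) (use W(3)[OF near p] px in simp)
  define V where "V = {q \<in> cimage c. frame_det \<epsilon> b (Dd (patch (X t) c) q) > 0}"
  have V: "open V" and ch: "local_immersion_chart \<epsilon> V (Y c t) b"
    and co: "\<And>q. q \<in> V \<Longrightarrow> gcoord b (gauss_map \<A> (X t) (cinv c q)) = frame_coord \<epsilon> b (Dd (Y c t) q)"
    unfolding V_def by (rule chart_domain[OF e imm[OF t] c(1) b])+
  interpret ch: local_immersion_chart \<epsilon> V "Y c t" b by (rule ch)
  have VU: "q \<in> cimage c" if "q \<in> V" for q using that by (simp add: V_def)
  have pV: "p \<in> V" using W(3)[OF W(2) p t] p by (simp add: V_def)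
  have h: "Hc c t q = ch.H q" if "q \<in> V" for q
    by (simp only: mean_curvature_H[OF c(1) t VU[OF that]] ch.H_def)
  have tens: "tension (gmetric \<epsilon> b) (loc_metric \<A> c (induced_metric \<epsilon> \<A> (X t)))
       (\<lambda>p. gcoord b (gauss_map \<A> (X t) (cinv c p))) p = tension (gmetric \<epsilon> b) ch.G ch.L p"
    using loc_metric_induced[OF imm[OF t] c(1) VU] co by (intro tension_cong[OF V pV]) (simp_all add: ch.L_def)
  \<comment> \<open>Differentiating in time the relation that the coordinate maps the
    \<open>pF\<close> part of the frame to its \<open>pN\<close> part leaves the defect of the
    derivative of \<open>H\<close>, which \<open>tension_L\<close> identifies.\<close>
  have "D (0, 1) *v pF \<epsilon> b (Dd (Y c t) p w) = tension (gmetric \<epsilon> b) ch.G ch.L p *v pF \<epsilon> b (Dd (Y c t) p w)" for w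
  proof -
    note DY = DY_velocity(2)[OF c(1) t p, of w]
    note dF = bounded_linear.has_vector_derivative[OF ch.bounded_linear_pFN(1) DY]
    note dN = bounded_linear.has_vector_derivative[OF ch.bounded_linear_pFN(2) DY]
    have "((\<lambda>s. ?F s *v pF \<epsilon> b (Dd (Y c s) p w)) has_vector_derivative
        ?F t *v pF \<epsilon> b (Dd (Hc c t) p w) + D (0, 1) *v pF \<epsilon> b (Dd (Y c t) p w)) (at t within I)"
      by (rule bounded_bilinear.has_vector_derivative[OF bounded_bilinear_matrix_vector F dF])
    then have "((\<lambda>s. pN \<epsilon> b (Dd (Y c s) p w)) has_vector_derivative
        ?F t *v pF \<epsilon> b (Dd (Hc c t) p w) + D (0, 1) *v pF \<epsilon> b (Dd (Y c t) p w)) (at t within I)"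
    proof (rule has_vector_derivative_transform_within[OF _ r(1) t])
      fix s assume s: "s \<in> I" "dist s t < r"
      then have "frame_det \<epsilon> b (Dd (Y c s) p) \<noteq> 0" using W(3)[OF near p] by force
      then show "?F s *v pF \<epsilon> b (Dd (Y c s) p w) = pN \<epsilon> b (Dd (Y c s) p w)"
        by (rule frame_coord_works[OF frame_linear[OF frame_immersion[OF imm[OF s(1)] c(1) p]]])
    qed
    from vector_derivative_unique_within[OF right_open_not_bot[OF I t] this dN]
    have "D (0, 1) *v pF \<epsilon> b (Dd (Y c t) p w) = ch.lam p (Dd (Hc c t) p w)"
      by (simp add: graph_defect_def ch.L_def algebra_simps)
    then show ?thesis using ch.tension_L[OF pV h DY_velocity(1)[OF c(1) t p]] by simp
  qed
  \<comment> \<open>The vectors \<open>pF \<epsilon> b (Dd (Y c t) p w)\<close> exhaust the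
    coordinate space, so the two matrices are equal.\<close>
  moreover have "\<exists>w. y = pF \<epsilon> b (Dd (Y c t) p w)" for y
    using frame_det_surj[OF ch.linear_Y1[OF pV], of \<epsilon> b y] ch.fd[OF pV] by (metis less_irrefl)
  ultimately have "D (0, 1) *v y = tension (gmetric \<epsilon> b) ch.G ch.L p *v y" for y by metis
  then have "D (0, 1) = tension (gmetric \<epsilon> b) ch.G ch.L p" by (simp add: matrix_eq)
  then show ?thesis using gc tens by (simp add: p_def)
qed

lemma loc_metric_velocity:
  assumes c: "c \<in> \<A>" "x \<in> fst c" and t: "t \<in> I"
  shows "((\<lambda>s. loc_metric \<A> c (induced_metric \<epsilon> \<A> (X s)) (snd c x) u v) has_real_derivative
           - 2 * ricci (loc_metric \<A> c (induced_metric \<epsilon> \<A> (X t))) (snd c x) u v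
           + 2 * (- \<epsilon>) * loc_metric \<A> c (pullback_grass \<epsilon> \<A> (gauss_map \<A> (X t))) (snd c x) u v)
        (at t within I)"
proof -
  interpret li: local_immersion \<epsilon> "cimage c" "Y c t" by (rule local_imm[OF c(1) t])
  have p: "snd c x \<in> cimage c" using c(2) by blast
  have "((\<lambda>s. loc_metric \<A> c (induced_metric \<epsilon> \<A> (X s)) (snd c x) u v) has_vector_derivative
    - 2 * flat_form \<epsilon> (Hc c t (snd c x)) (second_fund \<epsilon> (Y c t) (snd c x) u v)) (at t within I)"
    using pull_form_velocity[OF c(1) t p, of u v]
    by (rule has_vector_derivative_transform[OF t, rotated]) (simp only: loc_metric_induced[OF imm c(1) p])
  moreover have "ricci (loc_metric \<A> c (induced_metric \<epsilon> \<A> (X t))) (snd c x) = ricci li.G (snd c x)"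
    by (rule ricci_cong[OF li.U p]) (rule loc_metric_induced[OF imm[OF t] c(1)])
  moreover have "Hc c t (snd c x) = li.H (snd c x)" by (simp only: mean_curvature_H[OF c(1) t p] li.H_def)
  \<comment> \<open>The pullback carries a factor \<open>\<epsilon>\<close> and the coupling is
    \<open>- \<epsilon>\<close>; as \<open>\<epsilon> * \<epsilon> = 1\<close>, the quadratic trace
    in the Ricci formula cancels and \<open>-2\<close> times the product of \<open>H\<close> and
    \<open>A\<close> remains.\<close>
  ultimately show ?thesis
    using e unfolding has_real_derivative_iff_has_vector_derivative
    by (auto simp: pullback_gauss[OF e imm[OF t] c] li.ricci_formula[OF p] flat_form_sym[of _ "li.H _"])
qed

lemma initial: "x \<in> topspace S \<Longrightarrow> X 0 x = X0 x"
  using MCF chart_at[of x] unfolding MCF_solution_def by blast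

theorem HRF_of_MCF:
  "HRF_solution \<epsilon> (- \<epsilon>) \<A> I (gauss_map \<A> X0) (induced_metric \<epsilon> \<A> X0)
    (\<lambda>t. gauss_map \<A> (X t)) (\<lambda>t. induced_metric \<epsilon> \<A> (X t))"
  unfolding HRF_solution_def
proof (intro conjI ballI allI impI)
  fix c x assume c: "c \<in> \<A>" "x \<in> fst c"
  then have x: "x \<in> topspace S" using topspace_eq by blast
  show "gauss_map \<A> (X 0) x = gauss_map \<A> X0 x"
    by (simp add: gauss_map_def mdiff_cong[OF initial x])
  show "induced_metric \<epsilon> \<A> (X 0) x v w = induced_metric \<epsilon> \<A> X0 x v w" for v w
    by (simp add: induced_metric_def mdiff_cong[OF initial x])
qed (rule smooth_metric_family_induced smooth_grass_family_gauss gauss_map_velocity loc_metric_velocity | assumption)+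

end

section \<open>Reconstruction of the immersion by parallel transport in time\<close>

text \<open>Agreement is required at points of the space and on tangent vectors only, since
  elsewhere the functions may have arbitrary values.\<close>

locale mcf_hrf = mcf_flow S \<A> \<epsilon> I X0 X
  for S :: "'a topology" and \<A> :: "('a, 'n::finite) chart set" and \<epsilon> I
    and X0 :: "'a \<Rightarrow> real^('n + 'k::finite)" and X +
  fixes \<rho> :: "real \<Rightarrow> 'a \<Rightarrow> ('n, 'k) osub" and g :: "real \<Rightarrow> ('a, 'n) mmetric"
  assumes interval: "is_interval I" "0 \<in> I" "I \<subseteq> {0..}"
    and rho: "\<And>t x. t \<in> I \<Longrightarrow> x \<in> topspace S \<Longrightarrow> \<rho> t x = gauss_map \<A> (X t) x"
    and g: "\<And>t x v w. t \<in> I \<Longrightarrow> x \<in> topspace S \<Longrightarrow> v \<in> tangent_space \<A> x \<Longrightarrow> w \<in> tangent_space \<A> x \<Longrightarrow>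
      g t x v w = induced_metric \<epsilon> \<A> (X t) x v w"
begin

lemma chart_top: "c \<in> \<A> \<Longrightarrow> x \<in> fst c \<Longrightarrow> x \<in> topspace S"
  using topspace_eq by blast

lemma chart_image: "x \<in> fst c \<Longrightarrow> snd c x \<in> cimage c"
  by blast

lemma frame_Y: "c \<in> \<A> \<Longrightarrow> x \<in> fst c \<Longrightarrow> t \<in> I \<Longrightarrow> frame \<epsilon> (Dd (Y c t) (snd c x))"
  by (rule frame_immersion[OF imm _ chart_image])

lemma pos_G: "c \<in> \<A> \<Longrightarrow> x \<in> fst c \<Longrightarrow> t \<in> I \<Longrightarrow> pos_form (G c t (snd c x))"
  by (rule pos_form_frame[OF e frame_Y])

lemma g_chart:
  assumes c: "c \<in> \<A>" "x \<in> fst c" and t: "t \<in> I" and v: "v \<in> tangent_space \<A> x" "w \<in> tangent_space \<A> x"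
  shows "g t x v w = G c t (snd c x) (v c) (w c)"
  by (simp only: g[OF t chart_top[OF c] v] induced_metric_chart[OF imm[OF t] c v])

lemma loc_metric_g:
  assumes c: "c \<in> \<A>" "x \<in> fst c" and t: "t \<in> I"
  shows "loc_metric \<A> c (g t) (snd c x) = G c t (snd c x)"
  by (intro ext) (simp only: loc_metric_def cinv_left[OF c] g_chart[OF c t] coord_vec_tangent[OF c])

lemma subspace_rho:
  "c \<in> \<A> \<Longrightarrow> x \<in> fst c \<Longrightarrow> t \<in> I \<Longrightarrow> subspace_of (\<rho> t x) = range (Dd (Y c t) (snd c x))"
  by (simp only: rho chart_top subspace_gauss_map[OF imm])

text \<open>The matrix \<open>-1/2\<close> times the inverse metric times the time derivative of the
  metric, so that intrinsic parallelism is the linear system with this coefficient.\<close>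

definition transport :: "('a, 'n) chart \<Rightarrow> 'a \<Rightarrow> real \<Rightarrow> real^'n^'n" where
  "transport c x t = inv_metric (G c t (snd c x)) **
    (\<chi> l i. - (1/2) * vector_derivative (\<lambda>s. G c s (snd c x) (axis i 1) (axis l 1)) (at t within I))"

lemma transport_eq:
  assumes c: "c \<in> \<A>" "x \<in> fst c" and t: "t \<in> I"
  shows "(\<chi> j. - (1/2) * (\<Sum>l\<in>UNIV. \<Sum>i\<in>UNIV. inv_metric (loc_metric \<A> c (g t) (snd c x)) $ j $ l
           * vector_derivative (\<lambda>s. loc_metric \<A> c (g s) (snd c x) (axis i 1) (axis l 1)) (at t within I) * y $ i)) =
    transport c x t *v y"
proof -
  let ?vd = "\<lambda>h i l. vector_derivative (\<lambda>s. h s (axis i 1) (axis l 1)) (at t within I)"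
  have vd: "?vd (\<lambda>s. loc_metric \<A> c (g s) (snd c x)) i l = ?vd (\<lambda>s. G c s (snd c x)) i l" for i l
  proof -
    note d = pull_form_velocity[OF c(1) t chart_image[OF c(2)], of "axis i 1" "axis l 1"]
    have "((\<lambda>s. loc_metric \<A> c (g s) (snd c x) (axis i 1) (axis l 1)) has_vector_derivative
      - 2 * flat_form \<epsilon> (Hc c t (snd c x)) (second_fund \<epsilon> (Y c t) (snd c x) (axis i 1) (axis l 1))) (at t within I)"
      using d by (rule has_vector_derivative_transform[OF t, rotated]) (simp only: loc_metric_g[OF c])
    from vector_derivative_within[OF right_open_not_bot[OF I t] this]
      vector_derivative_within[OF right_open_not_bot[OF I t] d] show ?thesis by simp
  qed
  have "transport c x t *v y = inv_metric (G c t (snd c x)) *v (\<chi> l. \<Sum>i\<in>UNIV. - (1/2) * ?vd (\<lambda>s. G c s (snd c x)) i l * y $ i)"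
    unfolding transport_def matrix_vector_mul_assoc[symmetric] by (simp add: matrix_vector_mult_def)
  then show ?thesis
    by (simp add: vd loc_metric_g[OF c t] matrix_vector_mult_def sum_distrib_left sum_negf[symmetric] mult_ac)
qed

text \<open>Since the time derivative of the metric is \<open>-2\<close> times the product of
  \<open>H\<close> and \<open>A\<close>, raising an index turns the coefficient into the shape
  operator in direction \<open>H\<close>.\<close>

lemma transport_form:
  assumes c: "c \<in> \<A>" "x \<in> fst c" and t: "t \<in> I"
  shows "G c t (snd c x) (transport c x t *v y) w =
    flat_form \<epsilon> (Hc c t (snd c x)) (second_fund \<epsilon> (Y c t) (snd c x) y w)"
proof -
  interpret li: local_immersion \<epsilon> "cimage c" "Y c t" by (rule local_imm[OF c(1) t])
  let ?T = "\<lambda>u w. flat_form \<epsilon> (Hc c t (snd c x)) (second_fund \<epsilon> (Y c t) (snd c x) u w)"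
  note p = chart_image[OF c(2)]
  note lA = bilinear_linear[OF li.bilinear_A[OF p]]
  have T: "linear (\<lambda>u. ?T u w)" "linear (?T u)" for u w
    using linear_compose[OF lA(1) linear_flat_form(2)] linear_compose[OF lA(2) linear_flat_form(2)] by (simp_all add: o_def)
  have "vector_derivative (\<lambda>s. G c s (snd c x) u v) (at t within I) = - 2 * ?T u v" for u v
    by (rule vector_derivative_within[OF right_open_not_bot[OF I t] pull_form_velocity[OF c(1) t p]])
  then have "transport c x t *v y = inv_metric (G c t (snd c x)) *v (\<chi> l. \<Sum>i\<in>UNIV. ?T (axis i 1) (axis l 1) * y $ i)"
    unfolding transport_def matrix_vector_mul_assoc[symmetric] by (simp add: matrix_vector_mult_def)
  also have "(\<chi> l. \<Sum>i\<in>UNIV. ?T (axis i 1) (axis l 1) * y $ i) = (\<chi> l. ?T y (axis l 1))"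
    using linear_axis_expand[OF T(1), of y] by (simp add: mult.commute)
  finally show ?thesis
    using pos_form_inv_solve[OF pos_G[OF c t] T(2)] by simp
qed

lemma transport_continuous:
  assumes c: "c \<in> \<A>" "x \<in> fst c"
  shows "continuous_on I (transport c x)"
proof -
  let ?S = "cimage c \<times> I" and ?p = "snd c x"
  note th = thick_space_time[OF c(1)]
  have slice: "continuous_on I (\<lambda>t. f (?p, t))" if "smooth_on ?S f" for f :: "_ \<Rightarrow> 'z::real_normed_vector"
  proof -
    have "continuous_on I (f \<circ> (\<lambda>t. (?p, t)))"
      by (intro continuous_on_compose continuous_intros continuous_on_subset[OF smooth_on_continuous[OF that]])
        (use c in auto)
    then show ?thesis by (simp add: o_def)
  qed
  have G: "smooth_on ?S (\<lambda>z. flat_form \<epsilon> (case z of (p, t) \<Rightarrow> Dd (Y c t) p u) (case z of (p, t) \<Rightarrow> Dd (Y c t) p v))" for u v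
    by (rule smooth_on_bilinear[OF th bounded_bilinear_flat_form smooth_DY[OF c(1)] smooth_DY[OF c(1)]])
  then have G': "smooth_on ?S (\<lambda>z. G c (snd z) (fst z) u v)" for u v
    by (simp add: pull_form_def case_prod_unfold)
  have pos: "pos_form (G c (snd z) (fst z))" if "z \<in> ?S" for z
  proof -
    from that have z: "fst z \<in> cimage c" "snd z \<in> I" by (simp_all only: mem_Times_iff)
    show ?thesis by (rule pos_form_frame[OF e frame_immersion[OF imm[OF z(2)] c(1) z(1)]])
  qed
  have "smooth_on ?S (\<lambda>z. inv_metric (G c (snd z) (fst z)))"
    unfolding inv_metric_def
    by (rule smooth_on_matrix_inv[OF th smooth_on_vec_lambda[OF th smooth_on_vec_lambda[OF th G']] pos_form_det[OF pos]])
  from slice[OF this] have 1: "continuous_on I (\<lambda>t. inv_metric (G c t ?p))" by simp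
  have "continuous_on I (\<lambda>t. vector_derivative (\<lambda>s. G c s ?p u v) (at t within I))" for u v
    using slice[OF smooth_on_time_derivative[OF I G'], of u v] by simp
  then have 2: "continuous_on I (\<lambda>t. \<chi> l i. - (1/2) * vector_derivative (\<lambda>s. G c s ?p (axis i 1) (axis l 1)) (at t within I))"
    by (intro continuous_on_vec_lambda continuous_intros)
  show ?thesis
    unfolding transport_def
    by (rule bounded_bilinear.continuous_on[OF bounded_bilinear_matrix_mult 1 2])
qed

lemma intrinsically_parallel_iff:
  "intrinsically_parallel \<A> I g x v \<longleftrightarrow> (\<forall>t\<in>I. v t \<in> tangent_space \<A> x) \<and>
    (\<forall>c\<in>\<A>. x \<in> fst c \<longrightarrow> (\<forall>t\<in>I. ((\<lambda>s. v s c) has_vector_derivative transport c x t *v v t c) (at t within I)))"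
  unfolding intrinsically_parallel_def using transport_eq by (simp cong: conj_cong)

text \<open>The velocity of the transported vector is normal: the tangential part of \<open>dH(y)\<close> is compensated by the
  intrinsic parallel transport.\<close>

lemma transport_velocity:
  assumes c: "c \<in> \<A>" "x \<in> fst c" and t: "t \<in> I"
    and y: "(y has_vector_derivative transport c x t *v y t) (at t within I)"
  obtains n where "((\<lambda>s. Dd (Y c s) (snd c x) (y s)) has_vector_derivative n) (at t within I)"
    "\<And>w. flat_form \<epsilon> n (Dd (Y c t) (snd c x) w) = 0"
proof -
  interpret li: local_immersion \<epsilon> "cimage c" "Y c t" by (rule local_imm[OF c(1) t])
  let ?p = "snd c x" and ?y' = "transport c x t *v y t"
  note p = chart_image[OF c(2)]
  have h: "Hc c t q = li.H q" if "q \<in> cimage c" for q by (simp only: mean_curvature_H[OF c(1) t that] li.H_def)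
  note dH = DY_velocity(1)[OF c(1) t p]
  note DY = DY_velocity(2)[OF c(1) t p]
  let ?n = "\<Sum>i\<in>UNIV. (y t $ i) *\<^sub>R Dd (Hc c t) ?p (axis i 1) + (?y' $ i) *\<^sub>R Dd (Y c t) ?p (axis i 1)"
  have n: "?n = Dd (Hc c t) ?p (y t) + Dd (Y c t) ?p ?y'"
    by (simp only: sum.distrib linear_axis_expand[OF linear_Dd[OF dH], of "y t"] linear_axis_expand[OF li.linear_Y1[OF p], of ?y'])
  have "((\<lambda>s. \<Sum>i\<in>UNIV. (y s $ i) *\<^sub>R Dd (Y c s) ?p (axis i 1)) has_vector_derivative ?n) (at t within I)"
    by (intro has_vector_derivative_sum bounded_bilinear.has_vector_derivative[OF bounded_bilinear_scaleR]
        bounded_linear.has_vector_derivative[OF bounded_linear_vec_nth y] DY)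
  then have "((\<lambda>s. Dd (Y c s) ?p (y s)) has_vector_derivative ?n) (at t within I)"
    by (rule has_vector_derivative_transform[OF t, rotated])
      (rule linear_axis_expand[OF frame_linear[OF frame_Y[OF c]]])
  moreover have "flat_form \<epsilon> ?n (Dd (Y c t) ?p w) = 0" for w
    using transport_form[OF c t, of "y t" w] li.metric_velocity[OF p h dH, of "y t" w] h[OF p]
    unfolding n by (simp add: flat_form_simps pull_form_def)
  ultimately show thesis by (rule that)
qed

lemma constant_on_I:
  assumes "\<And>t. t \<in> I \<Longrightarrow> (f has_vector_derivative 0) (at t within I)" "t \<in> I" shows "f t = f 0"
proof -
  obtain k where "\<And>s. s \<in> I \<Longrightarrow> f s = k"
    by (rule has_vector_derivative_zero_constant[OF is_interval_convex[OF interval(1)] assms(1)]) (assumption, rule that)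
  then show ?thesis using assms(2) interval(2) by simp
qed

text \<open>The images of both curves under the differential have normal velocities, while the
  images themselves are tangent; so the derivative of their product vanishes.\<close>

lemma transport_isometry:
  assumes c: "c \<in> \<A>" "x \<in> fst c"
    and y: "\<And>t. t \<in> I \<Longrightarrow> (y has_vector_derivative transport c x t *v y t) (at t within I)"
    and z: "\<And>t. t \<in> I \<Longrightarrow> (z has_vector_derivative transport c x t *v z t) (at t within I)"
    and t: "t \<in> I"
  shows "G c t (snd c x) (y t) (z t) = G c 0 (snd c x) (y 0) (z 0)"
proof -
  have "((\<lambda>s. G c s (snd c x) (y s) (z s)) has_vector_derivative 0) (at t within I)" if t: "t \<in> I" for t
  proof -
    obtain a where a: "((\<lambda>s. Dd (Y c s) (snd c x) (y s)) has_vector_derivative a) (at t within I)"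
      "\<And>w. flat_form \<epsilon> a (Dd (Y c t) (snd c x) w) = 0" using transport_velocity[OF c t y[OF t]] by blast
    obtain b where b: "((\<lambda>s. Dd (Y c s) (snd c x) (z s)) has_vector_derivative b) (at t within I)"
      "\<And>w. flat_form \<epsilon> b (Dd (Y c t) (snd c x) w) = 0" using transport_velocity[OF c t z[OF t]] by blast
    have "((\<lambda>s. G c s (snd c x) (y s) (z s)) has_vector_derivative
        flat_form \<epsilon> (Dd (Y c t) (snd c x) (y t)) b + flat_form \<epsilon> a (Dd (Y c t) (snd c x) (z t))) (at t within I)"
      unfolding pull_form_def
      by (rule bounded_bilinear.has_vector_derivative[OF bounded_bilinear_flat_form a(1) b(1)])
    then show ?thesis using b(2)[of "y t"] by (simp add: a(2) flat_form_sym[of \<epsilon> _ b])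
  qed
  from constant_on_I[OF this t] show ?thesis .
qed

text \<open>The Jacobian carries the metric of one chart to that of the other at every time, hence
  also the time derivatives that define the coefficient. A solution found in one chart is therefore
  parallel in all charts.\<close>

lemma transport_chart_change:
  assumes c: "c \<in> \<A>" "x \<in> fst c" and c': "c' \<in> \<A>" "x \<in> fst c'" and t: "t \<in> I"
  shows "Dd (snd c' \<circ> cinv c) (snd c x) (transport c x t *v y) = transport c' x t *v Dd (snd c' \<circ> cinv c) (snd c x) y"
proof (rule pos_form_eqI[OF pos_G[OF c' t]])
  let ?J = "Dd (snd c' \<circ> cinv c) (snd c x)"
  fix w'
  have J: "coord_vec \<A> c x u c' = ?J u" for u using c' by (simp add: coord_vec_def)
  have GJ: "G c' s (snd c' x) (?J u) (?J v) = G c s (snd c x) u v" if s: "s \<in> I" for s u v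
    using g_chart[OF c' s coord_vec_tangent(1)[OF c] coord_vec_tangent(1)[OF c], of u v]
      g_chart[OF c s coord_vec_tangent(1)[OF c] coord_vec_tangent(1)[OF c], of u v]
    by (simp only: J coord_vec_tangent(2)[OF c])
  define w where "w = coord_vec \<A> c' x w' c"
  have "coord_vec \<A> c' x w' c' = ?J w"
    using coord_vec_tangent(1)[OF c', of w'] c c' unfolding tangent_space_def w_def by blast
  then have w': "w' = ?J w" by (simp only: coord_vec_tangent(2)[OF c'])
  have "((\<lambda>s. G c s (snd c x) y w) has_vector_derivative
      - 2 * flat_form \<epsilon> (Hc c' t (snd c' x)) (second_fund \<epsilon> (Y c' t) (snd c' x) (?J y) w')) (at t within I)"
    using pull_form_velocity[OF c'(1) t chart_image[OF c'(2)], of "?J y" w']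
    by (rule has_vector_derivative_transform[OF t, rotated]) (simp only: w' GJ)
  from vector_derivative_unique_within[OF right_open_not_bot[OF I t] this pull_form_velocity[OF c(1) t chart_image[OF c(2)]]]
  show "G c' t (snd c' x) (?J (transport c x t *v y)) w' = G c' t (snd c' x) (transport c' x t *v ?J y) w'"
    by (simp only: transport_form[OF c' t]) (simp add: w' GJ[OF t] transport_form[OF c t])
qed

text \<open>Transport preserves the metrics, so it takes an orthonormal basis at time \<open>0\<close> to one at time \<open>t0\<close>;
  expanding \<open>v\<close> in the latter avoids solving the equation backwards.\<close>

lemma parallel_through:
  assumes x: "x \<in> topspace S" and t0: "t0 \<in> I" and v: "v \<in> tangent_space \<A> x"
  obtains V where "intrinsically_parallel \<A> I g x V" "V t0 = v"
proof -
  define c where "c = chart_at \<A> x"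
  have c: "c \<in> \<A>" "x \<in> fst c" using chart_at[OF x] by (auto simp: c_def)
  let ?p = "snd c x"
  obtain E where E: "orthonormal_family (G c 0 ?p) E" using pos_form_orthonormal_family[OF pos_G[OF c interval(2)]] by blast
  have "\<exists>y. y 0 = E i \<and> (\<forall>t\<in>I. (y has_vector_derivative transport c x t *v y t) (at t within I))" for i
    using linear_ode_exists[OF I interval transport_continuous[OF c], of "E i"] by metis
  then obtain y where y: "\<And>i. y i 0 = E i"
    "\<And>i t. t \<in> I \<Longrightarrow> (y i has_vector_derivative transport c x t *v y i t) (at t within I)" by metis
  have "orthonormal_family (G c t0 ?p) (\<lambda>i. y i t0)"
    using E transport_isometry[OF c y(2) y(2) t0] y(1) by (simp add: orthonormal_family_def)
  then have exp: "(\<Sum>i\<in>UNIV. G c t0 ?p (v c) (y i t0) *\<^sub>R y i t0) = v c"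
    by (rule orthonormal_expand[OF pos_G[OF c t0]])
  define z where "z = (\<lambda>t. \<Sum>i\<in>UNIV. G c t0 ?p (v c) (y i t0) *\<^sub>R y i t)"
  have z: "(z has_vector_derivative transport c x t *v z t) (at t within I)" if t: "t \<in> I" for t
  proof -
    have "(z has_vector_derivative (\<Sum>i\<in>UNIV. G c t0 ?p (v c) (y i t0) *\<^sub>R (transport c x t *v y i t))) (at t within I)"
      unfolding z_def
      by (intro has_vector_derivative_sum bounded_linear.has_vector_derivative[OF bounded_linear_scaleR_right] y(2) t)
    then show ?thesis
      by (simp add: z_def linear_sum[OF matrix_vector_mul_linear] matrix_vector_mult_scaleR)
  qed
  let ?V = "\<lambda>t. coord_vec \<A> c x (z t)"
  show thesis
  proof (rule that[of ?V])
    show "?V t0 = v" using tangent_eq_coord_vec[OF c v] exp by (simp add: z_def)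
    show "intrinsically_parallel \<A> I g x ?V"
      unfolding intrinsically_parallel_iff
    proof (intro conjI ballI impI)
      show "?V t \<in> tangent_space \<A> x" for t by (rule coord_vec_tangent(1)[OF c])
      fix c' t assume c': "c' \<in> \<A>" "x \<in> fst c'" and t: "t \<in> I"
      let ?J = "Dd (snd c' \<circ> cinv c) (snd c x)"
      have J: "coord_vec \<A> c x u c' = ?J u" for u using c' by (simp add: coord_vec_def)
      have "bounded_linear ?J"
        using linear_Dd[OF transition_differentiable[OF c(1) c'(1) c(2) c'(2)]] linear_conv_bounded_linear by blast
      from bounded_linear.has_vector_derivative[OF this z[OF t]]
      show "((\<lambda>s. ?V s c') has_vector_derivative transport c' x t *v ?V t c') (at t within I)"
        by (simp only: J transport_chart_change[OF c c' t])
    qed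
  qed
qed

lemma extrinsically_parallelD:
  assumes "extrinsically_parallel \<epsilon> I \<rho> x w" and c: "c \<in> \<A>" "x \<in> fst c" and t: "t \<in> I"
  obtains u w' where "w t = Dd (Y c t) (snd c x) u" "(w has_vector_derivative w') (at t within I)"
    "\<And>u. flat_form \<epsilon> w' (Dd (Y c t) (snd c x) u) = 0"
proof -
  obtain w' where w: "w t \<in> subspace_of (\<rho> t x)" "(w has_vector_derivative w') (at t within I)"
    "tan_proj \<epsilon> (subspace_of (\<rho> t x)) w' = 0"
    using assms(1) t unfolding extrinsically_parallel_def by blast
  obtain z where z: "tan_proj \<epsilon> (range (Dd (Y c t) (snd c x))) w' = Dd (Y c t) (snd c x) z"
    "\<And>u. flat_form \<epsilon> (w' - Dd (Y c t) (snd c x) z) (Dd (Y c t) (snd c x) u) = 0"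
    using tan_proj_frame[OF e frame_Y[OF c t], of w'] by blast
  have "Dd (Y c t) (snd c x) z = 0" using z(1) w(3) by (simp only: subspace_rho[OF c t])
  then have "flat_form \<epsilon> w' (Dd (Y c t) (snd c x) u) = 0" for u using z(2)[of u] by simp
  moreover obtain u where "w t = Dd (Y c t) (snd c x) u" using w(1) unfolding subspace_rho[OF c t] by blast
  ultimately show thesis using w(2) that by blast
qed

lemma parallel_family_mdiff: "parallel_family \<epsilon> \<A> I \<rho> g X0 (\<lambda>t x v. mdiff \<A> (X t) x v)"
  unfolding parallel_family_def topspace_eq
proof (intro ballI conjI allI impI)
  fix x assume x: "x \<in> topspace S"
  define c where "c = chart_at \<A> x"
  have c: "c \<in> \<A>" "x \<in> fst c" using chart_at[OF x] by (auto simp: c_def)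
  show "mdiff \<A> (X 0) x v = mdiff \<A> X0 x v" for v by (simp only: mdiff_cong[OF initial x])
  fix t v assume t: "t \<in> I" and v: "v \<in> tangent_space \<A> x"
  show "mdiff \<A> (X t) x v \<in> subspace_of (\<rho> t x)"
    unfolding subspace_rho[OF c t] mdiff_immersion[OF imm[OF t] c v] by blast
  fix w a b assume w: "w \<in> tangent_space \<A> x"
  note lin = frame_linear[OF frame_Y[OF c t]]
  show "mdiff \<A> (X t) x (tlin a v b w) = a *\<^sub>R mdiff \<A> (X t) x v + b *\<^sub>R mdiff \<A> (X t) x w"
    unfolding mdiff_immersion[OF imm[OF t] c v] mdiff_immersion[OF imm[OF t] c w]
      mdiff_immersion[OF imm[OF t] c tlin_tangent[OF x v w]]
    by (simp add: tlin_def linear_add[OF lin] linear_scale[OF lin])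
next
  fix x v assume x: "x \<in> topspace S" and v: "intrinsically_parallel \<A> I g x v"
  define c where "c = chart_at \<A> x"
  have c: "c \<in> \<A>" "x \<in> fst c" using chart_at[OF x] by (auto simp: c_def)
  have vt: "v t \<in> tangent_space \<A> x" if "t \<in> I" for t using v that by (simp add: intrinsically_parallel_iff)
  have md: "mdiff \<A> (X t) x (v t) = Dd (Y c t) (snd c x) (v t c)" if "t \<in> I" for t
    by (rule mdiff_immersion[OF imm[OF that] c vt[OF that]])
  show "extrinsically_parallel \<epsilon> I \<rho> x (\<lambda>t. mdiff \<A> (X t) x (v t))"
    unfolding extrinsically_parallel_def
  proof (intro ballI conjI)
    fix t assume t: "t \<in> I"
    show "mdiff \<A> (X t) x (v t) \<in> subspace_of (\<rho> t x)"
      unfolding subspace_rho[OF c t] md[OF t] by blast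
    have "((\<lambda>s. v s c) has_vector_derivative transport c x t *v v t c) (at t within I)"
      using v c t by (simp add: intrinsically_parallel_iff)
    from transport_velocity[OF c t this] obtain n where
      n: "((\<lambda>s. Dd (Y c s) (snd c x) (v s c)) has_vector_derivative n) (at t within I)"
        "\<And>w. flat_form \<epsilon> n (Dd (Y c t) (snd c x) w) = 0" by blast
    have "((\<lambda>s. mdiff \<A> (X s) x (v s)) has_vector_derivative n) (at t within I)"
      using n(1) by (rule has_vector_derivative_transform[OF t, rotated]) (rule md)
    moreover have "tan_proj \<epsilon> (subspace_of (\<rho> t x)) n = 0"
      unfolding subspace_rho[OF c t]
      using tan_proj_unique[OF e frame_Y[OF c t], of n 0] n(2) linear_0[OF frame_linear[OF frame_Y[OF c t]]] by simp
    ultimately show "\<exists>w'. ((\<lambda>t. mdiff \<A> (X t) x (v t)) has_vector_derivative w') (at t within I) \<and>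
        tan_proj \<epsilon> (subspace_of (\<rho> t x)) w' = 0" by blast
  qed
qed

text \<open>The difference of two extrinsically parallel curves has constant length.\<close>

lemma extrinsically_parallel_unique:
  assumes w1: "extrinsically_parallel \<epsilon> I \<rho> x w1" and w2: "extrinsically_parallel \<epsilon> I \<rho> x w2"
    and x: "x \<in> topspace S" and init: "w1 0 = w2 0" and t: "t \<in> I"
  shows "w1 t = w2 t"
proof -
  define c where "c = chart_at \<A> x"
  have c: "c \<in> \<A>" "x \<in> fst c" using chart_at[OF x] by (auto simp: c_def)
  let ?N = "\<lambda>s. flat_form \<epsilon> (w1 s - w2 s) (w1 s - w2 s)"
  have "(?N has_vector_derivative 0) (at s within I)" if s: "s \<in> I" for s
  proof -
    let ?f = "Dd (Y c s) (snd c x)"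
    obtain u1 d1 where 1: "w1 s = ?f u1" "(w1 has_vector_derivative d1) (at s within I)" "\<And>u. flat_form \<epsilon> d1 (?f u) = 0"
      using extrinsically_parallelD[OF w1 c s] by blast
    obtain u2 d2 where 2: "w2 s = ?f u2" "(w2 has_vector_derivative d2) (at s within I)" "\<And>u. flat_form \<epsilon> d2 (?f u) = 0"
      using extrinsically_parallelD[OF w2 c s] by blast
    note d = has_vector_derivative_diff[OF 1(2) 2(2)]
    have "flat_form \<epsilon> (d1 - d2) (w1 s - w2 s) = 0"
      by (simp add: 1 2 flat_form_simps)
    then show ?thesis
      using bounded_bilinear.has_vector_derivative[OF bounded_bilinear_flat_form[of \<epsilon>] d d]
      by (simp add: flat_form_sym[of \<epsilon> "w1 s - w2 s" "d1 - d2"])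
  qed
  from constant_on_I[OF this t] have "?N t = 0" using init by (simp add: flat_form_simps)
  moreover obtain u where u: "w1 t - w2 t = Dd (Y c t) (snd c x) u"
  proof -
    obtain u1 where 1: "w1 t = Dd (Y c t) (snd c x) u1" using extrinsically_parallelD[OF w1 c t] by blast
    obtain u2 where 2: "w2 t = Dd (Y c t) (snd c x) u2" using extrinsically_parallelD[OF w2 c t] by blast
    show thesis by (rule that[of "u1 - u2"]) (simp add: 1 2 linear_diff[OF frame_linear[OF frame_Y[OF c t]]])
  qed
  ultimately have "G c t (snd c x) u u = 0" by (simp add: pull_form_def)
  then have "u = 0" using pos_formD(3)[OF pos_G[OF c t], of u] by force
  then show ?thesis using u linear_0[OF frame_linear[OF frame_Y[OF c t]]] by simp
qed

text \<open>A family is constrained only along parallel curves, but each tangent vector at each time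
  lies on one. Along it both images are extrinsically parallel and agree at time
  \<open>0\<close>.\<close>

lemma parallel_family_unique:
  assumes \<Psi>: "parallel_family \<epsilon> \<A> I \<rho> g X0 \<Psi>" and t: "t \<in> I" and x: "x \<in> topspace S" and v: "v \<in> tangent_space \<A> x"
  shows "\<Psi> t x v = mdiff \<A> (X t) x v"
proof -
  obtain V where V: "intrinsically_parallel \<A> I g x V" "V t = v" using parallel_through[OF x t v] by blast
  have V0: "V 0 \<in> tangent_space \<A> x" using V(1) interval(2) by (simp add: intrinsically_parallel_iff)
  have "\<Psi> t x (V t) = mdiff \<A> (X t) x (V t)"
  proof (rule extrinsically_parallel_unique[OF _ _ x _ t])
    show "extrinsically_parallel \<epsilon> I \<rho> x (\<lambda>t. \<Psi> t x (V t))"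
      using \<Psi> V(1) x unfolding parallel_family_def topspace_eq by blast
    show "extrinsically_parallel \<epsilon> I \<rho> x (\<lambda>t. mdiff \<A> (X t) x (V t))"
      using parallel_family_mdiff V(1) x unfolding parallel_family_def topspace_eq by blast
    have "\<Psi> 0 x (V 0) = mdiff \<A> X0 x (V 0)"
      using \<Psi> x V0 unfolding parallel_family_def topspace_eq by blast
    then show "\<Psi> 0 x (V 0) = mdiff \<A> (X 0) x (V 0)" by (simp only: mdiff_cong[OF initial x])
  qed
  then show ?thesis by (simp only: V(2))
qed

lemma isometry_onto_mdiff:
  assumes t: "t \<in> I" and x: "x \<in> topspace S"
  shows "isometry_onto \<epsilon> \<A> (g t) x (mdiff \<A> (X t) x) (\<rho> t x)"
proof -
  define c where "c = chart_at \<A> x"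
  have c: "c \<in> \<A>" "x \<in> fst c" using chart_at[OF x] by (auto simp: c_def)
  note md = mdiff_immersion[OF imm[OF t] c]
  have "mdiff \<A> (X t) x ` tangent_space \<A> x = range (Dd (Y c t) (snd c x))"
  proof (intro set_eqI iffI)
    fix w assume "w \<in> range (Dd (Y c t) (snd c x))"
    then obtain u where "w = Dd (Y c t) (snd c x) u" by blast
    then have "w = mdiff \<A> (X t) x (coord_vec \<A> c x u)"
      using md[OF coord_vec_tangent(1)[OF c], of u] coord_vec_tangent(2)[OF c] by simp
    then show "w \<in> mdiff \<A> (X t) x ` tangent_space \<A> x" using coord_vec_tangent(1)[OF c] by blast
  qed (use md in blast)
  then show ?thesis
    unfolding isometry_onto_def subspace_rho[OF c t] using g[OF t x] by (simp add: induced_metric_def)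
qed

text \<open>With the differential of \<open>X t\<close> in place of \<open>\<Phi>\<close>, each
  summand is the second fundamental form on a basis vector. The basis is picked by the choice
  operator, so some orthonormal basis is exhibited first.\<close>

lemma tr_Phi_mean_curvature:
  assumes t: "t \<in> I" and c: "c \<in> \<A>" "x \<in> fst c"
  shows "tr_Phi \<epsilon> \<A> (\<rho> t) (g t) x (mdiff \<A> (X t) x) = mean_curvature \<epsilon> \<A> c (X t) x"
proof -
  interpret li: local_immersion \<epsilon> "cimage c" "Y c t" by (rule local_imm[OF c(1) t])
  let ?p = "snd c x"
  let ?C = "\<lambda>E :: 'n \<Rightarrow> ('a, 'n) tvec. \<forall>i j. E i \<in> tangent_space \<A> x \<and> g t x (E i) (E j) = (if i = j then 1 else 0)"
  obtain E0 where "orthonormal_family (G c t ?p) E0" using pos_form_orthonormal_family[OF pos_G[OF c t]] by blast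
  then have "?C (\<lambda>i. coord_vec \<A> c x (E0 i))"
    using g_chart[OF c t coord_vec_tangent(1)[OF c] coord_vec_tangent(1)[OF c]]
    by (simp add: orthonormal_family_def coord_vec_tangent[OF c])
  then have "?C (SOME E. ?C E)" by (rule someI[of ?C])
  moreover define E where "E = (SOME E. ?C E)"
  ultimately have E: "E i \<in> tangent_space \<A> x" "g t x (E i) (E j) = (if i = j then 1 else 0)" for i j by blast+
  have ort: "orthonormal_family (G c t ?p) (\<lambda>i. E i c)"
    unfolding orthonormal_family_def using E(2) g_chart[OF c t E(1) E(1)] by simp
  have gc: "grass_diff \<epsilon> \<A> (\<rho> t) x = grass_diff \<epsilon> \<A> (gauss_map \<A> (X t)) x"
    by (rule grass_diff_cong[OF _ chart_top[OF c]]) (rule rho[OF t])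
  have gd: "grass_diff \<epsilon> \<A> (\<rho> t) x (E i) (mdiff \<A> (X t) x (E i)) = second_fund \<epsilon> (Y c t) ?p (E i c) (E i c)" for i
    unfolding gc mdiff_immersion[OF imm[OF t] c E(1)]
    by (rule grass_diff_gauss[OF e imm[OF t] c E(1)])
  have "tr_Phi \<epsilon> \<A> (\<rho> t) (g t) x (mdiff \<A> (X t) x) = (\<Sum>i\<in>UNIV. second_fund \<epsilon> (Y c t) ?p (E i c) (E i c))"
    by (simp only: tr_Phi_def Let_def E_def[symmetric] gd)
  also have "\<dots> = tr_metric (G c t ?p) (second_fund \<epsilon> (Y c t) ?p)"
    by (rule tr_metric_orthonormal[OF pos_formD(1)[OF pos_G[OF c t]] ort li.bilinear_A[OF chart_image[OF c(2)]], symmetric])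
  also have "\<dots> = mean_curvature \<epsilon> \<A> c (X t) x"
    using mean_curvature_H[OF c(1) t chart_image[OF c(2)]] cinv_left[OF c] by simp
  finally show ?thesis .
qed

lemma X_velocity:
  assumes t: "t \<in> I" and x: "x \<in> topspace S"
  shows "((\<lambda>s. X s x) has_vector_derivative tr_Phi \<epsilon> \<A> (\<rho> t) (g t) x (mdiff \<A> (X t) x)) (at t within I)"
proof -
  define c where "c = chart_at \<A> x"
  have c: "c \<in> \<A>" "x \<in> fst c" using chart_at[OF x] by (auto simp: c_def)
  show ?thesis unfolding tr_Phi_mean_curvature[OF t c] using MCF c t unfolding MCF_solution_def by blast
qed

lemma reconstruction_X: "reconstruction_ODE \<epsilon> \<A> I \<rho> g X0 (\<lambda>t x v. mdiff \<A> (X t) x v) X"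
  unfolding reconstruction_ODE_def topspace_eq using initial X_velocity by simp

text \<open>The right-hand side of the equation does not contain the unknown, so two solutions
  differ by a constant in time.\<close>

lemma reconstruction_unique:
  assumes Z: "reconstruction_ODE \<epsilon> \<A> I \<rho> g X0 (\<lambda>t x v. mdiff \<A> (X t) x v) Z" and t: "t \<in> I" and x: "x \<in> topspace S"
  shows "Z t x = X t x"
proof -
  have "((\<lambda>s. Z s x - X s x) has_vector_derivative 0) (at s within I)" if s: "s \<in> I" for s
  proof -
    have "((\<lambda>s. Z s x) has_vector_derivative tr_Phi \<epsilon> \<A> (\<rho> s) (g s) x (mdiff \<A> (X s) x)) (at s within I)"
      using Z s x unfolding reconstruction_ODE_def topspace_eq by simp
    from has_vector_derivative_diff[OF this X_velocity[OF s x]] show ?thesis by simp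
  qed
  from constant_on_I[OF this t] have "Z t x - X t x = Z 0 x - X 0 x" .
  moreover have "Z 0 x = X0 x" using Z x unfolding reconstruction_ODE_def topspace_eq by simp
  ultimately show ?thesis using initial[OF x] by simp
qed

end

theorem theorem1p1:
  fixes S :: "'a topology"
    and \<A> :: "('a, 'n::finite) chart set"
    and \<epsilon> :: real and T :: ereal and I :: "real set"
    and X0 :: "'a \<Rightarrow> real^('n + 'k::finite)"
    and X :: "real \<Rightarrow> 'a \<Rightarrow> real^('n + 'k)"
    and \<rho> :: "real \<Rightarrow> 'a \<Rightarrow> ('n, 'k) osub"
    and g :: "real \<Rightarrow> ('a, 'n) mmetric"
  assumes sign: "\<epsilon> = 1 \<or> \<epsilon> = -1"
    and time: "0 < T" "I = {t. 0 \<le> t \<and> ereal t < T}"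
    and manifold: "oriented_manifold S \<A>"
    and immersed: "immersion \<epsilon> \<A> X0"
    and compact_or_complete: "compact_space S \<or> complete_metric S \<A> (induced_metric \<epsilon> \<A> X0)"
    and MCF: "MCF_solution \<epsilon> \<A> I X0 X"
    and MCF_unique: "\<And>Y. MCF_solution \<epsilon> \<A> I X0 Y \<Longrightarrow> \<forall>t\<in>I. \<forall>x\<in>topspace S. Y t x = X t x"
    and HRF: "HRF_solution \<epsilon> (- \<epsilon>) \<A> I (gauss_map \<A> X0) (induced_metric \<epsilon> \<A> X0) \<rho> g"
    and HRF_unique: "\<And>\<sigma> h. HRF_solution \<epsilon> (- \<epsilon>) \<A> I (gauss_map \<A> X0) (induced_metric \<epsilon> \<A> X0) \<sigma> h \<Longrightarrow>
      \<forall>t\<in>I. \<forall>x\<in>topspace S. \<sigma> t x = \<rho> t x \<and>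
        (\<forall>v\<in>tangent_space \<A> x. \<forall>w\<in>tangent_space \<A> x. h t x v w = g t x v w)"
  shows "(\<forall>t\<in>I. \<forall>x\<in>topspace S. gauss_map \<A> (X t) x = \<rho> t x \<and>
      (\<forall>v\<in>tangent_space \<A> x. \<forall>w\<in>tangent_space \<A> x.
         induced_metric \<epsilon> \<A> (X t) x v w = g t x v w)) \<and>
    (\<exists>\<Phi>. parallel_family \<epsilon> \<A> I \<rho> g X0 \<Phi> \<and>
      (\<forall>\<Psi>. parallel_family \<epsilon> \<A> I \<rho> g X0 \<Psi> \<longrightarrow>
         (\<forall>t\<in>I. \<forall>x\<in>topspace S. \<forall>v\<in>tangent_space \<A> x. \<Psi> t x v = \<Phi> t x v)) \<and>
      (\<forall>t\<in>I. \<forall>x\<in>topspace S. isometry_onto \<epsilon> \<A> (g t) x (\<Phi> t x) (\<rho> t x)) \<and>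
      (\<exists>Z. reconstruction_ODE \<epsilon> \<A> I \<rho> g X0 \<Phi> Z) \<and>
      (\<forall>Z. reconstruction_ODE \<epsilon> \<A> I \<rho> g X0 \<Phi> Z \<longrightarrow> (\<forall>t\<in>I. \<forall>x\<in>topspace S. Z t x = X t x)))"
proof -
  have right: "right_open I"
    unfolding right_open_def
  proof
    fix t assume "t \<in> I"
    \<comment> \<open>A real number strictly between \<open>t\<close> and \<open>T\<close> exists
      also for infinite \<open>T\<close>; it gives the room to the right of
      \<open>t\<close>.\<close>
    then obtain r where r: "ereal t < ereal r" "ereal r < T" "0 \<le> t"
      using ereal_dense2[of "ereal t" T] time(2) by auto
    have "{t..t + (r - t)} \<subseteq> I"
    proof
      fix s assume "s \<in> {t..t + (r - t)}"
      then have "0 \<le> s" "ereal s \<le> ereal r" using r(3) by auto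
      then show "s \<in> I" using le_less_trans[OF _ r(2)] time(2) by blast
    qed
    then show "\<exists>h>0. {t..t + h} \<subseteq> I" using r(1) by (intro exI[of _ "r - t"]) auto
  qed
  have interval: "is_interval I"
    unfolding is_interval_1
  proof (intro ballI allI impI)
    fix a b s assume "a \<in> I" "b \<in> I" "a \<le> s \<and> s \<le> b"
    then have "0 \<le> s" "ereal s \<le> ereal b" "ereal b < T" using time(2) by auto
    then show "s \<in> I" using le_less_trans time(2) by blast
  qed
  have zero: "0 \<in> I" "I \<subseteq> {0..}" using time by (auto simp: zero_ereal_def)
  interpret mcf_flow S \<A> \<epsilon> I X0 X
    using manifold sign right MCF by unfold_locales
  \<comment> \<open>The Gauss map and the induced metric of \<open>X\<close> solve the
    harmonic-Ricci flow with the same initial data, so uniqueness identifies them with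
    \<open>\<rho>\<close> and \<open>g\<close>.\<close>
  note agree = HRF_unique[OF HRF_of_MCF]
  interpret mcf_hrf S \<A> \<epsilon> I X0 X \<rho> g
    using interval zero agree by unfold_locales auto
  show ?thesis
  proof (intro conjI exI[of _ "\<lambda>t x v. mdiff \<A> (X t) x v"])
    show "\<forall>t\<in>I. \<forall>x\<in>topspace S. gauss_map \<A> (X t) x = \<rho> t x \<and>
      (\<forall>v\<in>tangent_space \<A> x. \<forall>w\<in>tangent_space \<A> x. induced_metric \<epsilon> \<A> (X t) x v w = g t x v w)"
      by (rule agree)
    show "\<exists>Z. reconstruction_ODE \<epsilon> \<A> I \<rho> g X0 (\<lambda>t x v. mdiff \<A> (X t) x v) Z"
      using reconstruction_X by blast
  qed (use parallel_family_mdiff parallel_family_unique isometry_onto_mdiff reconstruction_unique in blast)+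
qed

end
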